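(* Consider the Midas-LL1 algorithm (with variance-reduced stochastic gradient estimator) for the regularized rank-$(L_r,L_r,1)$ block-term decomposition problem, with all objects as defined in the context. Suppose Assumption (A) of the context holds, the stepsize $\eta^k$ lies in $[\underline\eta,\bar\eta]$, and $$\delta=\underline b-\sum_{j=1}^{t+1}(j+1)\bar a_j>0\quad\text{and}\quad (t+2)\bar a_{t+1}-\frac{\gamma}{2}>0 .$$ Let the sequence $\{A_1^k,A_2^k,A_3^k\}_{k\in\mathbb N}$ produced by the algorithm remain bounded for all $k$. Then there exists $0<\sigma<\rho$ such that $$\mathbb E\big[\mathrm{dist}(0,\partial\Phi(A^{\hat k}))^2\big]\le\frac{\bar\mu}{(\rho-\sigma)K}\Big(\mathbb E\Psi_1+\frac{3(\rho-\sigma)}{\tau\bar\mu}\,\mathbb E\Gamma_1\Big)=\mathcal O(1/K),$$ where $K$ is a positive integer and $\hat k$ is drawn from $\{2,\dots,K+1\}$. This implies that at most $\mathcal O(\varepsilon^{-2})$ iterations are required in expectation to reach an $\varepsilon$-stationary point of $\Phi$.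
   Context: **Problem.** Let $\mathcal X\in\mathbb R^{I_1\times I_2\times I_3}$, $R\ge1$, and positive integers $L_1,\dots,L_R$. The variable is $A=(A_1,A_2,A_3)$ with $A_n=[A_{n,1},\dots,A_{n,R}]$, where $A_{n,r}\in\mathbb R^{I_n\times L_r}$ for $n=1,2$ and $A_{3,r}\in\mathbb R^{I_3}$. Put $$f(A)=\frac{1}{2I_1I_2I_3}\Big\|\mathcal X-\sum_{r=1}^R (A_{1,r}A_{2,r}^\top)\circ A_{3,r}\Big\|_F^2,\qquad \Phi(A)=f(A)+\sum_{n=1}^3h_n(A_n),$$ where $\circ$ is the outer product and $h_n(A_n)=\sum_{r=1}^R h_n(A_{n,r})$ (same symbol for the pieces). $\|A\|_F^2=\sum_n\|A_n\|_F^2$. $\partial$ is the limiting subdifferential and $\mathrm{dist}(0,S)=\inf_{s\in S}\|s\|_F$. For $\varepsilon>0$, $A^*$ is an $\varepsilon$-stationary point of $\Phi$ if $\mathrm{dist}(0,\partial\Phi(A^* ))\le\varepsilon$. **Algorithm (Midas-LL1).** Given an integer $t\ge1$, stepsizes $\eta^k$, inertial parameters $\alpha^{k+1-i},\beta^{k+1-i}\in[0,1]$, a sample size $B$, and an initial point $A^0$ with $A^{-1}=A^0$ (earlier iterates, where they occur, also equal $A^0$). For $k=0,1,\dots$: sample $n=\xi^k$ uniformly from $\{1,2,3\}$; sample uniformly a set $\mathcal F_n$ of $B$ fiber indices from $\{1,\dots,\prod_{m\ne n}I_m\}$; set $$\tilde A_n^k=A_n^k+\sum_{i=1}^t\alpha^{k+1-i}(A_n^{k+1-i}-A_n^{k-i}),\qquad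 \underline A_n^k=A_n^k+\sum_{i=1}^t\beta^{k+1-i}(A_n^{k+1-i}-A_n^{k-i});$$ compute with this minibatch a stochastic gradient $\tilde\nabla_{A_n}f(\underline A_n^k)$ (column blocks $\tilde\nabla_{A_{n,r}}f(\underline A_n^k)$) that is variance-reduced in the sense below, where $f(\underline A_n^k)$ means $f$ evaluated with block $n$ equal to $\underline A_n^k$ and the other blocks equal to $A_{n'}^k$; for $r=1,\dots,R$ set $$A_{n,r}^{k+1}=\arg\min_{Z}\; h_n(Z)+\langle\tilde\nabla_{A_{n,r}}f(\underline A_n^k),Z-\tilde A_{n,r}^k\rangle+\frac1{2\eta^k}\|Z-\tilde A_{n,r}^k\|_F^2,$$ and $A_{n'}^{k+1}=A_{n'}^k$ for $n'\ne n$. Write $A^k=(A_1^k,A_2^k,A_3^k)$. **Expectations.** $\xi^k$ and $\zeta^k$ are the stochastic parameters for the block index and for the stochastic gradient at iteration $k$. $\mathbb E_k[\cdot]$ is the conditional expectation at iteration $k$, written $\mathbb E[\cdot\,|\,\xi^k,\zeta^k]$, and $\mathbb E[\cdot]$ is the full expectation, written $\mathbb E[\cdot\,|\,\xi^0,\zeta^0,\dots]$. **Assumption (A).** (i) The $h_n$ are proper, lower semicontinuous, bounded from below, and convex. (ii) The sequence $\{A_1^k,A_2^k,A_3^k\}$ generated by the algorithm is bounded for all $k$. By (ii) there is a constant $L$ such that for every mode $n$ and all $Y,Z$ in place of block $n$ (other blocks fixed at the iterates), $\|\nabla_{A_n}f(\dots,Y,\dots)-\nabla_{A_n}f(\dots,Z,\dots)\|_F\le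 L\|Y-Z\|_F$; this $L$ is used below. **Variance-reduced estimator.** There are constants $V_1,V_2,V_\Gamma\ge0$, $\tau\in(0,1]$ and random variables $\{\Gamma_k\}_{k\ge1}$, $\{\Upsilon_k\}_{k\ge1}$ such that: (i) $\mathbb E_k\|\tilde\nabla_{A_{\xi^k}}f(\underline A_{\xi^k}^k)-\nabla_{A_{\xi^k}}f(\underline A_{\xi^k}^k)\|_F^2\le\Gamma_k+V_1\sum_{i=1}^{t+1}\|A^{k+1-i}-A^{k-i}\|_F^2$ and $\mathbb E_k\|\tilde\nabla_{A_{\xi^k}}f(\underline A_{\xi^k}^k)-\nabla_{A_{\xi^k}}f(\underline A_{\xi^k}^k)\|_F\le\Upsilon_k+V_2\sum_{i=1}^{t+1}\|A^{k+1-i}-A^{k-i}\|_F$; (ii) $\mathbb E_k[\Gamma_{k+1}]\le(1-\tau)\Gamma_k+V_\Gamma\sum_{i=1}^{t+1}\|A^{k+1-i}-A^{k-i}\|_F^2$; (iii) if $\lim_{k\to\infty}\mathbb E\|A^k-A^{k-1}\|_F^2=0$, then $\mathbb E\Gamma_k\to0$ and $\mathbb E\Upsilon_k\to0$. **Parameters.** $\gamma=\sqrt{V_\Gamma/\tau+V_1}$, $$b_k=\frac{1-\sum_{i=1}^t\alpha^{k+1-i}-2L\eta^k-\gamma\eta^k}{2\eta^k},\quad \underline b=\liminf_{k\in\mathbb N} b_k,\qquad a_{k,i}=\frac{3Lt(\beta^{k+1-i})^2}{2}+\frac\gamma2+\frac{\alpha^{k+1-i}}{2\eta^k},\quad \bar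 a_i=\limsup_{k\in\mathbb N} a_{k,i}.$$ $\bar a=\min_{1\le i\le t}\bar a_i$, $\rho=\min\{\delta,(t+2)\bar a_{t+1}-\frac\gamma2,\bar a\}$, and $$\Psi_k=\Phi(A^k)+\sum_{i=1}^{t+1}\sum_{j=i}^{t+1}(j+1)\bar a_j\|A^{k+1-i}-A^{k-i}\|_F^2+\frac1{2\tau\gamma}\Gamma_k .$$ With $c_1=\lim_{k\to\infty}\alpha^k$ and $c_2=\lim_{k\to\infty}\beta^k$, $$\bar\mu=3\max\Big\{6L^2+\tfrac{6}{\underline\eta},\; 6L^2t\,c_2^2+3V_1+\tfrac{6t}{\underline\eta}c_1^2,\; 3V_1\Big\}.$$
   Formalization: The bound has EΨ_1 − min(0, inf Φ) in place of EΨ_1 (equal when Φ ≥ 0); ∂Φ(A^0) is assumed nonempty, Γ_k and Υ_k nonnegative, and γ > 0; otherwise the right side may be negative or undefined, or the left side infinite. *)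

theory Defs
  imports "HOL-Probability.Probability" "HOL-Library.Landau_Symbols"
begin

section \<open>Subdifferentials and stationarity\<close>

text \<open>Extended-real-valued functions on a Euclidean space. \<^term>\<open>S\<close> is a linear subspace that plays
  the role of the domain space of \<^term>\<open>h\<close>; values of \<^term>\<open>h\<close> outside \<^term>\<open>S\<close> are irrelevant.\<close>

definition proper_on :: "'a set \<Rightarrow> ('a \<Rightarrow> ereal) \<Rightarrow> bool" where
  "proper_on S h \<longleftrightarrow> (\<forall>x\<in>S. h x \<noteq> -\<infinity>) \<and> (\<exists>x\<in>S. h x \<noteq> \<infinity>)"

definition lsc_on :: "'a::topological_space set \<Rightarrow> ('a \<Rightarrow> ereal) \<Rightarrow> bool" where
  "lsc_on S h \<longleftrightarrow> (\<forall>x\<in>S. h x \<le> Liminf (at x within S) h)"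

definition bounded_below_on :: "'a set \<Rightarrow> ('a \<Rightarrow> ereal) \<Rightarrow> bool" where
  "bounded_below_on S h \<longleftrightarrow> (\<exists>c::real. \<forall>x\<in>S. ereal c \<le> h x)"

definition ereal_convex_on :: "'a::real_vector set \<Rightarrow> ('a \<Rightarrow> ereal) \<Rightarrow> bool" where
  "ereal_convex_on S h \<longleftrightarrow> convex S \<and>
     (\<forall>x\<in>S. \<forall>y\<in>S. \<forall>u v. 0 \<le> u \<and> 0 \<le> v \<and> u + v = 1 \<longrightarrow>
        h (u *\<^sub>R x + v *\<^sub>R y) \<le> ereal u * h x + ereal v * h y)"

definition regular_subdiff :: "('a::euclidean_space \<Rightarrow> ereal) \<Rightarrow> 'a \<Rightarrow> 'a set" where
  "regular_subdiff F x = {v. \<bar>F x\<bar> \<noteq> \<infinity> \<and>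
     0 \<le> Liminf (at x) (\<lambda>y. (F y - F x - ereal (v \<bullet> (y - x))) / ereal (norm (y - x)))}"

definition limiting_subdiff :: "('a::euclidean_space \<Rightarrow> ereal) \<Rightarrow> 'a \<Rightarrow> 'a set" where
  "limiting_subdiff F x = {v. \<bar>F x\<bar> \<noteq> \<infinity> \<and>
     (\<exists>xs vs. xs \<longlonglongrightarrow> x \<and> (\<lambda>m. F (xs m)) \<longlonglongrightarrow> F x \<and>
        (\<forall>m::nat. vs m \<in> regular_subdiff F (xs m)) \<and> vs \<longlonglongrightarrow> v)}"

text \<open>Extended-valued, so that the distance to the empty set is \<open>\<infinity>\<close>
  (\<^const>\<open>infdist\<close> would give \<open>0\<close>).\<close>

definition dist0 :: "'a::real_normed_vector set \<Rightarrow> ennreal" where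
  "dist0 S = (INF s\<in>S. ennreal (norm s))"

definition eps_stationary :: "('a::euclidean_space \<Rightarrow> ereal) \<Rightarrow> real \<Rightarrow> 'a \<Rightarrow> bool" where
  "eps_stationary F \<epsilon> x \<longleftrightarrow> dist0 (limiting_subdiff F x) \<le> ennreal \<epsilon>"

definition grad :: "('a::real_inner \<Rightarrow> real) \<Rightarrow> 'a \<Rightarrow> 'a" where
  "grad F x = (THE D. GDERIV F x :> D)"


section \<open>The block-term decomposition model\<close>

datatype mode = M1 | M2 | M3

instance mode :: finite
proof
  have "(UNIV :: mode set) = {M1, M2, M3}"
    using mode.exhaust by auto
  then show "finite (UNIV :: mode set)"
    by (metis finite.emptyI finite_insert)
qed

text \<open>The row types \<^typ>\<open>'i\<close>, \<^typ>\<open>'j\<close>, \<^typ>\<open>'k\<close> have cardinalities \<open>I\<^sub>1, I\<^sub>2, I\<^sub>3\<close>, and \<^typ>\<open>'r\<close>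
  has cardinality \<open>R\<close>. The type \<^typ>\<open>'c\<close> indexes all \<open>L\<^sub>1 + \<dots> + L\<^sub>R\<close> columns of
  \<open>[A\<^bsub>n,1\<^esub>, \<dots>, A\<^bsub>n,R\<^esub>]\<close> for \<open>n = 1, 2\<close>; a map \<open>blk :: 'c \<Rightarrow> 'r\<close> says to which block a column
  belongs, so \<open>L\<^sub>r = card {c. blk c = r}\<close>, and \<open>L\<^sub>r \<ge> 1\<close> for all \<open>r\<close> means that \<open>blk\<close> is
  surjective. The norm of this product type is the Frobenius norm of the triple.\<close>

type_synonym ('i, 'j, 'k, 'c, 'r) factors = "(real^'c^'i) \<times> (real^'c^'j) \<times> (real^'r^'k)"

definition ll1_tensor ::
  "('c \<Rightarrow> 'r) \<Rightarrow> ('i::finite, 'j::finite, 'k::finite, 'c::finite, 'r::finite) factors \<Rightarrow> real^'k^'j^'i" where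
  "ll1_tensor blk = (\<lambda>(A1, A2, A3).
     \<chi> i j k. \<Sum>r\<in>UNIV. (\<Sum>c | blk c = r. A1 $ i $ c * A2 $ j $ c) * A3 $ k $ r)"

definition ll1_loss ::
  "(real^'k^'j^'i) \<Rightarrow> ('c \<Rightarrow> 'r) \<Rightarrow> ('i::finite, 'j::finite, 'k::finite, 'c::finite, 'r::finite) factors \<Rightarrow> real" where
  "ll1_loss X blk A =
     1 / (2 * real CARD('i) * real CARD('j) * real CARD('k)) * (norm (X - ll1_tensor blk A))\<^sup>2"

text \<open>Since the three factors, and the blocks \<open>A\<^bsub>n,r\<^esub>\<close> of different widths, have different types,
  the factor \<open>A\<^sub>n\<close> and the piece \<open>A\<^bsub>n,r\<^esub>\<close> are identified with their zero-padded versions in the full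
  space; this preserves inner products and Frobenius norms. The range of \<open>piece blk n r\<close> is the
  isometric copy of the space of pieces \<open>A\<^bsub>n,r\<^esub>\<close>.\<close>

fun block :: "mode \<Rightarrow> ('i::finite, 'j::finite, 'k::finite, 'c::finite, 'r::finite) factors
    \<Rightarrow> ('i, 'j, 'k, 'c, 'r) factors" where
  "block M1 (A1, A2, A3) = (A1, 0, 0)"
| "block M2 (A1, A2, A3) = (0, A2, 0)"
| "block M3 (A1, A2, A3) = (0, 0, A3)"

fun piece :: "('c \<Rightarrow> 'r) \<Rightarrow> mode \<Rightarrow> 'r
    \<Rightarrow> ('i::finite, 'j::finite, 'k::finite, 'c::finite, 'r::finite) factors \<Rightarrow> ('i, 'j, 'k, 'c, 'r) factors" where
  "piece blk M1 r (A1, A2, A3) = (\<chi> i c. if blk c = r then A1 $ i $ c else 0, 0, 0)"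
| "piece blk M2 r (A1, A2, A3) = (0, \<chi> j c. if blk c = r then A2 $ j $ c else 0, 0)"
| "piece blk M3 r (A1, A2, A3) = (0, 0, \<chi> k s. if s = r then A3 $ k $ s else 0)"

text \<open>\<^term>\<open>with_block n Y A\<close> is \<^term>\<open>A\<close> with its factor \<open>n\<close> replaced by the factor \<open>n\<close> of \<^term>\<open>Y\<close>.\<close>

fun with_block :: "mode \<Rightarrow> ('i::finite, 'j::finite, 'k::finite, 'c::finite, 'r::finite) factors
    \<Rightarrow> ('i, 'j, 'k, 'c, 'r) factors \<Rightarrow> ('i, 'j, 'k, 'c, 'r) factors" where
  "with_block M1 (Y1, Y2, Y3) (A1, A2, A3) = (Y1, A2, A3)"
| "with_block M2 (Y1, Y2, Y3) (A1, A2, A3) = (A1, Y2, A3)"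
| "with_block M3 (Y1, Y2, Y3) (A1, A2, A3) = (A1, A2, Y3)"

definition partial_grad :: "(real^'k^'j^'i) \<Rightarrow> ('c \<Rightarrow> 'r) \<Rightarrow> mode
    \<Rightarrow> ('i::finite, 'j::finite, 'k::finite, 'c::finite, 'r::finite) factors \<Rightarrow> ('i, 'j, 'k, 'c, 'r) factors" where
  "partial_grad X blk n A = block n (grad (ll1_loss X blk) A)"

definition ll1_objective :: "(real^'k^'j^'i) \<Rightarrow> ('c \<Rightarrow> 'r)
    \<Rightarrow> (mode \<Rightarrow> 'r \<Rightarrow> ('i::finite, 'j::finite, 'k::finite, 'c::finite, 'r::finite) factors \<Rightarrow> ereal)
    \<Rightarrow> ('i, 'j, 'k, 'c, 'r) factors \<Rightarrow> ereal" where
  "ll1_objective X blk h A =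
     ereal (ll1_loss X blk A) + (\<Sum>n\<in>UNIV. \<Sum>r\<in>UNIV. h n r (piece blk n r A))"

definition num_fibers :: "(real^'k^'j^'i) \<Rightarrow> mode \<Rightarrow> nat" where
  "num_fibers X n = (case n of
      M1 \<Rightarrow> CARD('j) * CARD('k)
    | M2 \<Rightarrow> CARD('i) * CARD('k)
    | M3 \<Rightarrow> CARD('i) * CARD('j))"


section \<open>The algorithm\<close>

text \<open>Truncated subtraction on \<^typ>\<open>nat\<close> implements the convention that iterates with negative index
  equal the initial point. Weights with a negative index are then multiplied by zero.\<close>

definition extrapolate :: "(nat \<Rightarrow> real) \<Rightarrow> nat \<Rightarrow> (nat \<Rightarrow> 'a::real_vector) \<Rightarrow> nat \<Rightarrow> 'a" where
  "extrapolate w t a k = a k + (\<Sum>i=1..t. w (k + 1 - i) *\<^sub>R (a (k + 1 - i) - a (k - i)))"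

text \<open>The point at which the gradient is estimated: only block \<open>n\<close> is extrapolated.\<close>

definition grad_point where
  "grad_point \<beta> t n a k = with_block n (extrapolate \<beta> t a k) (a k)"

definition midas_step :: "('c \<Rightarrow> 'r)
    \<Rightarrow> (mode \<Rightarrow> 'r \<Rightarrow> ('i::finite, 'j::finite, 'k::finite, 'c::finite, 'r::finite) factors \<Rightarrow> ereal)
    \<Rightarrow> (nat \<Rightarrow> real) \<Rightarrow> (nat \<Rightarrow> real) \<Rightarrow> nat \<Rightarrow> mode \<Rightarrow> ('i, 'j, 'k, 'c, 'r) factors
    \<Rightarrow> (nat \<Rightarrow> ('i, 'j, 'k, 'c, 'r) factors) \<Rightarrow> nat \<Rightarrow> bool" where
  "midas_step blk h \<eta> \<alpha> t n g a k \<longleftrightarrow>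
     (\<forall>r. is_arg_min
        (\<lambda>Z. h n r Z + ereal (piece blk n r g \<bullet> (Z - piece blk n r (extrapolate \<alpha> t a k))
              + 1 / (2 * \<eta> k) * (norm (Z - piece blk n r (extrapolate \<alpha> t a k)))\<^sup>2))
        (\<lambda>Z. Z \<in> range (piece blk n r))
        (piece blk n r (a (Suc k)))) \<and>
     (\<forall>m. m \<noteq> n \<longrightarrow> block m (a (Suc k)) = block m (a k))"

text \<open>\<open>\<xi> k\<close> is the sampled mode; \<open>\<zeta> k\<close> consists of the sampled set of fiber indices and of any
  further randomness (with values in \<^term>\<open>N\<close>) used by the gradient estimator. \<open>history k\<close> is
  the information generated before iteration \<open>k\<close>; the conditional expectation \<open>\<bbbE>\<^sub>k\<close>, which
  averages over \<open>\<xi> k\<close> and \<open>\<zeta> k\<close>, is conditional expectation given \<open>history k\<close>.\<close>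

definition sample_space :: "'s measure \<Rightarrow> (mode \<times> nat set \<times> 's) measure" where
  "sample_space N = count_space UNIV \<Otimes>\<^sub>M (count_space UNIV \<Otimes>\<^sub>M N)"

definition history :: "'w measure \<Rightarrow> 's measure \<Rightarrow> (nat \<Rightarrow> 'w \<Rightarrow> mode)
    \<Rightarrow> (nat \<Rightarrow> 'w \<Rightarrow> nat set \<times> 's) \<Rightarrow> nat \<Rightarrow> 'w measure" where
  "history M N \<xi> \<zeta> k = sigma (space M)
     {(\<lambda>\<omega>. (\<xi> j \<omega>, \<zeta> j \<omega>)) -` S \<inter> space M | j S. j < k \<and> S \<in> sets (sample_space N)}"

text \<open>Given the past, the mode is uniform and, given the mode, the minibatch is a uniformly
  distributed \<^term>\<open>B\<close>-element set of fiber indices.\<close>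

definition midas_sampling :: "'w measure \<Rightarrow> 's measure \<Rightarrow> (nat \<Rightarrow> 'w \<Rightarrow> mode)
    \<Rightarrow> (nat \<Rightarrow> 'w \<Rightarrow> nat set \<times> 's) \<Rightarrow> (real^'k^'j^'i) \<Rightarrow> nat \<Rightarrow> bool" where
  "midas_sampling M N \<xi> \<zeta> X B \<longleftrightarrow>
     (\<forall>k. \<xi> k \<in> measurable M (count_space UNIV)) \<and>
     (\<forall>k. \<zeta> k \<in> measurable M (count_space UNIV \<Otimes>\<^sub>M N)) \<and>
     (\<forall>n. 1 \<le> B \<and> B \<le> num_fibers X n) \<and>
     (\<forall>k n S E. S \<subseteq> {1..num_fibers X n} \<and> card S = B \<and> E \<in> sets (history M N \<xi> \<zeta> k) \<longrightarrow>
        measure M (E \<inter> {\<omega> \<in> space M. \<xi> k \<omega> = n \<and> fst (\<zeta> k \<omega>) = S})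
          = measure M E * (1 / 3) * (1 / real (num_fibers X n choose B)))"

text \<open>\<open>G k\<close> is the stochastic gradient of iteration \<open>k\<close>, of which only block \<open>\<xi> k\<close> is used. It is
  computed from the sample of iteration \<open>k\<close> and the past.\<close>

definition midas_process :: "'w measure \<Rightarrow> 's measure \<Rightarrow> (nat \<Rightarrow> 'w \<Rightarrow> mode)
    \<Rightarrow> (nat \<Rightarrow> 'w \<Rightarrow> nat set \<times> 's) \<Rightarrow> (real^'k^'j^'i) \<Rightarrow> ('c \<Rightarrow> 'r)
    \<Rightarrow> (mode \<Rightarrow> 'r \<Rightarrow> ('i::finite, 'j::finite, 'k::finite, 'c::finite, 'r::finite) factors \<Rightarrow> ereal)
    \<Rightarrow> (nat \<Rightarrow> real) \<Rightarrow> (nat \<Rightarrow> real) \<Rightarrow> nat \<Rightarrow> nat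
    \<Rightarrow> ('i, 'j, 'k, 'c, 'r) factors
    \<Rightarrow> (nat \<Rightarrow> 'w \<Rightarrow> ('i, 'j, 'k, 'c, 'r) factors)
    \<Rightarrow> (nat \<Rightarrow> 'w \<Rightarrow> ('i, 'j, 'k, 'c, 'r) factors) \<Rightarrow> bool" where
  "midas_process M N \<xi> \<zeta> X blk h \<eta> \<alpha> t B A0 G A \<longleftrightarrow>
     midas_sampling M N \<xi> \<zeta> X B \<and>
     (\<forall>k. G k \<in> borel_measurable (history M N \<xi> \<zeta> (Suc k))) \<and>
     (\<forall>k. A k \<in> borel_measurable (history M N \<xi> \<zeta> k)) \<and>
     (\<forall>\<omega>\<in>space M. A 0 \<omega> = A0) \<and>
     (\<forall>\<omega>\<in>space M. \<forall>k. midas_step blk h \<eta> \<alpha> t (\<xi> k \<omega>) (G k \<omega>) (\<lambda>l. A l \<omega>) k)"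

definition grad_error :: "(real^'k^'j^'i) \<Rightarrow> ('c \<Rightarrow> 'r) \<Rightarrow> (nat \<Rightarrow> real) \<Rightarrow> nat
    \<Rightarrow> (nat \<Rightarrow> 'w \<Rightarrow> mode)
    \<Rightarrow> (nat \<Rightarrow> 'w \<Rightarrow> ('i::finite, 'j::finite, 'k::finite, 'c::finite, 'r::finite) factors)
    \<Rightarrow> (nat \<Rightarrow> 'w \<Rightarrow> ('i, 'j, 'k, 'c, 'r) factors) \<Rightarrow> nat \<Rightarrow> 'w \<Rightarrow> real" where
  "grad_error X blk \<beta> t \<xi> G A k \<omega> =
     norm (block (\<xi> k \<omega>) (G k \<omega>)
       - partial_grad X blk (\<xi> k \<omega>) (grad_point \<beta> t (\<xi> k \<omega>) (\<lambda>l. A l \<omega>) k))"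

text \<open>Variance-reduced estimators: \<open>F k\<close> is the \<open>\<sigma>\<close>-algebra of the conditional expectation
  \<open>\<bbbE>\<^sub>k\<close> and \<open>e k\<close> the norm of the error of the stochastic gradient. The integrability clauses
  make the expectations meaningful; \<open>\<Gamma>\<close> and \<open>\<Upsilon>\<close> are indexed from \<open>1\<close>.\<close>

definition variance_reduced :: "'w measure \<Rightarrow> (nat \<Rightarrow> 'w measure) \<Rightarrow> nat
    \<Rightarrow> (nat \<Rightarrow> 'w \<Rightarrow> 'a::real_normed_vector) \<Rightarrow> (nat \<Rightarrow> 'w \<Rightarrow> real)
    \<Rightarrow> real \<Rightarrow> real \<Rightarrow> real \<Rightarrow> real \<Rightarrow> (nat \<Rightarrow> 'w \<Rightarrow> real) \<Rightarrow> (nat \<Rightarrow> 'w \<Rightarrow> real) \<Rightarrow> bool" where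
  "variance_reduced M F t A e V1 V2 V\<Gamma> \<tau> \<Gamma> \<Upsilon> \<longleftrightarrow>
     0 \<le> V1 \<and> 0 \<le> V2 \<and> 0 \<le> V\<Gamma> \<and> 0 < \<tau> \<and> \<tau> \<le> 1 \<and>
     (\<forall>k. integrable M (\<lambda>\<omega>. (e k \<omega>)\<^sup>2)) \<and>
     (\<forall>k\<ge>1. integrable M (\<Gamma> k) \<and> integrable M (\<Upsilon> k)) \<and>
     (\<forall>k\<ge>1. AE \<omega> in M. 0 \<le> \<Gamma> k \<omega> \<and> 0 \<le> \<Upsilon> k \<omega>) \<and>
     (\<forall>k\<ge>1. AE \<omega> in M. real_cond_exp M (F k) (\<lambda>\<omega>. (e k \<omega>)\<^sup>2) \<omega>
        \<le> \<Gamma> k \<omega> + V1 * (\<Sum>i=1..t+1. (norm (A (k + 1 - i) \<omega> - A (k - i) \<omega>))\<^sup>2)) \<and>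
     (\<forall>k\<ge>1. AE \<omega> in M. real_cond_exp M (F k) (e k) \<omega>
        \<le> \<Upsilon> k \<omega> + V2 * (\<Sum>i=1..t+1. norm (A (k + 1 - i) \<omega> - A (k - i) \<omega>))) \<and>
     (\<forall>k\<ge>1. AE \<omega> in M. real_cond_exp M (F k) (\<Gamma> (k + 1)) \<omega>
        \<le> (1 - \<tau>) * \<Gamma> k \<omega>
           + V\<Gamma> * (\<Sum>i=1..t+1. (norm (A (k + 1 - i) \<omega> - A (k - i) \<omega>))\<^sup>2)) \<and>
     ((\<lambda>k. \<integral>\<omega>. (norm (A k \<omega> - A (k - 1) \<omega>))\<^sup>2 \<partial>M) \<longlonglongrightarrow> 0 \<longrightarrow>
        (\<lambda>k. \<integral>\<omega>. \<Gamma> k \<omega> \<partial>M) \<longlonglongrightarrow> 0 \<and> (\<lambda>k. \<integral>\<omega>. \<Upsilon> k \<omega> \<partial>M) \<longlonglongrightarrow> 0)"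


section \<open>Constants and the Lyapunov function\<close>

definition midas_b :: "nat \<Rightarrow> real \<Rightarrow> real \<Rightarrow> (nat \<Rightarrow> real) \<Rightarrow> (nat \<Rightarrow> real) \<Rightarrow> nat \<Rightarrow> real" where
  "midas_b t L \<gamma> \<eta> \<alpha> k =
     (1 - (\<Sum>i=1..t. \<alpha> (k + 1 - i)) - 2 * L * \<eta> k - \<gamma> * \<eta> k) / (2 * \<eta> k)"

definition midas_a :: "nat \<Rightarrow> real \<Rightarrow> real \<Rightarrow> (nat \<Rightarrow> real) \<Rightarrow> (nat \<Rightarrow> real) \<Rightarrow> (nat \<Rightarrow> real)
    \<Rightarrow> nat \<Rightarrow> nat \<Rightarrow> real" where
  "midas_a t L \<gamma> \<eta> \<alpha> \<beta> k i =
     3 * L * real t * (\<beta> (k + 1 - i))\<^sup>2 / 2 + \<gamma> / 2 + \<alpha> (k + 1 - i) / (2 * \<eta> k)"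

text \<open>Inferior and superior limits of bounded real sequences, via the complete lattice of
  extended reals.\<close>

definition real_liminf :: "(nat \<Rightarrow> real) \<Rightarrow> real" where
  "real_liminf x = real_of_ereal (liminf (\<lambda>k. ereal (x k)))"

definition real_limsup :: "(nat \<Rightarrow> real) \<Rightarrow> real" where
  "real_limsup x = real_of_ereal (limsup (\<lambda>k. ereal (x k)))"

text \<open>Along the iterates the objective is finite as soon as it is finite at the initial point.\<close>

definition lyapunov :: "('a::real_normed_vector \<Rightarrow> ereal) \<Rightarrow> nat \<Rightarrow> (nat \<Rightarrow> real) \<Rightarrow> real \<Rightarrow> real
    \<Rightarrow> (nat \<Rightarrow> 'w \<Rightarrow> 'a) \<Rightarrow> (nat \<Rightarrow> 'w \<Rightarrow> real) \<Rightarrow> nat \<Rightarrow> 'w \<Rightarrow> real" where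
  "lyapunov \<Phi> t abar \<tau> \<gamma> A \<Gamma> k \<omega> =
     real_of_ereal (\<Phi> (A k \<omega>))
     + (\<Sum>i=1..t+1. \<Sum>j=i..t+1.
          (real j + 1) * abar j * (norm (A (k + 1 - i) \<omega> - A (k - i) \<omega>))\<^sup>2)
     + 1 / (2 * \<tau> * \<gamma>) * \<Gamma> k \<omega>"

text \<open>The expectation of the squared distance at an iterate whose index is uniformly distributed
  on \<open>{2..K+1}\<close> and independent of the algorithm.\<close>

definition mean_sq_residual :: "'w measure \<Rightarrow> ('a::euclidean_space \<Rightarrow> ereal)
    \<Rightarrow> (nat \<Rightarrow> 'w \<Rightarrow> 'a) \<Rightarrow> nat \<Rightarrow> ennreal" where
  "mean_sq_residual M \<Phi> A K =
     (\<integral>\<^sup>+ k. (\<integral>\<^sup>+ \<omega>. (dist0 (limiting_subdiff \<Phi> (A k \<omega>)))\<^sup>2 \<partial>M)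
        \<partial>measure_pmf (pmf_of_set {2..K+1}))"

text \<open>The number of iterations until the first \<open>\<epsilon>\<close>-stationary point (\<open>\<infinity>\<close> if there is none).\<close>

definition stationarity_time :: "('a::euclidean_space \<Rightarrow> ereal) \<Rightarrow> (nat \<Rightarrow> 'w \<Rightarrow> 'a)
    \<Rightarrow> real \<Rightarrow> 'w \<Rightarrow> ennreal" where
  "stationarity_time \<Phi> A \<epsilon> \<omega> = (INF k\<in>{k. eps_stationary \<Phi> \<epsilon> (A k \<omega>)}. of_nat k)"

end

theory Submission
  imports Defs
begin

text \<open>The prox step and the block Lipschitz bound give a one-step descent of \<open>\<Phi>\<close> which, after taking
  expectations and adding \<open>\<Gamma>\<^sub>k / (2 \<tau> \<gamma>)\<close>, makes the mean square moves
  \<open>\<bbbE> \<parallel>A\<^sup>k - A\<^sup>k\<^sup>-\<^sup>1\<parallel>\<^sup>2\<close> summable, and with them the mean square errors of the stochastic gradients.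

  An iteration only gives a small subgradient in the sampled block. For the other blocks one keeps the
  subgradient of \<open>h\<^sub>n\<close> found when the block was last updated; since then the residual has grown by at
  most a multiple of the moves. As every block is sampled with probability 1/3 independently of the
  past, the mean square of such a residual contracts up to a summable perturbation. Hence the expected
  squared distances to stationarity are summable, with sum \<open>s\<close> say, so that the mean over
  \<open>{2..K+1}\<close> is at most \<open>s / K\<close> and the expected hitting time is at most \<open>s / \<epsilon>\<^sup>2\<close>.

  The factor \<open>1 / (\<rho> - \<sigma>)\<close> exceeds any given constant for \<open>\<sigma>\<close> close to \<open>\<rho>\<close>. So the bound follows
  unless \<open>\<bbbE> \<Psi>\<^sub>1\<close> attains its least possible value; in that case \<open>A\<^sup>0\<close> is a global minimizer with
  exact gradients, and the iterates never leave it.\<close>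

section \<open>Functions with locally Lipschitz gradient\<close>

text \<open>\<open>L\<close> only bounds the change of one block of the gradient while that same
  block moves. A step in another block changes it too, and since the loss is a polynomial of degree
  six in all factors together, no global constant controls that change. The iterates stay in a ball,
  however, and a Lipschitz constant of the full gradient on that ball is enough; hence Lipschitz
  continuity on balls.

  An old subgradient can be kept because the regularizer is convex and splits over the blocks: the
  inequality that defines a subgradient of \<open>h n\<close> sees block \<open>n\<close> only, so
  steps in other blocks do not invalidate it.

  The total \<open>s\<close> of the expected squared residuals is only known to be finite. It
  contains the Lipschitz constant on the ball and the residual at the initial point, so it is not
  compared with \<open>mubar\<close> term by term; the choice of \<open>\<sigma>\<close> absorbs
  it.\<close>

definition loc_lipschitz :: "('a::real_normed_vector \<Rightarrow> 'b::real_normed_vector) \<Rightarrow> bool" where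
  "loc_lipschitz f \<longleftrightarrow> (\<forall>C. \<exists>K. \<forall>x y. norm x \<le> C \<longrightarrow> norm y \<le> C \<longrightarrow> norm (f x - f y) \<le> K * norm (x - y))"

lemma loc_lipschitzD:
  assumes "loc_lipschitz f"
  obtains K where "0 \<le> K"
    "\<And>x y. norm x \<le> C \<Longrightarrow> norm y \<le> C \<Longrightarrow> norm (f x - f y) \<le> K * norm (x - y)"
proof -
  obtain K where K: "\<And>x y. norm x \<le> C \<Longrightarrow> norm y \<le> C \<Longrightarrow> norm (f x - f y) \<le> K * norm (x - y)"
    using assms unfolding loc_lipschitz_def by blast
  have "norm (f x - f y) \<le> max K 0 * norm (x - y)" if "norm x \<le> C" "norm y \<le> C" for x y
    using K[OF that] mult_right_mono[of K "max K 0" "norm (x - y)"] by simp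
  then show thesis using that[of "max K 0"] by simp
qed

lemma loc_lipschitz_bounded:
  assumes "loc_lipschitz f"
  obtains B where "0 \<le> B" "\<And>x. norm x \<le> C \<Longrightarrow> norm (f x) \<le> B"
proof -
  \<comment> \<open>The absolute value makes the origin a point of the ball even if \<open>C\<close>
    is negative.\<close>
  obtain K where K: "0 \<le> K"
    "\<And>x y. norm x \<le> \<bar>C\<bar> \<Longrightarrow> norm y \<le> \<bar>C\<bar> \<Longrightarrow> norm (f x - f y) \<le> K * norm (x - y)"
    using loc_lipschitzD[OF assms] by metis
  have "norm (f x) \<le> norm (f 0) + K * \<bar>C\<bar>" if "norm x \<le> C" for x
  proof -
    have "norm (f x - f 0) \<le> K * norm (x - 0)" using that K(2) by (smt (verit) norm_zero)
    also have "\<dots> \<le> K * \<bar>C\<bar>" using that K(1) by (simp add: mult_left_mono)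
    finally show ?thesis using norm_triangle_sub[of "f x" "f 0"] by linarith
  qed
  then show thesis using that[of "norm (f 0) + K * \<bar>C\<bar>"] K(1) by simp
qed

lemma loc_lipschitz_continuous:
  assumes "loc_lipschitz f"
  shows "continuous_on UNIV f"
proof -
  have "isCont f x" for x
  proof -
    obtain K where K: "0 \<le> K"
      "\<And>y z. norm y \<le> norm x + 1 \<Longrightarrow> norm z \<le> norm x + 1 \<Longrightarrow> norm (f y - f z) \<le> K * norm (y - z)"
      using loc_lipschitzD[OF assms] by metis
    have "(K+1)-lipschitz_on (ball x 1) f"
    proof (rule lipschitz_onI)
      fix y z assume "y \<in> ball x 1" "z \<in> ball x 1"
      then have "norm y \<le> norm x + 1" "norm z \<le> norm x + 1"
        using norm_triangle_sub[of y x] norm_triangle_sub[of z x] by (auto simp: dist_norm norm_minus_commute)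
      from K(2)[OF this] show "dist (f y) (f z) \<le> (K + 1) * dist y z"
        unfolding dist_norm by (smt (verit) mult_right_mono norm_ge_zero)
    qed (use K in simp)
    then have "continuous_on (ball x 1) f" by (rule lipschitz_on_continuous_on)
    then show ?thesis by (simp add: continuous_on_eq_continuous_at)
  qed
  then show ?thesis by (simp add: continuous_at_imp_continuous_on)
qed

lemma loc_lipschitz_const: "loc_lipschitz (\<lambda>x. c)"
  unfolding loc_lipschitz_def by (auto intro!: exI[of _ 0])

lemma loc_lipschitz_linear:
  fixes f :: "'a::euclidean_space \<Rightarrow> 'b::euclidean_space"
  assumes "linear f"
  shows "loc_lipschitz f"
proof -
  obtain B where "\<And>x. norm (f x) \<le> B * norm x" using linear_bounded[OF assms] by blast
  then show ?thesis unfolding loc_lipschitz_def by (metis linear_diff[OF assms])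
qed

lemma loc_lipschitz_add:
  assumes "loc_lipschitz f" "loc_lipschitz g"
  shows "loc_lipschitz (\<lambda>x. f x + g x)"
  unfolding loc_lipschitz_def
proof
  fix C
  obtain K where K: "\<And>x y. norm x \<le> C \<Longrightarrow> norm y \<le> C \<Longrightarrow> norm (f x - f y) \<le> K * norm (x - y)"
    using loc_lipschitzD[OF assms(1)] by metis
  obtain J where J: "\<And>x y. norm x \<le> C \<Longrightarrow> norm y \<le> C \<Longrightarrow> norm (g x - g y) \<le> J * norm (x - y)"
    using loc_lipschitzD[OF assms(2)] by metis
  have "norm (f x + g x - (f y + g y)) \<le> (K + J) * norm (x - y)" if "norm x \<le> C" "norm y \<le> C" for x y
    using K[OF that] J[OF that] norm_triangle_ineq[of "f x - f y" "g x - g y"]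
    by (simp add: algebra_simps)
  then show "\<exists>K. \<forall>x y. norm x \<le> C \<longrightarrow> norm y \<le> C \<longrightarrow> norm (f x + g x - (f y + g y)) \<le> K * norm (x - y)"
    by blast
qed

lemma loc_lipschitz_scaleR:
  fixes f :: "'a::real_normed_vector \<Rightarrow> real"
  assumes "loc_lipschitz f" "loc_lipschitz g"
  shows "loc_lipschitz (\<lambda>x. f x *\<^sub>R g x)"
  unfolding loc_lipschitz_def
proof
  fix C
  obtain K where K: "0 \<le> K" "\<And>x y. norm x \<le> C \<Longrightarrow> norm y \<le> C \<Longrightarrow> norm (f x - f y) \<le> K * norm (x - y)"
    using loc_lipschitzD[OF assms(1)] by metis
  obtain J where J: "0 \<le> J" "\<And>x y. norm x \<le> C \<Longrightarrow> norm y \<le> C \<Longrightarrow> norm (g x - g y) \<le> J * norm (x - y)"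
    using loc_lipschitzD[OF assms(2)] by metis
  obtain B where B: "0 \<le> B" "\<And>x. norm x \<le> C \<Longrightarrow> norm (f x) \<le> B"
    using loc_lipschitz_bounded[OF assms(1)] by metis
  obtain D where D: "0 \<le> D" "\<And>x. norm x \<le> C \<Longrightarrow> norm (g x) \<le> D"
    using loc_lipschitz_bounded[OF assms(2)] by metis
  have "norm (f x *\<^sub>R g x - f y *\<^sub>R g y) \<le> (B * J + K * D) * norm (x - y)"
    if xy: "norm x \<le> C" "norm y \<le> C" for x y
  proof -
    have "f x *\<^sub>R g x - f y *\<^sub>R g y = f x *\<^sub>R (g x - g y) + (f x - f y) *\<^sub>R g y"
      by (simp add: algebra_simps)
    then have "norm (f x *\<^sub>R g x - f y *\<^sub>R g y) \<le> norm (f x) * norm (g x - g y) + norm (f x - f y) * norm (g y)"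
      by (metis norm_scaleR norm_triangle_ineq real_norm_def)
    also have "\<dots> \<le> B * (J * norm (x - y)) + (K * norm (x - y)) * D"
      using B K J D xy by (intro add_mono mult_mono) auto
    finally show ?thesis by (simp add: algebra_simps)
  qed
  then show "\<exists>K. \<forall>x y. norm x \<le> C \<longrightarrow> norm y \<le> C \<longrightarrow> norm (f x *\<^sub>R g x - f y *\<^sub>R g y) \<le> K * norm (x - y)"
    by blast
qed

text \<open>A class that contains the linear functions and is closed under sums and products, hence
  contains all polynomials. The function itself is required to be locally Lipschitz because it
  reappears as a factor in the gradient \<open>f x *\<^sub>R g' x + g x *\<^sub>R f' x\<close> of a
  product.\<close>

definition c11 :: "('a::euclidean_space \<Rightarrow> real) \<Rightarrow> bool" where
  "c11 f \<longleftrightarrow> loc_lipschitz f \<and> (\<exists>g. (\<forall>x. GDERIV f x :> g x) \<and> loc_lipschitz g)"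

lemma c11_const: "c11 (\<lambda>x. c)"
  unfolding c11_def by (auto intro!: exI[of _ "\<lambda>x. 0"] loc_lipschitz_const GDERIV_const)

lemma c11_linear:
  fixes f :: "'a::euclidean_space \<Rightarrow> real"
  assumes "linear f"
  shows "c11 f"
proof -
  \<comment> \<open>\<open>adjoint f 1\<close> is the Riesz representer of the functional
    \<open>f\<close>.\<close>
  have "GDERIV f x :> adjoint f 1" for x
  proof -
    have "(f has_derivative f) (at x)"
      using assms by (simp add: linear_conv_bounded_linear bounded_linear_imp_has_derivative)
    moreover have "f = (\<lambda>h. h \<bullet> adjoint f 1)"
      using adjoint_works[OF assms, of _ 1] by auto
    ultimately show ?thesis unfolding gderiv_def by metis
  qed
  then show ?thesis unfolding c11_def
    by (auto intro!: exI[of _ "\<lambda>x. adjoint f 1"] loc_lipschitz_const loc_lipschitz_linear assms)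
qed

lemma c11_add:
  assumes "c11 f" "c11 g"
  shows "c11 (\<lambda>x. f x + g x)"
proof -
  obtain f' g' where "\<And>x. GDERIV f x :> f' x" "\<And>x. GDERIV g x :> g' x" "loc_lipschitz f'" "loc_lipschitz g'"
    using assms unfolding c11_def by blast
  then show ?thesis using assms unfolding c11_def
    by (auto intro!: loc_lipschitz_add exI[of _ "\<lambda>x. f' x + g' x"] GDERIV_add)
qed

lemma c11_mult:
  assumes "c11 f" "c11 g"
  shows "c11 (\<lambda>x. f x * g x)"
proof -
  obtain f' g' where d: "\<And>x. GDERIV f x :> f' x" "\<And>x. GDERIV g x :> g' x"
    and l: "loc_lipschitz f'" "loc_lipschitz g'"
    using assms unfolding c11_def by blast
  have "GDERIV (\<lambda>x. f x * g x) x :> f x *\<^sub>R g' x + g x *\<^sub>R f' x" for x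
    using GDERIV_mult[OF d] .
  moreover have "loc_lipschitz (\<lambda>x. f x *\<^sub>R g' x + g x *\<^sub>R f' x)"
    using assms l unfolding c11_def by (intro loc_lipschitz_add loc_lipschitz_scaleR) auto
  moreover have "loc_lipschitz (\<lambda>x. f x * g x)"
    using loc_lipschitz_scaleR[of f g] assms unfolding c11_def by simp
  ultimately show ?thesis unfolding c11_def
    by (intro conjI exI[of _ "\<lambda>x. f x *\<^sub>R g' x + g x *\<^sub>R f' x"]) auto
qed

lemma c11_sum:
  assumes "\<And>i. i \<in> I \<Longrightarrow> c11 (f i)"
  shows "c11 (\<lambda>x. \<Sum>i\<in>I. f i x)"
  using assms
proof (induction I rule: infinite_finite_induct)
  case (insert i I)
  then show ?case by (auto intro!: c11_add)
qed (auto intro: c11_const)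

lemma c11_ll1_loss:
  fixes X :: "real^'k::finite^'j::finite^'i::finite" and blk :: "'c::finite \<Rightarrow> 'r::finite"
  shows "c11 (ll1_loss X blk)"
proof -
  have lin1: "c11 (\<lambda>A::('i, 'j, 'k, 'c, 'r) factors. fst A $ i $ c)" for i c
    by (rule c11_linear) (auto intro!: linearI)
  have lin2: "c11 (\<lambda>A::('i, 'j, 'k, 'c, 'r) factors. fst (snd A) $ j $ c)" for j c
    by (rule c11_linear) (auto intro!: linearI)
  have lin3: "c11 (\<lambda>A::('i, 'j, 'k, 'c, 'r) factors. snd (snd A) $ k $ c)" for k c
    by (rule c11_linear) (auto intro!: linearI)
  \<comment> \<open>An entry of the residual tensor, with the difference written as a sum with
    factor -1 and later the square as a product, so that the closure rules of \<open>c11\<close>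
    apply literally.\<close>
  define q where "q A i j k = X $ i $ j $ k +
      (-1) * (\<Sum>r\<in>UNIV. (\<Sum>c | blk c = r. fst A $ i $ c * fst (snd A) $ j $ c) * snd (snd A) $ k $ r)"
    for A :: "('i, 'j, 'k, 'c, 'r) factors" and i j k
  have c: "c11 (\<lambda>A. 1 / (2 * real CARD('i) * real CARD('j) * real CARD('k)) *
     (\<Sum>i\<in>UNIV. \<Sum>j\<in>UNIV. \<Sum>k\<in>UNIV. q A i j k * q A i j k))"
    unfolding q_def by (intro c11_mult c11_sum c11_add c11_const lin1 lin2 lin3)
  have "ll1_loss X blk A = 1 / (2 * real CARD('i) * real CARD('j) * real CARD('k)) *
     (\<Sum>i\<in>UNIV. \<Sum>j\<in>UNIV. \<Sum>k\<in>UNIV. q A i j k * q A i j k)" for A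
    unfolding ll1_loss_def ll1_tensor_def q_def power2_norm_eq_inner
    by (simp add: inner_vec_def split_beta)
  then show ?thesis using c by presburger
qed

lemma GDERIV_grad:
  assumes "GDERIV f x :> D"
  shows "grad f x = D"
proof -
  have "D' = D" if "GDERIV f x :> D'" for D'
  proof -
    have "(\<lambda>h. h \<bullet> D') = (\<lambda>h. h \<bullet> D)"
      using assms that unfolding gderiv_def by (rule has_derivative_unique[rotated])
    from fun_cong[OF this, of "D' - D"] have "(D' - D) \<bullet> D' = (D' - D) \<bullet> D" .
    then have "(D' - D) \<bullet> (D' - D) = 0" by (simp add: inner_diff_right)
    then show ?thesis by simp
  qed
  with assms show ?thesis unfolding grad_def by (rule the_equality)
qed

lemma c11_grad:
  assumes "c11 f"
  shows "GDERIV f x :> grad f x" "loc_lipschitz (grad f)"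
proof -
  obtain g where g: "\<And>x. GDERIV f x :> g x" "loc_lipschitz g"
    using assms unfolding c11_def by blast
  then have "grad f = g" using GDERIV_grad[OF g(1)] by auto
  then show "GDERIV f x :> grad f x" "loc_lipschitz (grad f)" using g by auto
qed

section \<open>Block decompositions of the factor space\<close>

text \<open>The maps \<open>P n\<close> are the orthogonal projections onto mutually orthogonal
  subspaces that span the space; \<open>inner_P\<close> encodes self-adjointness. In this form one
  argument covers three factors of different types.\<close>

locale block_decomposition =
  fixes P :: "'m::finite \<Rightarrow> 'a::euclidean_space \<Rightarrow> 'a"
  assumes linear_P: "linear (P n)"
    and inner_P: "P n x \<bullet> P n y = P n x \<bullet> y"
    and P_idem: "P n (P n x) = P n x"
    and P_orth: "m \<noteq> n \<Longrightarrow> P m (P n x) = 0"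
    and sum_P: "(\<Sum>n\<in>UNIV. P n x) = x"

lemma linear_block: "linear (block n)"
  by (cases n) (auto intro!: linearI simp: zero_prod_def)

lemma UNIV_mode: "UNIV = {M1, M2, M3}"
  using mode.exhaust by auto

lemma block_decomposition_block:
  "block_decomposition (block :: mode \<Rightarrow> ('i::finite, 'j::finite, 'k::finite, 'c::finite, 'r::finite) factors \<Rightarrow> _)"
proof (rule block_decomposition.intro)
  fix m n :: mode and x y :: "('i, 'j, 'k, 'c, 'r) factors"
  show "linear (block n :: ('i, 'j, 'k, 'c, 'r) factors \<Rightarrow> _)" by (rule linear_block)
  obtain x1 x2 x3 y1 y2 y3 where xy: "x = (x1, x2, x3)" "y = (y1, y2, y3)" by (metis prod.collapse)
  show "block n x \<bullet> block n y = block n x \<bullet> y" by (cases n) (auto simp: xy inner_prod_def)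
  show "block n (block n x) = block n x" by (cases n) (auto simp: xy)
  show "m \<noteq> n \<Longrightarrow> block m (block n x) = 0" by (cases n; cases m) (auto simp: xy zero_prod_def)
  show "(\<Sum>n\<in>UNIV. block n x) = x" by (auto simp: UNIV_mode xy)
qed

text \<open>Replacing a factor becomes a translation by a projected difference, which makes sense
  for arbitrary projections \<open>P n\<close>.\<close>

lemma with_block_eq: "with_block n Y A = A + block n (Y - A)"
proof -
  obtain x1 x2 x3 y1 y2 y3 where "Y = (x1, x2, x3)" "A = (y1, y2, y3)" by (metis prod.collapse)
  then show ?thesis by (cases n) auto
qed

lemma linear_piece: "linear (piece blk n r)"
  by (cases n) (auto intro!: linearI simp: zero_prod_def vec_eq_iff)

lemma inner_piece: "piece blk n r x \<bullet> piece blk n r y = piece blk n r x \<bullet> y"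
proof -
  obtain x1 x2 x3 y1 y2 y3 where xy: "x = (x1, x2, x3)" "y = (y1, y2, y3)" by (metis prod.collapse)
  show ?thesis
    by (cases n) (auto simp: xy inner_prod_def inner_vec_def intro!: sum.cong)
qed

lemma piece_block: "piece blk n r (block m x) = (if m = n then piece blk n r x else 0)"
proof -
  obtain x1 x2 x3 where xy: "x = (x1, x2, x3)" by (metis prod.collapse)
  show ?thesis
    by (cases n; cases m) (auto simp: xy zero_prod_def vec_eq_iff)
qed

lemma sum_piece: "(\<Sum>r\<in>UNIV. piece blk n r x) = block n x"
proof -
  obtain x1 x2 x3 where xy: "x = (x1, x2, x3)" by (metis prod.collapse)
  have s: "(\<Sum>r\<in>UNIV. (a r, b r, c r)) = (\<Sum>r\<in>UNIV. a r, \<Sum>r\<in>UNIV. b r, \<Sum>r\<in>UNIV. c r)"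
    for a :: "_ \<Rightarrow> 'u::comm_monoid_add" and b :: "_ \<Rightarrow> 'v::comm_monoid_add" and c :: "_ \<Rightarrow> 'w::comm_monoid_add"
    by (simp add: sum_prod)
  show ?thesis
    by (cases n) (auto simp: xy s vec_eq_iff)
qed

text \<open>Different pieces of a block are orthogonal. This is what lets the separate subproblems
  for the pieces add up to one subproblem for the block.\<close>

lemma sum_inner_piece:
  "(\<Sum>r\<in>UNIV. piece blk n r x \<bullet> piece blk n r y) = block n x \<bullet> block n y"
proof -
  have "block n x \<bullet> block n y = (\<Sum>r\<in>UNIV. piece blk n r x \<bullet> block n y)"
    by (simp add: inner_sum_left flip: sum_piece[of blk])
  also have "\<dots> = (\<Sum>r\<in>UNIV. piece blk n r x \<bullet> piece blk n r y)"
    by (intro sum.cong refl, subst inner_piece[symmetric]) (simp add: piece_block)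
  finally show ?thesis by simp
qed

section \<open>Subgradients and prox steps\<close>

text \<open>The subdifferential of convex analysis. Being a global inequality without limits, it can
  be restricted to a block and carried from one point to another.\<close>

definition subgrad :: "('a::real_inner \<Rightarrow> ereal) \<Rightarrow> 'a \<Rightarrow> 'a \<Rightarrow> bool" where
  "subgrad H x v \<longleftrightarrow> \<bar>H x\<bar> \<noteq> \<infinity> \<and> (\<forall>y. H x + ereal (v \<bullet> (y - x)) \<le> H y)"

section \<open>Subdifferentials of a smooth plus a convex function\<close>

lemma GDERIV_quotient_tendsto:
  fixes f :: "'a::euclidean_space \<Rightarrow> real"
  assumes "GDERIV f x :> g"
  shows "((\<lambda>y. (f y - f x - g \<bullet> (y - x)) / norm (y - x)) \<longlongrightarrow> 0) (at x)"
proof -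
  have "(f has_derivative (\<lambda>h. h \<bullet> g)) (at x)" using assms unfolding gderiv_def .
  then have "((\<lambda>y. (f y - f x - (y - x) \<bullet> g) /\<^sub>R norm (y - x)) \<longlongrightarrow> 0) (at x)"
    unfolding has_derivative_at_within by (simp add: diff_diff_eq)
  then show ?thesis by (simp add: inner_commute divide_inverse_commute)
qed

text \<open>The affine minorant of \<open>H\<close> cancels the part \<open>v\<close>, so the
  difference quotient of the sum dominates that of \<open>f\<close>, which tends to 0.\<close>

lemma regular_subdiff_add:
  fixes f :: "'a::euclidean_space \<Rightarrow> real"
  assumes "GDERIV f x :> g" "subgrad H x v"
  shows "g + v \<in> regular_subdiff (\<lambda>y. ereal (f y) + H y) x"
proof -
  obtain hx where hx: "H x = ereal hx" using assms(2) unfolding subgrad_def by (cases "H x") auto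
  have Hy: "ereal (hx + v \<bullet> (y - x)) \<le> H y" for y
    using assms(2) unfolding subgrad_def hx by simp
  have le: "ereal ((f y - f x - g \<bullet> (y - x)) / norm (y - x))
      \<le> (ereal (f y) + H y - (ereal (f x) + H x) - ereal ((g + v) \<bullet> (y - x))) / ereal (norm (y - x))"
    if "y \<noteq> x" for y
    using Hy[of y] that unfolding hx by (cases "H y") (auto simp: inner_add_left divide_right_mono)
  have "((\<lambda>y. ereal ((f y - f x - g \<bullet> (y - x)) / norm (y - x))) \<longlongrightarrow> ereal 0) (at x)"
    using GDERIV_quotient_tendsto[OF assms(1)] by simp
  from lim_imp_Liminf[OF _ this]
  have "0 = Liminf (at x) (\<lambda>y. ereal ((f y - f x - g \<bullet> (y - x)) / norm (y - x)))"
    by (simp add: zero_ereal_def)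
  also have "\<dots> \<le> Liminf (at x) (\<lambda>y. (ereal (f y) + H y - (ereal (f x) + H x)
      - ereal ((g + v) \<bullet> (y - x))) / ereal (norm (y - x)))"
    using le by (intro Liminf_mono) (auto simp: eventually_at_filter)
  finally show ?thesis unfolding regular_subdiff_def hx by simp
qed

text \<open>Suppose that the subgradient inequality fails at \<open>y\<close> by \<open>d\<close>,
  and let \<open>n\<close> be the distance from \<open>x\<close> to \<open>y\<close>. By convexity
  the failure persists in proportion along the segment: the quotient that belongs to
  \<open>H\<close> is at most \<open>- d / n\<close> there. Near \<open>x\<close> the quotient of
  \<open>f\<close> is below \<open>d / (2 * n)\<close>, so the total falls below
  \<open>- d / (2 * n)\<close>, which regularity excludes.\<close>

lemma regular_subdiff_convexD:
  fixes f :: "'a::euclidean_space \<Rightarrow> real"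
  assumes f: "GDERIV f x :> g" and conv: "ereal_convex_on UNIV H" and ninf: "\<And>y. H y \<noteq> -\<infinity>"
    and v: "v \<in> regular_subdiff (\<lambda>y. ereal (f y) + H y) x"
  shows "subgrad H x (v - g)"
proof -
  obtain hx where hx: "H x = ereal hx"
    using v ninf[of x] unfolding regular_subdiff_def by (cases "H x") auto
  have "H x + ereal ((v - g) \<bullet> (y - x)) \<le> H y" for y
  proof (rule ccontr)
    assume neg: "\<not> ?thesis"
    then obtain hy where hy: "H y = ereal hy" using ninf[of y] by (cases "H y") auto
    define d where "d = hx + (v - g) \<bullet> (y - x) - hy"
    have d: "0 < d" using neg unfolding hx hy d_def by simp
    then have yx: "y \<noteq> x" using hx hy unfolding d_def by auto
    define n where "n = norm (y - x)"
    have n: "0 < n" using yx unfolding n_def by simp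
    have e1: "eventually (\<lambda>z. (f z - f x - g \<bullet> (z - x)) / norm (z - x) < d / (2 * n)) (at x)"
      using GDERIV_quotient_tendsto[OF f] d n by (intro order_tendstoD(2)) auto
    have "ereal (- (d / (2 * n))) < 0" using d n by simp
    then have e2: "eventually (\<lambda>z. ereal (- (d / (2 * n))) <
        (ereal (f z) + H z - (ereal (f x) + H x) - ereal (v \<bullet> (z - x))) / ereal (norm (z - x))) (at x)"
      using v unfolding regular_subdiff_def le_Liminf_iff by blast
    \<comment> \<open>Both eventual statements are pulled back to the segment, where the convexity
      inequality between \<open>x\<close> and \<open>y\<close> is available.\<close>
    have "filterlim (\<lambda>s. x + s *\<^sub>R (y - x)) (at x) (at_right (0::real))"
      unfolding filterlim_at using yx
      by (auto intro!: tendsto_eq_intros simp: eventually_at_filter)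
    from eventually_compose_filterlim[OF eventually_conj[OF e1 e2] this]
    have "eventually (\<lambda>s. (f (x + s *\<^sub>R (y - x)) - f x - g \<bullet> (x + s *\<^sub>R (y - x) - x)) / norm (x + s *\<^sub>R (y - x) - x) < d / (2 * n)
       \<and> ereal (- (d / (2 * n))) <
        (ereal (f (x + s *\<^sub>R (y - x))) + H (x + s *\<^sub>R (y - x)) - (ereal (f x) + H x)
         - ereal (v \<bullet> (x + s *\<^sub>R (y - x) - x))) / ereal (norm (x + s *\<^sub>R (y - x) - x))) (at_right (0::real))" .
    moreover have "eventually (\<lambda>s. 0 < s \<and> s < 1) (at_right (0::real))"
      by (auto simp: eventually_at_right_field intro!: exI[of _ 1])
    ultimately have "eventually (\<lambda>s. (f (x + s *\<^sub>R (y - x)) - f x - g \<bullet> (x + s *\<^sub>R (y - x) - x)) / norm (x + s *\<^sub>R (y - x) - x) < d / (2 * n)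
       \<and> ereal (- (d / (2 * n))) <
        (ereal (f (x + s *\<^sub>R (y - x))) + H (x + s *\<^sub>R (y - x)) - (ereal (f x) + H x)
         - ereal (v \<bullet> (x + s *\<^sub>R (y - x) - x))) / ereal (norm (x + s *\<^sub>R (y - x) - x)) \<and> 0 < s \<and> s < 1) (at_right (0::real))"
      by eventually_elim auto
    from eventually_happens'[OF _ this] obtain s where s: "0 < s" "s < 1"
      and s1: "(f (x + s *\<^sub>R (y - x)) - f x - s * (g \<bullet> (y - x))) / (s * n) < d / (2 * n)"
      and s2: "ereal (- (d / (2 * n))) <
        (ereal (f (x + s *\<^sub>R (y - x))) + H (x + s *\<^sub>R (y - x)) - (ereal (f x) + H x)
         - ereal (s * (v \<bullet> (y - x)))) / ereal (s * n)"
      unfolding n_def by auto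
    have "x + s *\<^sub>R (y - x) = (1 - s) *\<^sub>R x + s *\<^sub>R y" by (simp add: algebra_simps)
    then have "H (x + s *\<^sub>R (y - x)) \<le> ereal (1 - s) * H x + ereal s * H y"
      using conv s unfolding ereal_convex_on_def by simp
    then have Hz: "H (x + s *\<^sub>R (y - x)) \<le> ereal ((1 - s) * hx + s * hy)" unfolding hx hy by simp
    then obtain hz where hz: "H (x + s *\<^sub>R (y - x)) = ereal hz"
      using ninf[of "x + s *\<^sub>R (y - x)"] by (cases "H (x + s *\<^sub>R (y - x))") auto
    have sn: "0 < s * n" using s n by simp
    have sd: "d / (2 * n) * (s * n) = s * d / 2" using n by simp
    have a1: "f (x + s *\<^sub>R (y - x)) - f x - s * (g \<bullet> (y - x)) < s * d / 2"
      using s1 sn unfolding pos_divide_less_eq[OF sn] sd by simp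
    have "- (d / (2 * n)) < (f (x + s *\<^sub>R (y - x)) + hz - (f x + hx) - s * (v \<bullet> (y - x))) / (s * n)"
      using s2 s n unfolding hz hx by simp
    then have a2: "- (s * d / 2) < f (x + s *\<^sub>R (y - x)) + hz - (f x + hx) - s * (v \<bullet> (y - x))"
      unfolding pos_less_divide_eq[OF sn] mult_minus_left sd .
    have a3: "hz \<le> (1 - s) * hx + s * hy" using Hz unfolding hz by simp
    have "s * d = s * hx + s * (v \<bullet> (y - x)) - s * (g \<bullet> (y - x)) - s * hy"
      unfolding d_def by (simp add: algebra_simps)
    then show False using a1 a2 a3 by (simp add: algebra_simps)
  qed
  then show ?thesis unfolding subgrad_def hx by simp
qed

text \<open>For convex functions the limit adds nothing new, because the subgradient inequality is
  stable under limits. The convergence of the values \<open>H (xs m)\<close>, which is essential for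
  this, comes from that of the sums and the continuity of \<open>f\<close>.\<close>

lemma limiting_subdiff_convexD:
  fixes f :: "'a::euclidean_space \<Rightarrow> real"
  assumes f: "\<And>x. GDERIV f x :> g x" and g: "isCont g x"
    and conv: "ereal_convex_on UNIV H" and ninf: "\<And>y. H y \<noteq> -\<infinity>"
    and v: "v \<in> limiting_subdiff (\<lambda>y. ereal (f y) + H y) x"
  shows "subgrad H x (v - g x)"
proof -
  obtain hx where hx: "H x = ereal hx"
    using v ninf[of x] unfolding limiting_subdiff_def by (cases "H x") auto
  obtain xs vs where xs: "xs \<longlonglongrightarrow> x"
    and Fx: "(\<lambda>m. ereal (f (xs m)) + H (xs m)) \<longlonglongrightarrow> ereal (f x) + H x"
    and vs: "\<And>m::nat. vs m \<in> regular_subdiff (\<lambda>y. ereal (f y) + H y) (xs m)" "vs \<longlonglongrightarrow> v"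
    using v unfolding limiting_subdiff_def by auto
  have sub: "subgrad H (xs m) (vs m - g (xs m))" for m
    using regular_subdiff_convexD[OF f conv ninf vs(1)] .
  have "isCont f x"
    using f[of x] unfolding gderiv_def by (rule has_derivative_continuous)
  then have fx: "(\<lambda>m. f (xs m)) \<longlonglongrightarrow> f x" using xs by (rule isCont_tendsto_compose)
  have gx: "(\<lambda>m. g (xs m)) \<longlonglongrightarrow> g x" using g xs by (rule isCont_tendsto_compose)
  have "(\<lambda>m. (ereal (f (xs m)) + H (xs m)) - ereal (f (xs m))) \<longlonglongrightarrow> (ereal (f x) + H x) - ereal (f x)"
    using Fx fx by (intro tendsto_diff_ereal) (auto simp: hx)
  moreover have "(ereal (f (xs m)) + H (xs m)) - ereal (f (xs m)) = H (xs m)" for m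
    by (cases "H (xs m)") auto
  moreover have "(ereal (f x) + H x) - ereal (f x) = H x" by (simp add: hx)
  ultimately have Hx: "(\<lambda>m. H (xs m)) \<longlonglongrightarrow> H x" by simp
  have "H x + ereal ((v - g x) \<bullet> (y - x)) \<le> H y" for y
  proof (rule LIMSEQ_le_const2)
    show "(\<lambda>m. H (xs m) + ereal ((vs m - g (xs m)) \<bullet> (y - xs m))) \<longlonglongrightarrow> H x + ereal ((v - g x) \<bullet> (y - x))"
      using Hx xs vs(2) gx by (intro tendsto_add_ereal) (auto simp: hx intro!: tendsto_intros)
  qed (use sub in \<open>auto simp: subgrad_def\<close>)
  then show ?thesis unfolding subgrad_def hx by simp
qed

lemma regular_subset_limiting: "regular_subdiff F x \<subseteq> limiting_subdiff F x"
proof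
  fix v assume "v \<in> regular_subdiff F x"
  then show "v \<in> limiting_subdiff F x"
    unfolding limiting_subdiff_def mem_Collect_eq
    by (intro conjI exI[of _ "\<lambda>_. x"] exI[of _ "\<lambda>_. v"] allI) (auto simp: regular_subdiff_def)
qed

lemma zero_in_regular_subdiff:
  assumes "\<bar>F x\<bar> \<noteq> \<infinity>" "\<And>y. F x \<le> F y"
  shows "0 \<in> regular_subdiff F x"
proof -
  obtain fx where fx: "F x = ereal fx" using assms(1) by (cases "F x") auto
  have "0 \<le> (F y - F x - ereal (0 \<bullet> (y - x))) / ereal (norm (y - x))" for y
    using assms(2)[of y] unfolding fx by (cases "F y"; cases "y = x") (auto simp: zero_ereal_def[symmetric])
  then have "0 \<le> Liminf (at x) (\<lambda>y. (F y - F x - ereal (0 \<bullet> (y - x))) / ereal (norm (y - x)))"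
    by (intro Liminf_bounded) simp
  then show ?thesis using assms(1) unfolding regular_subdiff_def by simp
qed

lemma dist0_le: "s \<in> S \<Longrightarrow> dist0 S \<le> ennreal (norm s)"
  unfolding dist0_def by (rule INF_lower)

text \<open>The optimality condition of the prox problem, obtained by comparing the minimizer
  \<open>xp\<close> with the points \<open>xp + s *\<^sub>R (y - xp)\<close>: convexity bounds
  \<open>H\<close> there, division by \<open>s\<close> leaves a quadratic term of order
  \<open>s\<close>, and \<open>s\<close> tends to 0. The point \<open>x0\<close> guarantees that the
  minimal value is finite.\<close>

lemma prox_subgrad:
  fixes H :: "'a::euclidean_space \<Rightarrow> ereal"
  assumes conv: "ereal_convex_on UNIV H" and ninf: "\<And>y. H y \<noteq> -\<infinity>"
    and fin: "H x0 \<noteq> \<infinity>" and T: "linear T" "\<And>x y. T x \<bullet> T y = T x \<bullet> y" and \<eta>: "0 < (\<eta>::real)"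
    and min: "\<And>y. H xp + ereal (u \<bullet> T (xp - c) + 1 / (2 * \<eta>) * (norm (T (xp - c)))\<^sup>2)
      \<le> H y + ereal (u \<bullet> T (y - c) + 1 / (2 * \<eta>) * (norm (T (y - c)))\<^sup>2)"
  shows "subgrad H xp (- T u - (1 / \<eta>) *\<^sub>R T (xp - c))"
proof -
  define q where "q y = u \<bullet> T (y - c) + 1 / (2 * \<eta>) * (norm (T (y - c)))\<^sup>2" for y
  obtain h0 where "H x0 = ereal h0" using fin ninf[of x0] by (cases "H x0") auto
  then obtain hp where hp: "H xp = ereal hp"
    using min[of x0] ninf[of xp] by (cases "H xp") auto
  have adj: "u \<bullet> T z = T u \<bullet> z" for u z
    using T(2)[of u z] T(2)[of z u] by (metis inner_commute)
  have "H xp + ereal ((- T u - (1 / \<eta>) *\<^sub>R T (xp - c)) \<bullet> (y - xp)) \<le> H y" for y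
  proof (cases "H y")
    case (real hy)
    define w where "w = T (y - xp)"
    define m where "m = u \<bullet> w + (1 / \<eta>) * (T (xp - c) \<bullet> w)"
    have q: "q (xp + s *\<^sub>R (y - xp)) = q xp + s * m + s\<^sup>2 / (2 * \<eta>) * (norm w)\<^sup>2" for s
    proof -
      have "T (xp + s *\<^sub>R (y - xp) - c) = T (xp - c) + s *\<^sub>R w"
        unfolding w_def by (metis T(1) add_diff_eq diff_add_eq linear_add linear_scale)
      moreover have "(norm (T (xp - c) + s *\<^sub>R w))\<^sup>2 = (norm (T (xp - c)))\<^sup>2 + 2 * s * (T (xp - c) \<bullet> w) + s\<^sup>2 * (norm w)\<^sup>2"
        unfolding power2_norm_eq_inner by (simp add: algebra_simps inner_commute power2_eq_square)
      ultimately show ?thesis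
        unfolding q_def m_def using \<eta> by (simp add: inner_add_right field_simps)
    qed
    have ineq: "0 \<le> hy - hp + m + s / (2 * \<eta>) * (norm w)\<^sup>2" if s: "0 < s" "s < 1" for s
    proof -
      have "xp + s *\<^sub>R (y - xp) = (1 - s) *\<^sub>R xp + s *\<^sub>R y" by (simp add: algebra_simps)
      then have "H (xp + s *\<^sub>R (y - xp)) \<le> ereal (1 - s) * H xp + ereal s * H y"
        using conv s unfolding ereal_convex_on_def by simp
      then have "H (xp + s *\<^sub>R (y - xp)) + ereal (q (xp + s *\<^sub>R (y - xp)))
          \<le> ereal ((1 - s) * hp + s * hy) + ereal (q (xp + s *\<^sub>R (y - xp)))"
        unfolding real hp by (intro add_mono) auto
      then have "ereal hp + ereal (q xp) \<le> ereal ((1 - s) * hp + s * hy) + ereal (q (xp + s *\<^sub>R (y - xp)))"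
        using min[of "xp + s *\<^sub>R (y - xp)"] unfolding q_def[symmetric] hp by (rule order.trans[rotated])
      then have "hp + q xp \<le> (1 - s) * hp + s * hy + (q xp + s * m + s\<^sup>2 / (2 * \<eta>) * (norm w)\<^sup>2)"
        unfolding q by simp
      then have "0 \<le> s * (hy - hp + m + s / (2 * \<eta>) * (norm w)\<^sup>2)"
        by (simp add: algebra_simps power2_eq_square)
      then show ?thesis using s by (simp add: zero_le_mult_iff)
    qed
    have "((\<lambda>s. hy - hp + m + s / (2 * \<eta>) * (norm w)\<^sup>2) \<longlongrightarrow> hy - hp + m + 0 / (2 * \<eta>) * (norm w)\<^sup>2) (at_right 0)"
      using \<eta> by (intro tendsto_intros) auto
    moreover have "eventually (\<lambda>s. 0 \<le> hy - hp + m + s / (2 * \<eta>) * (norm w)\<^sup>2) (at_right 0)"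
      unfolding eventually_at_right_field using ineq by (intro exI[of _ 1]) auto
    ultimately have "0 \<le> hy - hp + m + 0 / (2 * \<eta>) * (norm w)\<^sup>2"
      by (rule tendsto_lowerbound) simp
    moreover have "(- T u - (1 / \<eta>) *\<^sub>R T (xp - c)) \<bullet> (y - xp) = - m"
      using adj[of u "y - xp"] T(2)[of "xp - c" "y - xp"]
      unfolding m_def w_def by (simp add: inner_diff_left)
    ultimately show ?thesis unfolding real hp by simp
  qed (use ninf in auto)
  then show ?thesis unfolding subgrad_def hp by simp
qed

text \<open>The descent lemma with the Lipschitz condition required on one segment and tested
  against its direction only. A block Lipschitz constant provides no more than this. The constant
  \<open>c\<close> stands for \<open>L\<close> times the squared length of \<open>d\<close>.\<close>

lemma descent_along_line:
  fixes f :: "'a::euclidean_space \<Rightarrow> real"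
  assumes f: "\<And>x. GDERIV f x :> g x"
    and L: "\<And>s. 0 \<le> s \<Longrightarrow> s \<le> 1 \<Longrightarrow> (g (x + s *\<^sub>R d) - g x) \<bullet> d \<le> s * c"
  shows "f (x + d) \<le> f x + g x \<bullet> d + c / 2"
proof -
  define \<psi> where "\<psi> s = f (x + s *\<^sub>R d) - s * (g x \<bullet> d) - s\<^sup>2 / 2 * c" for s
  have der: "(\<psi> has_real_derivative (g (x + s *\<^sub>R d) \<bullet> d - g x \<bullet> d - s * c)) (at s)" for s
  proof -
    have "((\<lambda>s. f (x + s *\<^sub>R d)) has_derivative (\<lambda>s'. (s' *\<^sub>R d) \<bullet> g (x + s *\<^sub>R d))) (at s)"
      using f[of "x + s *\<^sub>R d"] unfolding gderiv_def
      by (rule has_derivative_compose[rotated]) (auto intro!: derivative_eq_intros)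
    then have "((\<lambda>s. f (x + s *\<^sub>R d)) has_real_derivative (g (x + s *\<^sub>R d) \<bullet> d)) (at s)"
      unfolding has_field_derivative_def by (rule has_derivative_eq_rhs) (auto simp: inner_commute)
    then show ?thesis unfolding \<psi>_def by (auto intro!: derivative_eq_intros)
  qed
  have "\<psi> 1 \<le> \<psi> 0"
    by (rule DERIV_nonpos_imp_nonincreasing) (use der L in \<open>auto simp: inner_diff_left intro!: exI\<close>)
  then show ?thesis unfolding \<psi>_def by simp
qed

text \<open>Superlevel sets are open, as usual for lower semicontinuity, but \<open>H\<close> is
  controlled on \<open>S\<close> only; therefore the open sets are pulled back along
  \<open>T\<close>, whose values lie in \<open>S\<close>.\<close>

lemma ereal_lsc_borel_measurable:
  fixes H :: "'a::euclidean_space \<Rightarrow> ereal"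
  assumes T: "continuous_on UNIV T" and lsc: "lsc_on S H" and S: "range T \<subseteq> S"
  shows "(\<lambda>x. H (T x)) \<in> borel_measurable borel"
proof (rule borel_measurableI_greater)
  fix c :: ereal
  have "\<exists>U. open U \<and> x \<in> U \<and> U \<subseteq> {x. c < H (T x)}" if "c < H (T x)" for x
  proof -
    have "c < Liminf (at (T x) within S) H"
      using that lsc S unfolding lsc_on_def by (meson order_less_le_trans range_subsetD)
    then have "eventually (\<lambda>z. c < H z) (at (T x) within S)" by (rule less_LiminfD)
    then obtain V where V: "open V" "T x \<in> V" "\<And>z. z \<in> V \<Longrightarrow> z \<noteq> T x \<Longrightarrow> z \<in> S \<Longrightarrow> c < H z"
      unfolding eventually_at_topological by blast
    have "c < H (T y)" if "T y \<in> V" for y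
      using V(3)[OF that] S \<open>c < H (T x)\<close> by (cases "T y = T x") auto
    then show ?thesis
      using open_vimage[OF V(1) T] V(2) by (intro exI[of _ "T -` V"]) auto
  qed
  then have "open {x. c < H (T x)}" by (subst open_subopen) auto
  then show "{x \<in> space borel. c < H (T x)} \<in> sets borel" by simp
qed

section \<open>Convexity of sums and of compositions with linear maps\<close>

lemma ereal_convex_on_add:
  assumes "ereal_convex_on S F" "ereal_convex_on S G" "\<And>x. x \<in> S \<Longrightarrow> F x \<noteq> -\<infinity>" "\<And>x. x \<in> S \<Longrightarrow> G x \<noteq> -\<infinity>"
  shows "ereal_convex_on S (\<lambda>x. F x + G x)"
  unfolding ereal_convex_on_def
proof (intro conjI ballI allI impI)
  show "convex S" using assms(1) unfolding ereal_convex_on_def by simp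
  fix x y and u v :: real
  assume xy: "x \<in> S" "y \<in> S" and uv: "0 \<le> u \<and> 0 \<le> v \<and> u + v = 1"
  have distr: "ereal w * (a + b) = ereal w * a + ereal w * b" if "0 \<le> w" "a \<noteq> -\<infinity>" "b \<noteq> -\<infinity>" for w a b
    using that by (cases a; cases b) (auto simp: distrib_left)
  have "F (u *\<^sub>R x + v *\<^sub>R y) + G (u *\<^sub>R x + v *\<^sub>R y)
      \<le> (ereal u * F x + ereal v * F y) + (ereal u * G x + ereal v * G y)"
    using assms(1,2) xy uv unfolding ereal_convex_on_def by (intro add_mono) blast+
  also have "\<dots> = ereal u * (F x + G x) + ereal v * (F y + G y)"
    using uv xy assms(3,4) by (simp add: distr ac_simps)
  finally show "F (u *\<^sub>R x + v *\<^sub>R y) + G (u *\<^sub>R x + v *\<^sub>R y)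
      \<le> ereal u * (F x + G x) + ereal v * (F y + G y)" .
qed

lemma sum_ereal_not_MInfty:
  fixes F :: "'i \<Rightarrow> ereal"
  assumes "\<And>i. i \<in> I \<Longrightarrow> F i \<noteq> -\<infinity>"
  shows "(\<Sum>i\<in>I. F i) \<noteq> -\<infinity>"
  using assms by (induction I rule: infinite_finite_induct) auto

lemma ereal_convex_on_sum:
  assumes "finite I" "convex S" "\<And>i. i \<in> I \<Longrightarrow> ereal_convex_on S (F i)"
    "\<And>i x. i \<in> I \<Longrightarrow> x \<in> S \<Longrightarrow> F i x \<noteq> -\<infinity>"
  shows "ereal_convex_on S (\<lambda>x. \<Sum>i\<in>I. F i x)"
  using assms
proof (induction I rule: finite_induct)
  case empty
  then show ?case by (simp add: ereal_convex_on_def)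
next
  case (insert i I)
  have "(\<Sum>i\<in>I. F i x) \<noteq> -\<infinity>" if "x \<in> S" for x
    using insert.prems(3) that by (intro sum_ereal_not_MInfty) auto
  then show ?case using insert by (auto intro!: ereal_convex_on_add)
qed

lemma ereal_convex_on_linear_image:
  assumes "linear T" "ereal_convex_on (range T) F"
  shows "ereal_convex_on UNIV (\<lambda>x. F (T x))"
  using assms(2) unfolding ereal_convex_on_def
  by (auto simp: linear_add[OF assms(1)] linear_scale[OF assms(1)])

text \<open>Cauchy-Schwarz over the inertial terms; the source of the factor \<open>t\<close> in
  \<open>midas_a\<close>.\<close>

lemma norm_sum_scaleR_square_le:
  "(norm (\<Sum>i=1..t. w i *\<^sub>R D i))\<^sup>2 \<le> real t * (\<Sum>i=1..t. (w i)\<^sup>2 * (norm (D i))\<^sup>2)"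
proof -
  have "norm (\<Sum>i=1..t. w i *\<^sub>R D i) \<le> (\<Sum>i=1..t. \<bar>w i\<bar> * norm (D i))"
    by (rule order.trans[OF norm_sum]) simp
  then have "(norm (\<Sum>i=1..t. w i *\<^sub>R D i))\<^sup>2 \<le> (\<Sum>i=1..t. \<bar>w i\<bar> * norm (D i))\<^sup>2"
    by (rule power_mono) simp
  also have "\<dots> \<le> (\<Sum>i=1..t. (\<bar>w i\<bar> * norm (D i))\<^sup>2) * card {1..t}"
    by (rule sum_squared_le_sum_of_squares)
  finally show ?thesis by (simp add: power_mult_distrib mult.commute)
qed

section \<open>Geometry of the block projections\<close>

context block_decomposition
begin

lemma P_diff: "P n (x - y) = P n x - P n y" by (rule linear_diff[OF linear_P])
lemma P_add: "P n (x + y) = P n x + P n y" by (rule linear_add[OF linear_P])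
lemma P_scaleR: "P n (c *\<^sub>R x) = c *\<^sub>R P n x" by (rule linear_scale[OF linear_P])
lemma P_zero: "P n 0 = 0" by (rule linear_0[OF linear_P])

lemma inner_P_right: "x \<bullet> P n y = P n x \<bullet> y"
  by (metis inner_P inner_commute)

lemma norm_P_le: "norm (P n x) \<le> norm x"
proof -
  have "norm (P n x) * norm (P n x) = P n x \<bullet> x"
    using inner_P[of n x x] by (simp add: norm_eq_square power2_norm_eq_inner flip: power2_eq_square)
  also have "\<dots> \<le> norm (P n x) * norm x" by (rule norm_cauchy_schwarz)
  finally show ?thesis by (metis mult_le_cancel_left norm_ge_zero order_le_less not_less_iff_gr_or_eq)
qed

lemma P_single:
  assumes "\<And>m. m \<noteq> n \<Longrightarrow> P m d = 0"
  shows "P n d = d"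
proof -
  have "d = (\<Sum>m\<in>UNIV. P m d)" by (simp add: sum_P)
  also have "\<dots> = (\<Sum>m\<in>UNIV. if m = n then P n d else 0)" using assms by (intro sum.cong) auto
  finally show ?thesis by simp
qed

lemma P_replace: "P m (x + P n (y - x)) = (if m = n then P n y else P m x)"
  by (simp add: P_add P_diff P_idem P_orth)

end

text \<open>Every \<open>H n\<close> lives on the whole space but depends on block \<open>n\<close>
  alone, by \<open>H_P\<close>. Thus regularizers of differently typed factors can be added, and
  their subgradients can be taken in the range of \<open>P n\<close>.\<close>

locale block_composite = block_decomposition P
  for P :: "'m::finite \<Rightarrow> 'a::euclidean_space \<Rightarrow> 'a" +
  fixes f :: "'a \<Rightarrow> real" and gf :: "'a \<Rightarrow> 'a" and H :: "'m \<Rightarrow> 'a \<Rightarrow> ereal" and lo :: real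
  assumes f_deriv: "GDERIV f x :> gf x"
    and gf_lipschitz: "loc_lipschitz gf"
    and H_lower: "ereal lo \<le> H n x"
    and H_convex: "ereal_convex_on UNIV (H n)"
    and H_P: "H n (P n x) = H n x"
    and H_measurable [measurable]: "H n \<in> borel_measurable borel"
begin

definition Phi :: "'a \<Rightarrow> ereal" where
  "Phi x = ereal (f x) + (\<Sum>n\<in>UNIV. H n x)"

definition phi :: "'a \<Rightarrow> real" where
  "phi x = real_of_ereal (Phi x)"

text \<open>The competitor \<open>w\<close> ranges over the whole space although only its block
  \<open>n\<close> matters; the second clause fixes the remaining blocks of
  \<open>y\<close>.\<close>

definition prox_step :: "'m \<Rightarrow> real \<Rightarrow> 'a \<Rightarrow> 'a \<Rightarrow> 'a \<Rightarrow> 'a \<Rightarrow> bool" where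
  "prox_step n \<eta> g x z y \<longleftrightarrow>
     (\<forall>w. H n y + ereal (g \<bullet> P n (y - z) + 1 / (2 * \<eta>) * (norm (P n (y - z)))\<^sup>2)
        \<le> H n w + ereal (g \<bullet> P n (w - z) + 1 / (2 * \<eta>) * (norm (P n (w - z)))\<^sup>2)) \<and>
     (\<forall>m. m \<noteq> n \<longrightarrow> P m y = P m x)"

text \<open>A certificate for one block: some subgradient of \<open>H n\<close> nearly cancels that
  block of the gradient. Such certificates for all blocks bound the distance to
  stationarity.\<close>

definition residual_le :: "'m \<Rightarrow> 'a \<Rightarrow> real \<Rightarrow> bool" where
  "residual_le n x r \<longleftrightarrow> (\<exists>v. subgrad (H n) x (P n v) \<and> norm (P n (gf x + v)) \<le> r)"

lemma H_ninf: "H n x \<noteq> -\<infinity>"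
  using H_lower[of n x] by auto

lemma f_continuous: "continuous_on UNIV f"
  using f_deriv unfolding gderiv_def by (meson continuous_at_imp_continuous_on has_derivative_continuous)

lemma gf_continuous: "continuous_on UNIV gf"
  using gf_lipschitz by (rule loc_lipschitz_continuous)

lemma Phi_measurable [measurable]: "Phi \<in> borel_measurable borel"
  unfolding Phi_def using borel_measurable_continuous_onI[OF f_continuous] by measurable

lemma phi_measurable [measurable]: "phi \<in> borel_measurable borel"
  unfolding phi_def by measurable

lemma H_cong: "P n x = P n y \<Longrightarrow> H n x = H n y"
  by (metis H_P)

lemma sum_H_finite:
  "\<bar>\<Sum>n\<in>UNIV. H n x\<bar> \<noteq> \<infinity> \<longleftrightarrow> (\<forall>n. H n x \<noteq> \<infinity>)"
proof -
  have "\<bar>H n x\<bar> = \<infinity> \<longleftrightarrow> H n x = \<infinity>" for n using H_ninf[of n x] by (cases "H n x") auto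
  then show ?thesis by (simp add: sum_Inf)
qed

lemma Phi_finite: "\<bar>Phi x\<bar> \<noteq> \<infinity> \<longleftrightarrow> (\<forall>n. H n x \<noteq> \<infinity>)"
  unfolding sum_H_finite[symmetric] Phi_def by (cases "\<Sum>n\<in>UNIV. H n x") auto

lemma phi_eq:
  assumes "\<And>n. H n x \<noteq> \<infinity>"
  shows "phi x = f x + (\<Sum>n\<in>UNIV. real_of_ereal (H n x))"
proof -
  have H_real: "H n x = ereal (real_of_ereal (H n x))" for n using assms[of n] H_ninf[of n x] by (cases "H n x") auto
  have "(\<Sum>n\<in>UNIV. H n x) = (\<Sum>n\<in>UNIV. ereal (real_of_ereal (H n x)))"
    by (rule sum.cong[OF refl]) (rule H_real)
  also have "\<dots> = ereal (\<Sum>n\<in>UNIV. real_of_ereal (H n x))" by simp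
  finally have "(\<Sum>n\<in>UNIV. H n x) = ereal (\<Sum>n\<in>UNIV. real_of_ereal (H n x))" .
  then show ?thesis unfolding phi_def Phi_def by simp
qed

lemma sum_H_convex: "ereal_convex_on UNIV (\<lambda>x. \<Sum>n\<in>UNIV. H n x)"
  by (intro ereal_convex_on_sum) (auto simp: H_convex H_ninf)

text \<open>The inequality is tested at the point \<open>w\<close> that has block \<open>n\<close>
  of \<open>y\<close> and the other blocks of \<open>x\<close>. The other summands then agree on
  both sides, and they are finite, so they cancel.\<close>

lemma subgrad_block:
  assumes "subgrad (\<lambda>x. \<Sum>n\<in>UNIV. H n x) x v"
  shows "subgrad (H n) x (P n v)"
proof -
  have fin: "H m x \<noteq> \<infinity>" for m using assms sum_H_finite[of x] by (simp add: subgrad_def)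
  define rest where "rest = (\<Sum>m\<in>UNIV - {n}. H m x)"
  have rest: "\<bar>rest\<bar> \<noteq> \<infinity>" unfolding rest_def using fin H_ninf by (auto simp: sum_Inf)
  then obtain r where r: "rest = ereal r" by (cases rest) auto
  obtain hx where hx: "H n x = ereal hx" using fin[of n] H_ninf[of n x] by (cases "H n x") auto
  have "H n x + ereal (P n v \<bullet> (y - x)) \<le> H n y" for y
  proof -
    define w where "w = x + P n (y - x)"
    have "H m w = (if m = n then H n y else H m x)" for m
      using H_P[of m w] H_P[of m x] H_P[of n y] unfolding w_def P_replace by (cases "m = n") auto
    then have "(\<Sum>m\<in>UNIV. H m w) = H n y + rest"
      unfolding rest_def by (subst sum.remove[of _ n]) (auto intro!: sum.cong)
    moreover have "(\<Sum>m\<in>UNIV. H m x) = H n x + rest"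
      unfolding rest_def by (subst sum.remove[of _ n]) auto
    moreover have "(\<Sum>m\<in>UNIV. H m x) + ereal (v \<bullet> (w - x)) \<le> (\<Sum>m\<in>UNIV. H m w)"
      using assms unfolding subgrad_def by blast
    ultimately have "H n x + rest + ereal (v \<bullet> P n (y - x)) \<le> H n y + rest"
      unfolding w_def by simp
    then show ?thesis unfolding r hx inner_P_right by (cases "H n y") auto
  qed
  then show ?thesis unfolding subgrad_def hx by simp
qed

lemma subgrad_sum:
  assumes "\<And>n. subgrad (H n) x (v n)"
  shows "subgrad (\<lambda>x. \<Sum>n\<in>UNIV. H n x) x (\<Sum>n\<in>UNIV. v n)"
proof -
  have "(\<Sum>n\<in>UNIV. H n x) + ereal ((\<Sum>n\<in>UNIV. v n) \<bullet> (y - x)) = (\<Sum>n\<in>UNIV. H n x + ereal (v n \<bullet> (y - x)))" for y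
    by (simp add: inner_sum_left sum.distrib)
  also have "(\<Sum>n\<in>UNIV. H n x + ereal (v n \<bullet> (y - x))) \<le> (\<Sum>n\<in>UNIV. H n y)" for y
    using assms unfolding subgrad_def by (intro sum_mono) auto
  finally have "(\<Sum>n\<in>UNIV. H n x) + ereal ((\<Sum>n\<in>UNIV. v n) \<bullet> (y - x)) \<le> (\<Sum>n\<in>UNIV. H n y)" for y .
  moreover have "H n x \<noteq> \<infinity>" for n using assms[of n] by (auto simp: subgrad_def)
  ultimately show ?thesis using sum_H_finite[of x] by (simp add: subgrad_def)
qed

text \<open>Supplies certificates for the blocks that have not been sampled yet, where no prox step
  has produced a subgradient. By convexity a limiting subgradient at the initial point splits into
  subgradients of the individual \<open>H n\<close>.\<close>

lemma residual_le_init: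
  assumes "limiting_subdiff Phi x \<noteq> {}"
  shows "\<exists>r\<ge>0. \<forall>n. residual_le n x r"
proof -
  obtain v where "v \<in> limiting_subdiff Phi x" using assms by auto
  then have "v \<in> limiting_subdiff (\<lambda>y. ereal (f y) + (\<Sum>n\<in>UNIV. H n y)) x" unfolding Phi_def[abs_def] .
  moreover have "isCont gf x" using gf_continuous by (simp add: continuous_on_eq_continuous_at)
  moreover have "(\<Sum>n\<in>UNIV. H n y) \<noteq> -\<infinity>" for y using H_ninf by (intro sum_ereal_not_MInfty)
  ultimately have "subgrad (\<lambda>x. \<Sum>n\<in>UNIV. H n x) x (v - gf x)"
    by (intro limiting_subdiff_convexD[OF f_deriv _ sum_H_convex])
  from subgrad_block[OF this] show ?thesis unfolding residual_le_def
    \<comment> \<open>With the subgradient \<open>v - gf x\<close> the residual is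
      \<open>P n v\<close>, whose norm is at most that of \<open>v\<close>.\<close>
    by (intro exI[of _ "norm v"]) (auto intro!: exI[of _ "v - gf x"] norm_P_le)
qed

text \<open>Neither \<open>H n\<close> nor the inner product with \<open>P n v\<close> notices a
  change in other blocks, so the old \<open>v\<close> remains a subgradient. Only the gradient part
  of the residual moves.\<close>

lemma residual_le_keep:
  assumes "residual_le n x r" "P n y = P n x" "norm (gf y - gf x) \<le> d"
  shows "residual_le n y (r + d)"
proof -
  obtain v where v: "subgrad (H n) x (P n v)" "norm (P n (gf x + v)) \<le> r"
    using assms(1) unfolding residual_le_def by blast
  have "P n v \<bullet> (z - y) = P n v \<bullet> (z - x)" for z
    by (metis P_diff assms(2) inner_P)
  then have "subgrad (H n) y (P n v)"
    using v(1) H_cong[OF assms(2)] unfolding subgrad_def by simp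
  moreover have "P n (gf y + v) = P n (gf x + v) + P n (gf y - gf x)" by (simp add: P_add P_diff)
  then have "norm (P n (gf y + v)) \<le> r + d"
    using v(2) assms(3) norm_P_le[of n "gf y - gf x"] norm_triangle_ineq[of "P n (gf x + v)" "P n (gf y - gf x)"]
    by simp
  ultimately show ?thesis unfolding residual_le_def by blast
qed

lemma prox_step_subgrad:
  assumes "prox_step n \<eta> g x z y" "0 < \<eta>" "H n x \<noteq> \<infinity>"
  shows "subgrad (H n) y (P n (- g - (1 / \<eta>) *\<^sub>R (y - z)))"
proof -
  have "subgrad (H n) y (- P n g - (1 / \<eta>) *\<^sub>R P n (y - z))"
    using assms unfolding prox_step_def
    by (intro prox_subgrad[where T = "P n" and ?x0.0 = x]) (auto simp: H_convex H_ninf linear_P inner_P)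
  then show ?thesis by (simp add: P_diff P_scaleR linear_neg[OF linear_P])
qed

lemma prox_step_finite:
  assumes "prox_step n \<eta> g x z y" "0 < \<eta>" "\<And>m. H m x \<noteq> \<infinity>"
  shows "H m y \<noteq> \<infinity>"
proof (cases "m = n")
  case True
  then show ?thesis using prox_step_subgrad[OF assms(1,2) assms(3)[of n]] unfolding subgrad_def by auto
next
  case False
  then show ?thesis using assms(1) H_cong[of m y x] assms(3)[of m] unfolding prox_step_def by simp
qed

text \<open>Inserting the subgradient left by the prox step, the residual consists of the mismatch
  between the new gradient and the gradient that was used, and of the displacement from the prox
  centre divided by the stepsize.\<close>

lemma residual_le_prox_step:
  assumes "prox_step n \<eta> g x z y" "0 < \<eta>" "H n x \<noteq> \<infinity>"
    and "norm (P n (gf y) - P n g) + (1 / \<eta>) * norm (y - z) \<le> r"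
  shows "residual_le n y r"
proof -
  have "P n (gf y + (- g - (1 / \<eta>) *\<^sub>R (y - z))) = (P n (gf y) - P n g) - (1 / \<eta>) *\<^sub>R P n (y - z)"
    by (simp add: P_diff P_add P_scaleR linear_neg[OF linear_P])
  then have "norm (P n (gf y + (- g - (1 / \<eta>) *\<^sub>R (y - z)))) \<le> norm (P n (gf y) - P n g) + norm ((1 / \<eta>) *\<^sub>R P n (y - z))"
    by (metis norm_triangle_ineq4)
  also have "norm ((1 / \<eta>) *\<^sub>R P n (y - z)) \<le> (1 / \<eta>) * norm (y - z)"
    using norm_P_le[of n "y - z"] assms(2) by (simp add: divide_right_mono)
  finally show ?thesis using prox_step_subgrad[OF assms(1-3)] assms(4) unfolding residual_le_def
    by (intro exI[of _ "- g - (1 / \<eta>) *\<^sub>R (y - z)"]) auto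
qed

text \<open>The block subgradients add up to a subgradient of the whole regularizer, hence together
  with the gradient to an element of the regular subdifferential; its norm is bounded block by
  block.\<close>

lemma dist0_residual:
  assumes "\<And>n. residual_le n x (r n)"
  shows "dist0 (limiting_subdiff Phi x) \<le> ennreal (\<Sum>n\<in>UNIV. r n)"
proof -
  obtain v where v: "\<And>n. subgrad (H n) x (P n (v n))" "\<And>n. norm (P n (gf x + v n)) \<le> r n"
    using assms unfolding residual_le_def by metis
  have "gf x + (\<Sum>n\<in>UNIV. P n (v n)) \<in> regular_subdiff Phi x"
    unfolding Phi_def[abs_def] by (rule regular_subdiff_add[OF f_deriv subgrad_sum[OF v(1)]])
  then have "gf x + (\<Sum>n\<in>UNIV. P n (v n)) \<in> limiting_subdiff Phi x"
    using regular_subset_limiting by blast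
  then have "dist0 (limiting_subdiff Phi x) \<le> ennreal (norm (gf x + (\<Sum>n\<in>UNIV. P n (v n))))"
    by (rule dist0_le)
  also have "gf x + (\<Sum>n\<in>UNIV. P n (v n)) = (\<Sum>n\<in>UNIV. P n (gf x + v n))"
    by (simp add: P_add sum.distrib sum_P)
  also have "norm \<dots> \<le> (\<Sum>n\<in>UNIV. r n)" by (rule sum_norm_le) (rule v(2))
  finally show ?thesis by (simp add: ennreal_leI)
qed

lemma dist0_minimizer:
  assumes "\<And>n. H n x \<noteq> \<infinity>" "\<And>y. Phi x \<le> Phi y"
  shows "dist0 (limiting_subdiff Phi x) = 0"
proof -
  have "0 \<in> limiting_subdiff Phi x"
    by (rule subsetD[OF regular_subset_limiting zero_in_regular_subdiff]) (auto simp: assms Phi_finite)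
  from dist0_le[OF this] show ?thesis by simp
qed

text \<open>Stationarity of \<open>x\<close> makes \<open>- gf x\<close> a subgradient of the
  regularizer at \<open>x\<close>, and \<open>y\<close> does at least as well as \<open>x\<close> in
  the prox problem. Adding both inequalities cancels the linear terms because \<open>g\<close> is
  exact in block \<open>n\<close>, and only the squared distance remains.\<close>

lemma prox_step_minimizer:
  assumes fin: "\<And>n. H n x \<noteq> \<infinity>" and min: "\<And>y. Phi x \<le> Phi y"
    and step: "prox_step n \<eta> g x x y" and "0 < \<eta>" and g: "P n g = P n (gf x)"
  shows "y = x"
proof -
  have "0 \<in> regular_subdiff (\<lambda>y. ereal (f y) + (\<Sum>n\<in>UNIV. H n y)) x"
    unfolding Phi_def[abs_def, symmetric] by (rule zero_in_regular_subdiff) (auto simp: fin min Phi_finite)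
  moreover have "(\<Sum>n\<in>UNIV. H n y) \<noteq> -\<infinity>" for y using H_ninf by (intro sum_ereal_not_MInfty)
  ultimately have "subgrad (\<lambda>x. \<Sum>n\<in>UNIV. H n x) x (0 - gf x)"
    by (intro regular_subdiff_convexD[OF f_deriv sum_H_convex])
  from subgrad_block[OF this, of n]
  have a: "H n x + ereal (P n (- gf x) \<bullet> (y - x)) \<le> H n y" unfolding subgrad_def by simp
  have b: "H n y + ereal (g \<bullet> P n (y - x) + 1 / (2 * \<eta>) * (norm (P n (y - x)))\<^sup>2)
        \<le> H n x + ereal (g \<bullet> P n (x - x) + 1 / (2 * \<eta>) * (norm (P n (x - x)))\<^sup>2)"
    using step unfolding prox_step_def by blast
  obtain hx where hx: "H n x = ereal hx" using fin[of n] H_ninf[of n x] by (cases "H n x") auto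
  then obtain hy where hy: "H n y = ereal hy" using b H_ninf[of n y] by (cases "H n y") auto
  have "1 / (2 * \<eta>) * (norm (P n (y - x)))\<^sup>2 \<le> 0"
    using a b unfolding hx hy inner_P_right g by (simp add: P_zero linear_neg[OF linear_P])
  then have "P n (y - x) = 0" using \<open>0 < \<eta>\<close> by (simp add: divide_le_0_iff)
  moreover have "P m (y - x) = 0" if "m \<noteq> n" for m
    using step that unfolding prox_step_def by (simp add: P_diff)
  ultimately show ?thesis using P_single[of n "y - x"] by simp
qed

text \<open>The prox objective is compared at \<open>y\<close> and at the old point
  \<open>x\<close>; this yields the coefficient \<open>1 / (2 * \<eta>)\<close> of the decrease. The
  error terms measure how far \<open>g\<close> is from the gradient at \<open>w\<close>, how far
  \<open>w\<close> is from \<open>x\<close>, and how far the prox centre \<open>z\<close> is from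
  \<open>x\<close>.\<close>

lemma prox_step_descent:
  assumes step: "prox_step n \<eta> g x z y" and \<eta>: "0 < \<eta>" and fin: "\<And>m. H m x \<noteq> \<infinity>"
    and L: "\<And>Y Z. norm (P n (gf (x + P n (Y - x))) - P n (gf (x + P n (Z - x)))) \<le> L * norm (P n (Y - Z))" "0 \<le> L"
    and e: "norm (P n g - P n (gf (x + P n (w - x)))) \<le> e"
  shows "phi y \<le> phi x + norm (y - x) * e + L * norm (w - x) * norm (y - x) + L / 2 * (norm (y - x))\<^sup>2
     - 1 / (2 * \<eta>) * (norm (y - x))\<^sup>2 + (1 / \<eta>) * norm (y - x) * norm (z - x)"
proof -
  define d where "d = y - x"
  have "P m d = 0" if "m \<noteq> n" for m
    using step that unfolding prox_step_def d_def by (simp add: P_diff)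
  then have Pd: "P n d = d" by (rule P_single)
  \<comment> \<open>Since \<open>d\<close> lies in block \<open>n\<close>, its inner products with
    gradients see that block only, and the block Lipschitz bound applies.\<close>
  have fd: "f (x + d) \<le> f x + gf x \<bullet> d + (L * (norm d)\<^sup>2) / 2"
  proof (rule descent_along_line[OF f_deriv])
    fix s :: real assume s: "0 \<le> s" "s \<le> 1"
    have "(gf (x + s *\<^sub>R d) - gf x) \<bullet> d = (P n (gf (x + s *\<^sub>R d)) - P n (gf x)) \<bullet> d"
      by (metis P_diff Pd inner_P_right)
    also have "\<dots> \<le> norm (P n (gf (x + s *\<^sub>R d)) - P n (gf x)) * norm d" by (rule norm_cauchy_schwarz)
    also have "norm (P n (gf (x + s *\<^sub>R d)) - P n (gf x)) \<le> L * norm (s *\<^sub>R d)"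
      using L(1)[of "x + s *\<^sub>R d" x] by (simp add: P_scaleR Pd P_zero)
    finally show "(gf (x + s *\<^sub>R d) - gf x) \<bullet> d \<le> s * (L * (norm d)\<^sup>2)"
      using s by (simp add: mult_right_mono power2_eq_square ac_simps)
  qed
  have b: "H n y + ereal (g \<bullet> P n (y - z) + 1 / (2 * \<eta>) * (norm (P n (y - z)))\<^sup>2)
        \<le> H n x + ereal (g \<bullet> P n (x - z) + 1 / (2 * \<eta>) * (norm (P n (x - z)))\<^sup>2)"
    using step unfolding prox_step_def by blast
  have finy: "H m y \<noteq> \<infinity>" for m using prox_step_finite[OF step \<eta> fin] .
  obtain hx where hx: "H n x = ereal hx" using fin[of n] H_ninf[of n x] by (cases "H n x") auto
  obtain hy where hy: "H n y = ereal hy" using finy[of n] H_ninf[of n y] by (cases "H n y") auto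
  define q where "q = P n (z - x)"
  have "P n (y - z) = P n d - q" unfolding q_def d_def by (simp add: P_diff)
  then have q1: "P n (y - z) = d - q" unfolding Pd .
  have q2: "P n (x - z) = - q" unfolding q_def by (simp add: P_diff)
  have "hy + (g \<bullet> (d - q) + 1 / (2 * \<eta>) * (norm (d - q))\<^sup>2) \<le> hx + (g \<bullet> (- q) + 1 / (2 * \<eta>) * (norm (- q))\<^sup>2)"
    using b unfolding hx hy q1 q2 by simp
  moreover have "(norm (d - q))\<^sup>2 = (norm d)\<^sup>2 - 2 * (d \<bullet> q) + (norm q)\<^sup>2"
    unfolding power2_norm_eq_inner by (simp add: algebra_simps inner_commute)
  then have "1 / (2 * \<eta>) * (norm (d - q))\<^sup>2 = 1 / (2 * \<eta>) * (norm d)\<^sup>2 - (1 / \<eta>) * (d \<bullet> q) + 1 / (2 * \<eta>) * (norm q)\<^sup>2"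
    by (simp add: diff_divide_distrib add_divide_distrib)
  ultimately have hh: "hy \<le> hx - g \<bullet> d - 1 / (2 * \<eta>) * (norm d)\<^sup>2 + (1 / \<eta>) * (d \<bullet> q)"
    unfolding inner_diff_right inner_minus_right norm_minus_cancel by linarith
  have "d \<bullet> q \<le> norm d * norm (z - x)"
    unfolding q_def using norm_cauchy_schwarz[of d "P n (z - x)"] norm_P_le[of n "z - x"]
    by (smt (verit) mult_left_mono norm_ge_zero)
  then have dq: "(1 / \<eta>) * (d \<bullet> q) \<le> (1 / \<eta>) * norm d * norm (z - x)"
    using \<eta> mult_left_mono[of "d \<bullet> q" "norm d * norm (z - x)" "1 / \<eta>"] by (simp add: mult.assoc)
  \<comment> \<open>The exact block gradient at the point where it is estimated, inserted between
    the gradient at \<open>x\<close> and the estimate \<open>g\<close>.\<close>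
  define u where "u = P n (gf (x + P n (w - x)))"
  have "gf x \<bullet> d - g \<bullet> d = (P n (gf x) - u) \<bullet> d + (u - P n g) \<bullet> d"
    using Pd by (metis (no_types, lifting) P_diff diff_add_cancel add_diff_eq inner_P_right inner_add_left inner_diff_left)
  also have "\<dots> \<le> norm (P n (gf x) - u) * norm d + norm (u - P n g) * norm d"
    by (intro add_mono norm_cauchy_schwarz)
  also have "norm (P n (gf x) - u) \<le> L * norm (w - x)"
  proof -
    have "norm (P n (gf x) - u) \<le> L * norm (P n (x - w))" using L(1)[of x w] unfolding u_def by (simp add: P_zero)
    also have "\<dots> \<le> L * norm (x - w)" using L(2) norm_P_le by (intro mult_left_mono) auto
    finally show ?thesis by (simp add: norm_minus_commute)
  qed
  also have "norm (u - P n g) \<le> e" using e unfolding u_def by (simp add: norm_minus_commute)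
  finally have gd: "gf x \<bullet> d - g \<bullet> d \<le> L * norm (w - x) * norm d + e * norm d"
    by (simp add: mult_right_mono)
  have "real_of_ereal (H m y) = real_of_ereal (H m x)" if "m \<noteq> n" for m
    using step that H_cong[of m y x] unfolding prox_step_def by simp
  then have "(\<Sum>m\<in>UNIV. real_of_ereal (H m y)) - hy = (\<Sum>m\<in>UNIV. real_of_ereal (H m x)) - hx"
    by (subst (1 2) sum.remove[of _ n]) (auto simp: hx hy intro!: sum.cong)
  then have "phi y - phi x = f y - f x + hy - hx"
    using phi_eq[OF fin] phi_eq[OF finy] by simp
  moreover have "f y \<le> f x + gf x \<bullet> d + L * (norm d)\<^sup>2 / 2" using fd unfolding d_def by simp
  ultimately show ?thesis using hh dq gd unfolding d_def[symmetric]
    by (simp add: algebra_simps)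
qed

text \<open>Young's inequality is applied to each mixed term of the previous descent estimate:
  weight 1 for the two inertial displacements, weight \<open>\<gamma>\<close> for the gradient
  error. The terms in the squared new move then add up exactly to \<open>midas_b\<close>; its part
  with \<open>L\<close> is half from the descent lemma and half from the extrapolation of the
  gradient point.\<close>

lemma inertial_step_descent:
  fixes a :: "nat \<Rightarrow> 'a"
  assumes step: "prox_step n (\<eta> k) g (a k) (extrapolate \<alpha> t a k) (a (Suc k))"
    and \<eta>: "0 < \<eta> k" and fin: "\<And>m. H m (a k) \<noteq> \<infinity>"
    and L: "\<And>Y Z. norm (P n (gf (a k + P n (Y - a k))) - P n (gf (a k + P n (Z - a k)))) \<le> L * norm (P n (Y - Z))" "0 \<le> L"
    and e: "norm (P n g - P n (gf (a k + P n (extrapolate \<beta> t a k - a k)))) \<le> e"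
    and \<gamma>: "0 < \<gamma>" and \<alpha>: "\<And>j. 0 \<le> \<alpha> j"
  shows "phi (a (Suc k)) \<le> phi (a k) - midas_b t L \<gamma> \<eta> \<alpha> k * (norm (a (Suc k) - a k))\<^sup>2
     + (\<Sum>i=1..t. (L * real t * (\<beta> (k + 1 - i))\<^sup>2 / 2 + \<alpha> (k + 1 - i) / (2 * \<eta> k))
          * (norm (a (k + 1 - i) - a (k - i)))\<^sup>2) + e\<^sup>2 / (2 * \<gamma>)"
proof -
  define d where "d = norm (a (Suc k) - a k)"
  define D where "D i = norm (a (k + 1 - i) - a (k - i))" for i
  define W where "W = norm (extrapolate \<beta> t a k - a k)"
  define Z where "Z = norm (extrapolate \<alpha> t a k - a k)"
  have W: "W\<^sup>2 \<le> real t * (\<Sum>i=1..t. (\<beta> (k + 1 - i))\<^sup>2 * (D i)\<^sup>2)"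
    unfolding W_def D_def extrapolate_def add_diff_cancel_left' by (rule norm_sum_scaleR_square_le)
  have "Z \<le> (\<Sum>i=1..t. norm (\<alpha> (k + 1 - i) *\<^sub>R (a (k + 1 - i) - a (k - i))))"
    unfolding Z_def extrapolate_def add_diff_cancel_left' by (rule norm_sum)
  then have Z: "Z \<le> (\<Sum>i=1..t. \<alpha> (k + 1 - i) * D i)"
    unfolding D_def using \<alpha> by simp
  have "d * Z \<le> d * (\<Sum>i=1..t. \<alpha> (k + 1 - i) * D i)"
    by (intro mult_left_mono Z) (simp add: d_def)
  also have "\<dots> = (\<Sum>i=1..t. \<alpha> (k + 1 - i) * (d * D i))" by (simp add: sum_distrib_left ac_simps)
  also have "\<dots> \<le> (\<Sum>i=1..t. \<alpha> (k + 1 - i) * ((d\<^sup>2 + (D i)\<^sup>2) / 2))"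
  proof (intro sum_mono mult_left_mono \<alpha>)
    fix i show "d * D i \<le> (d\<^sup>2 + (D i)\<^sup>2) / 2" using sum_squares_bound[of d "D i"] by simp
  qed
  also have "\<dots> = (\<Sum>i=1..t. \<alpha> (k + 1 - i)) * d\<^sup>2 / 2 + (\<Sum>i=1..t. \<alpha> (k + 1 - i) * (D i)\<^sup>2) / 2"
    by (simp add: sum_distrib_left sum_distrib_right sum_divide_distrib sum.distrib[symmetric] field_simps)
  finally have "1 / \<eta> k * (d * Z) \<le> 1 / \<eta> k * ((\<Sum>i=1..t. \<alpha> (k + 1 - i)) * d\<^sup>2 / 2 + (\<Sum>i=1..t. \<alpha> (k + 1 - i) * (D i)\<^sup>2) / 2)"
    using \<eta> by (intro mult_left_mono) auto
  also have "\<dots> = (\<Sum>i=1..t. \<alpha> (k + 1 - i)) / (2 * \<eta> k) * d\<^sup>2 + (\<Sum>i=1..t. \<alpha> (k + 1 - i) / (2 * \<eta> k) * (D i)\<^sup>2)"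
    using \<eta> by (simp add: sum_divide_distrib sum_distrib_left field_simps)
  finally have dZ: "1 / \<eta> k * (d * Z) \<le> (\<Sum>i=1..t. \<alpha> (k + 1 - i)) / (2 * \<eta> k) * d\<^sup>2 + (\<Sum>i=1..t. \<alpha> (k + 1 - i) / (2 * \<eta> k) * (D i)\<^sup>2)" .
  have "2 * (W * d) \<le> W\<^sup>2 + d\<^sup>2" using sum_squares_bound[of W d] by simp
  then have "2 * (W * d) \<le> real t * (\<Sum>i=1..t. (\<beta> (k + 1 - i))\<^sup>2 * (D i)\<^sup>2) + d\<^sup>2" using W by linarith
  then have "L / 2 * (2 * (W * d)) \<le> L / 2 * (real t * (\<Sum>i=1..t. (\<beta> (k + 1 - i))\<^sup>2 * (D i)\<^sup>2) + d\<^sup>2)"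
    using L(2) by (intro mult_left_mono) auto
  also have "\<dots> = (\<Sum>i=1..t. L * real t * (\<beta> (k + 1 - i))\<^sup>2 / 2 * (D i)\<^sup>2) + L / 2 * d\<^sup>2"
    by (simp add: sum_distrib_left field_simps)
  finally have LW: "L * W * d \<le> (\<Sum>i=1..t. L * real t * (\<beta> (k + 1 - i))\<^sup>2 / 2 * (D i)\<^sup>2) + L / 2 * d\<^sup>2" by simp
  have "0 \<le> (e - \<gamma> * d)\<^sup>2 / (2 * \<gamma>)" using \<gamma> by simp
  also have "\<dots> = e\<^sup>2 / (2 * \<gamma>) + \<gamma> / 2 * d\<^sup>2 - d * e"
    using \<gamma> by (simp add: power2_diff field_simps power2_eq_square)
  finally have de: "d * e \<le> e\<^sup>2 / (2 * \<gamma>) + \<gamma> / 2 * d\<^sup>2" by simp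
  have b: "midas_b t L \<gamma> \<eta> \<alpha> k * d\<^sup>2 = 1 / (2 * \<eta> k) * d\<^sup>2 - (\<Sum>i=1..t. \<alpha> (k + 1 - i)) / (2 * \<eta> k) * d\<^sup>2 - L * d\<^sup>2 - \<gamma> / 2 * d\<^sup>2"
    unfolding midas_b_def using \<eta> by (simp add: field_simps)
  have "phi (a (Suc k)) \<le> phi (a k) + d * e + L * W * d + L / 2 * d\<^sup>2 - 1 / (2 * \<eta> k) * d\<^sup>2 + 1 / \<eta> k * d * Z"
    unfolding d_def W_def Z_def by (rule prox_step_descent[OF step \<eta> fin L e])
  also have "\<dots> \<le> phi (a k) - midas_b t L \<gamma> \<eta> \<alpha> k * d\<^sup>2 + ((\<Sum>i=1..t. L * real t * (\<beta> (k + 1 - i))\<^sup>2 / 2 * (D i)\<^sup>2)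
      + (\<Sum>i=1..t. \<alpha> (k + 1 - i) / (2 * \<eta> k) * (D i)\<^sup>2)) + e\<^sup>2 / (2 * \<gamma>)"
    using dZ LW de unfolding b mult.assoc[of "1 / \<eta> k"] by linarith
  finally show ?thesis unfolding d_def D_def by (simp only: sum.distrib[symmetric] distrib_right[symmetric])
qed

end

section \<open>Recursive inequalities\<close>

lemma summable_contraction:
  fixes x c :: "nat \<Rightarrow> real"
  assumes nonneg: "\<And>k. 0 \<le> x k" "\<And>k. 0 \<le> c k" and \<theta>: "0 \<le> \<theta>" "\<theta> < 1"
    and step: "\<And>k. x (Suc k) \<le> \<theta> * x k + c k" and c: "summable c"
  shows "summable x"
proof (rule summableI_nonneg_bounded)
  \<comment> \<open>The extra term \<open>\<theta> * x n\<close> makes the induction close: passing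
    to \<open>Suc n\<close> increases the left side by \<open>x (Suc n) - \<theta> * x n\<close>,
    which is at most \<open>c n\<close>.\<close>
  have "(1 - \<theta>) * sum x {..n} + \<theta> * x n \<le> x 0 + sum c {..<n}" for n
  proof (induction n)
    case 0
    then show ?case by (simp add: algebra_simps)
  next
    case (Suc n)
    then show ?case using step[of n] by (simp add: algebra_simps)
  qed
  moreover have "sum c {..<n} \<le> suminf c" for n by (rule sum_le_suminf[OF c]) (auto simp: nonneg)
  ultimately have "(1 - \<theta>) * sum x {..n} + \<theta> * x n \<le> x 0 + suminf c" for n
    by (meson add_left_mono order.trans)
  then have "(1 - \<theta>) * sum x {..n} \<le> x 0 + suminf c" for n
    using mult_nonneg_nonneg[OF \<theta>(1) nonneg(1), of n for n] by (meson add_increasing2 order.trans order_refl)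
  then have le: "sum x {..n} \<le> (x 0 + suminf c) / (1 - \<theta>)" for n
    using \<theta> by (simp add: pos_le_divide_eq mult.commute)
  show "sum x {..<n} \<le> (x 0 + suminf c) / (1 - \<theta>)" for n
  proof -
    have "sum x {..<n} \<le> sum x {..n}" by (rule sum_mono2) (auto simp: nonneg)
    then show ?thesis using le[of n] by simp
  qed
qed (rule nonneg)

text \<open>For \<open>k + 1 \<le> i\<close> truncated subtraction yields index 0, where
  \<open>x\<close> vanishes, so a delay adds no initial terms.\<close>

lemma sum_delayed_le:
  fixes x :: "nat \<Rightarrow> real"
  assumes "x 0 = 0" "\<And>k. 0 \<le> x k" "1 \<le> i"
  shows "(\<Sum>k<n. x (k + 1 - i)) \<le> sum x {..n}"
proof -
  have "(\<Sum>k<n. x (k + 1 - i)) = sum x {..n - i}"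
  proof (induction n)
    case 0
    then show ?case using assms by simp
  next
    case (Suc n)
    show ?case
    proof (cases "i \<le> n")
      case True
      then have "Suc n - i = Suc (n - i)" by simp
      then show ?thesis using Suc by simp
    next
      case False
      then show ?thesis using Suc assms(1,3) by simp
    qed
  qed
  also have "\<dots> \<le> sum x {..n}" by (rule sum_mono2) (auto simp: assms)
  finally show ?thesis .
qed

lemma summable_delayed:
  fixes x :: "nat \<Rightarrow> real"
  assumes "summable x" "x 0 = 0" "\<And>k. 0 \<le> x k" "1 \<le> i"
  shows "summable (\<lambda>k. x (k + 1 - i))"
proof (rule summableI_nonneg_bounded)
  show "(\<Sum>k<n. x (k + 1 - i)) \<le> suminf x" for n
    using sum_delayed_le[of x i n, OF assms(2-4)] sum_le_suminf[OF assms(1), of "{..n}"] assms(3) by force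
qed (use assms in auto)

text \<open>Summed over time, each delayed sequence contributes at most the partial sum of
  \<open>x\<close> itself. As the weights \<open>a i\<close> together stay below \<open>b\<close>,
  the decrease wins by a fixed factor, and the lower bound on \<open>W\<close> limits the
  total.\<close>

lemma summable_descent:
  fixes x W :: "nat \<Rightarrow> real" and a :: "nat \<Rightarrow> real"
  assumes x: "x 0 = 0" "\<And>k. 0 \<le> x k" and W: "\<And>k. lo \<le> W k"
    and a: "\<And>i. 0 \<le> a i" and b: "(\<Sum>i=1..m. a i) < b"
    and step: "\<And>k. k0 \<le> k \<Longrightarrow> W (Suc k) \<le> W k - b * x (Suc k) + (\<Sum>i=1..m. a i * x (k + 1 - i))"
  shows "summable x"
proof (rule summableI_nonneg_bounded)
  define s where "s n = sum x {..n}" for n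
  \<comment> \<open>The delayed sums start at 0 rather than at \<open>k0\<close>; being nonnegative,
    they leave the base case valid and match \<open>sum_delayed_le\<close>.\<close>
  have telescope: "W n + b * (s n - s k0) \<le> W k0 + (\<Sum>i=1..m. a i * (\<Sum>k<n. x (k + 1 - i)))"
    if "k0 \<le> n" for n
    using that
  proof (induction n rule: dec_induct)
    case base
    then show ?case using a x(2) by (auto intro!: sum_nonneg mult_nonneg_nonneg)
  next
    case (step n)
    have "(\<Sum>i=1..m. a i * (\<Sum>k<Suc n. x (k + 1 - i)))
        = (\<Sum>i=1..m. a i * (\<Sum>k<n. x (k + 1 - i))) + (\<Sum>i=1..m. a i * x (n + 1 - i))"
      by (simp add: distrib_left sum.distrib)
    moreover have "s (Suc n) = s n + x (Suc n)" unfolding s_def by simp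
    ultimately show ?case using step.IH assms(6)[OF step.hyps(1)] by (simp add: algebra_simps)
  qed
  have bound: "s n \<le> (W k0 - lo + b * s k0) / (b - (\<Sum>i=1..m. a i))" if "k0 \<le> n" for n
  proof -
    have "(\<Sum>i=1..m. a i * (\<Sum>k<n. x (k + 1 - i))) \<le> (\<Sum>i=1..m. a i * s n)"
      unfolding s_def by (intro sum_mono mult_left_mono sum_delayed_le a x) auto
    then have "(\<Sum>i=1..m. a i * (\<Sum>k<n. x (k + 1 - i))) \<le> (\<Sum>i=1..m. a i) * s n"
      by (simp add: sum_distrib_right)
    then have "(b - (\<Sum>i=1..m. a i)) * s n \<le> W k0 - lo + b * s k0"
      using telescope[OF that] W[of n] by (simp add: algebra_simps)
    then show ?thesis using b by (simp add: pos_le_divide_eq mult.commute)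
  qed
  show "sum x {..<n} \<le> (W k0 - lo + b * s k0) / (b - (\<Sum>i=1..m. a i))" for n
  proof -
    have "sum x {..<n} \<le> s (max n k0)" unfolding s_def by (rule sum_mono2) (auto simp: x)
    then show ?thesis using bound[of "max n k0"] by simp
  qed
qed (rule x)

text \<open>\<open>real_of_ereal\<close> maps infinite values to 0, so the real-valued limits carry
  information only after infinite values have been excluded.\<close>

lemma liminf_real_finite:
  assumes "\<And>k. \<bar>x k\<bar> \<le> (C::real)"
  shows "liminf (\<lambda>k. ereal (x k)) = ereal (real_liminf x)" "limsup (\<lambda>k. ereal (x k)) = ereal (real_limsup x)"
proof -
  have l: "ereal (- C) \<le> liminf (\<lambda>k. ereal (x k))" using assms by (intro Liminf_bounded) (auto simp: abs_le_iff minus_le_iff)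
  have u: "limsup (\<lambda>k. ereal (x k)) \<le> ereal C" using assms by (intro Limsup_bounded) (auto simp: abs_le_iff)
  have lu: "liminf (\<lambda>k. ereal (x k)) \<le> limsup (\<lambda>k. ereal (x k))" by (intro Liminf_le_Limsup) simp
  show "liminf (\<lambda>k. ereal (x k)) = ereal (real_liminf x)" unfolding real_liminf_def
    using l u lu by (cases "liminf (\<lambda>k. ereal (x k))") auto
  show "limsup (\<lambda>k. ereal (x k)) = ereal (real_limsup x)" unfolding real_limsup_def
    using l u lu by (cases "limsup (\<lambda>k. ereal (x k))") auto
qed

lemma eventually_le_real_limsup:
  assumes "\<And>k. \<bar>x k\<bar> \<le> (C::real)" "0 < \<epsilon>"
  shows "eventually (\<lambda>k. x k \<le> real_limsup x + \<epsilon>) sequentially"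
proof -
  have "limsup (\<lambda>k. ereal (x k)) < ereal (real_limsup x + \<epsilon>)"
    using liminf_real_finite(2)[OF assms(1)] assms(2) by simp
  from Limsup_lessD[OF this] show ?thesis by eventually_elim simp
qed

lemma eventually_ge_real_liminf:
  assumes "\<And>k. \<bar>x k\<bar> \<le> (C::real)" "0 < \<epsilon>"
  shows "eventually (\<lambda>k. real_liminf x - \<epsilon> \<le> x k) sequentially"
proof -
  have "ereal (real_liminf x - \<epsilon>) < liminf (\<lambda>k. ereal (x k))"
    using liminf_real_finite(1)[OF assms(1)] assms(2) by simp
  from less_LiminfD[OF this] show ?thesis by eventually_elim simp
qed

lemma real_limsup_ge:
  assumes "\<And>k. \<bar>x k\<bar> \<le> (C::real)" "\<And>k. c \<le> x k"
  shows "c \<le> real_limsup x"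
proof -
  have "ereal c \<le> liminf (\<lambda>k. ereal (x k))" using assms(2) by (intro Liminf_bounded) auto
  also have "\<dots> \<le> limsup (\<lambda>k. ereal (x k))" by (intro Liminf_le_Limsup) simp
  finally show ?thesis using liminf_real_finite(2)[OF assms(1)] by simp
qed

lemma measurable_select:
  fixes \<xi> :: "'w \<Rightarrow> 'm::finite"
  assumes "\<And>n. g n \<in> borel_measurable F" "\<xi> \<in> measurable F (count_space UNIV)"
  shows "(\<lambda>\<omega>. g (\<xi> \<omega>) \<omega>) \<in> borel_measurable F"
  by (rule measurable_compose_countable'[OF _ assms(2), of g]) (auto simp: assms(1) intro: countable_finite)

text \<open>\<open>u k\<close> bounds the residual of block \<open>n\<close> just after an update, \<open>w k\<close> its growth while the block
  keeps the subgradient of its last update.\<close>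

primrec residual_bound :: "real \<Rightarrow> 'm \<Rightarrow> (nat \<Rightarrow> 'w \<Rightarrow> 'm) \<Rightarrow> (nat \<Rightarrow> 'w \<Rightarrow> real) \<Rightarrow> (nat \<Rightarrow> 'w \<Rightarrow> real)
    \<Rightarrow> nat \<Rightarrow> 'w \<Rightarrow> real" where
  "residual_bound r n \<xi> u w 0 \<omega> = r"
| "residual_bound r n \<xi> u w (Suc k) \<omega> =
     (if \<xi> k \<omega> = n then u k \<omega> else residual_bound r n \<xi> u w k \<omega> + w k \<omega>)"

text \<open>\<open>F k\<close> is the past before step \<open>k\<close>, and \<open>\<xi> k\<close>
  is known after that step. With \<open>E\<close> ranging over the past,
  \<open>\<xi>_uniform\<close> says that the selection is independent of the past and that each
  block has probability 1/3.\<close>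

locale uniform_selection = prob_space M for M :: "'w measure" +
  fixes F :: "nat \<Rightarrow> 'w measure" and \<xi> :: "nat \<Rightarrow> 'w \<Rightarrow> 'm::finite"
  assumes subalg: "subalgebra M (F k)"
    and sets_F_Suc: "sets (F k) \<subseteq> sets (F (Suc k))"
    and \<xi>_measurable: "\<xi> k \<in> measurable (F (Suc k)) (count_space UNIV)"
    and \<xi>_uniform: "E \<in> sets (F k) \<Longrightarrow> prob (E \<inter> {\<omega> \<in> space M. \<xi> k \<omega> = n}) = prob E / 3"
begin

lemma space_F: "space (F k) = space M"
  using subalg unfolding subalgebra_def by blast

lemma measurable_F_mono:
  assumes "g \<in> measurable (F j) N" "j \<le> k"
  shows "g \<in> measurable (F k) N"
proof -
  have "sets (F j) \<subseteq> sets (F k)" using assms(2) sets_F_Suc by (rule lift_Suc_mono_le[rotated])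
  then have "subalgebra (F k) (F j)" unfolding subalgebra_def by (simp add: space_F)
  then show ?thesis using assms(1) by (rule measurable_from_subalg)
qed

lemma measurable_F_M: "g \<in> measurable (F k) N \<Longrightarrow> g \<in> measurable M N"
  using measurable_from_subalg[OF subalg] .

lemma finite_measure_subalgebra_F: "finite_measure_subalgebra M (F k)"
  by unfold_locales (rule subalg)

text \<open>Given the past, the event that block \<open>n\<close> is not selected has the constant
  conditional probability 2/3, and \<open>g\<close> can be pulled out because it is known from the
  past. Nonnegative integrals are used since finiteness for the squared residual bounds emerges only
  from the recursion that this lemma feeds.\<close>

lemma nn_integral_unselected:
  assumes g: "g \<in> borel_measurable (F k)"
  shows "(\<integral>\<^sup>+ \<omega>. g \<omega> * indicator {\<omega>. \<xi> k \<omega> \<noteq> n} \<omega> \<partial>M) = ennreal (2 / 3) * (\<integral>\<^sup>+ \<omega>. g \<omega> \<partial>M)"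
proof -
  interpret finite_measure_subalgebra M "F k" by (rule finite_measure_subalgebra_F)
  have [measurable]: "\<xi> k \<in> measurable M (count_space UNIV)" by (rule measurable_F_M[OF \<xi>_measurable])
  have [measurable]: "g \<in> borel_measurable M" by (rule measurable_F_M[OF g])
  have "AE \<omega> in M. ennreal (2 / 3) = nn_cond_exp M (F k) (indicator {\<omega>. \<xi> k \<omega> \<noteq> n}) \<omega>"
  proof (rule nn_cond_exp_charact)
    fix E assume E: "E \<in> sets (F k)"
    then have EM: "E \<in> sets M" using subalg unfolding subalgebra_def by blast
    have set: "{\<omega> \<in> space M. \<xi> k \<omega> = n} \<in> sets M" by measurable
    have "(\<integral>\<^sup>+ \<omega> \<in> E. indicator {\<omega>. \<xi> k \<omega> \<noteq> n} \<omega> \<partial>M) = (\<integral>\<^sup>+ \<omega>. indicator (E - {\<omega> \<in> space M. \<xi> k \<omega> = n}) \<omega> \<partial>M)"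
      by (intro nn_integral_cong) (auto split: split_indicator)
    also have "\<dots> = emeasure M (E - {\<omega> \<in> space M. \<xi> k \<omega> = n})" using EM set by (intro nn_integral_indicator) auto
    also have "\<dots> = ennreal (prob E - prob (E \<inter> {\<omega> \<in> space M. \<xi> k \<omega> = n}))"
      unfolding emeasure_eq_measure by (subst finite_measure_Diff') (use EM set in auto)
    also have "\<dots> = ennreal (2 / 3 * prob E)" unfolding \<xi>_uniform[OF E] by simp
    also have "\<dots> = (\<integral>\<^sup>+ \<omega> \<in> E. ennreal (2 / 3) \<partial>M)"
      using EM by (simp add: nn_integral_cmult_indicator emeasure_eq_measure flip: ennreal_mult)
    finally show "(\<integral>\<^sup>+ \<omega> \<in> E. indicator {\<omega>. \<xi> k \<omega> \<noteq> n} \<omega> \<partial>M) = (\<integral>\<^sup>+ \<omega> \<in> E. ennreal (2 / 3) \<partial>M)" .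
  qed auto
  then have "AE \<omega> in M. g \<omega> * nn_cond_exp M (F k) (indicator {\<omega>. \<xi> k \<omega> \<noteq> n}) \<omega> = ennreal (2 / 3) * g \<omega>"
    by eventually_elim (metis mult.commute)
  then have "(\<integral>\<^sup>+ \<omega>. g \<omega> * nn_cond_exp M (F k) (indicator {\<omega>. \<xi> k \<omega> \<noteq> n}) \<omega> \<partial>M) = (\<integral>\<^sup>+ \<omega>. ennreal (2 / 3) * g \<omega> \<partial>M)"
    by (rule nn_integral_cong_AE)
  moreover have "(\<integral>\<^sup>+ \<omega>. g \<omega> * nn_cond_exp M (F k) (indicator {\<omega>. \<xi> k \<omega> \<noteq> n}) \<omega> \<partial>M)
      = (\<integral>\<^sup>+ \<omega>. g \<omega> * indicator {\<omega>. \<xi> k \<omega> \<noteq> n} \<omega> \<partial>M)"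
    by (rule nn_cond_exp_intg[OF g]) measurable
  ultimately show ?thesis by (simp add: nn_integral_cmult)
qed

lemma residual_bound_measurable:
  assumes u: "\<And>k. u k \<in> borel_measurable (F (Suc k))" and w: "\<And>k. w k \<in> borel_measurable (F (Suc k))"
  shows "residual_bound r n \<xi> u w k \<in> borel_measurable (F k)"
proof (induction k)
  case 0
  then show ?case by (simp add: measurable_const residual_bound.simps(1)[abs_def])
next
  case (Suc k)
  note [measurable] = u[of k] w[of k] \<xi>_measurable[of k] measurable_F_mono[OF Suc, of "Suc k", simplified]
  show ?case unfolding residual_bound.simps(2)[abs_def] by measurable
qed

lemma residual_bound_nonneg:
  assumes "0 \<le> r" "\<And>k. 0 \<le> u k \<omega>" "\<And>k. 0 \<le> w k \<omega>"
  shows "0 \<le> residual_bound r n \<xi> u w k \<omega>"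
  by (induction k) (use assms in auto)

lemma residual_bound_square_summable:
  assumes r: "0 \<le> r"
    and u: "\<And>k. u k \<in> borel_measurable (F (Suc k))" "\<And>k \<omega>. 0 \<le> u k \<omega>" "\<And>k. integrable M (\<lambda>\<omega>. (u k \<omega>)\<^sup>2)"
    and w: "\<And>k. w k \<in> borel_measurable (F (Suc k))" "\<And>k \<omega>. 0 \<le> w k \<omega>" "\<And>k. integrable M (\<lambda>\<omega>. (w k \<omega>)\<^sup>2)"
    and sums: "summable (\<lambda>k. \<integral>\<omega>. (u k \<omega>)\<^sup>2 \<partial>M)" "summable (\<lambda>k. \<integral>\<omega>. (w k \<omega>)\<^sup>2 \<partial>M)"
  shows "(\<Sum>k. \<integral>\<^sup>+ \<omega>. ennreal ((residual_bound r n \<xi> u w k \<omega>)\<^sup>2) \<partial>M) < \<infinity>"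
proof -
  define R where "R = residual_bound r n \<xi> u w"
  define Q where "Q k = (\<integral>\<^sup>+ \<omega>. ennreal ((R k \<omega>)\<^sup>2) \<partial>M)" for k
  define c where "c k = (\<integral>\<omega>. (u k \<omega>)\<^sup>2 \<partial>M) + 4 * (\<integral>\<omega>. (w k \<omega>)\<^sup>2 \<partial>M)" for k
  have Rm: "R k \<in> borel_measurable (F k)" for k unfolding R_def by (rule residual_bound_measurable[OF u(1) w(1)])
  have R0: "0 \<le> R k \<omega>" for k \<omega> unfolding R_def by (rule residual_bound_nonneg[where \<omega> = \<omega>, OF r u(2) w(2)])
  have step: "Q (Suc k) \<le> ennreal (8 / 9) * Q k + ennreal (c k)" for k
  proof -
    have R2m: "(\<lambda>\<omega>. ennreal ((R k \<omega>)\<^sup>2)) \<in> borel_measurable (F k)"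
      using Rm[of k] by measurable
    note [measurable] = measurable_F_M[OF u(1)[of k]] measurable_F_M[OF w(1)[of k]]
      measurable_F_M[OF Rm[of k]] measurable_F_M[OF \<xi>_measurable[of k]]
    have pw: "ennreal ((R (Suc k) \<omega>)\<^sup>2) \<le> ennreal (4 / 3) * (ennreal ((R k \<omega>)\<^sup>2) * indicator {\<omega>. \<xi> k \<omega> \<noteq> n} \<omega>)
        + (ennreal ((u k \<omega>)\<^sup>2) + 4 * ennreal ((w k \<omega>)\<^sup>2))" for \<omega>
    proof (cases "\<xi> k \<omega> = n")
      case True
      then show ?thesis unfolding R_def by simp
    next
      case False
      \<comment> \<open>Young's inequality with a weight close to 1 on \<open>R k\<close>: the
        factor 4/3 times the probability 2/3 gives 8/9, which is still a contraction. The symmetric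
        split with factor 2 would give 4/3.\<close>
      have "0 \<le> (R k \<omega> - 3 * w k \<omega>)\<^sup>2" by simp
      then have "(R k \<omega> + w k \<omega>)\<^sup>2 \<le> 4 / 3 * (R k \<omega>)\<^sup>2 + 4 * (w k \<omega>)\<^sup>2"
        by (simp add: power2_eq_square algebra_simps)
      then have "(R k \<omega> + w k \<omega>)\<^sup>2 \<le> 4 / 3 * (R k \<omega>)\<^sup>2 + ((u k \<omega>)\<^sup>2 + 4 * (w k \<omega>)\<^sup>2)"
        using zero_le_power2[of "u k \<omega>"] by linarith
      then have "ennreal ((R (Suc k) \<omega>)\<^sup>2) \<le> ennreal (4 / 3 * (R k \<omega>)\<^sup>2 + ((u k \<omega>)\<^sup>2 + 4 * (w k \<omega>)\<^sup>2))"
        using False unfolding R_def by (intro ennreal_leI) simp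
      moreover have "ennreal (4 / 3) * ennreal ((R k \<omega>)\<^sup>2) = ennreal (4 / 3 * (R k \<omega>)\<^sup>2)"
        by (simp flip: ennreal_mult)
      ultimately show ?thesis using False by (simp add: ennreal_mult')
    qed
    have "Q (Suc k) \<le> (\<integral>\<^sup>+ \<omega>. ennreal (4 / 3) * (ennreal ((R k \<omega>)\<^sup>2) * indicator {\<omega>. \<xi> k \<omega> \<noteq> n} \<omega>)
        + (ennreal ((u k \<omega>)\<^sup>2) + 4 * ennreal ((w k \<omega>)\<^sup>2)) \<partial>M)"
      unfolding Q_def by (intro nn_integral_mono pw)
    also have "\<dots> = ennreal (4 / 3) * (\<integral>\<^sup>+ \<omega>. ennreal ((R k \<omega>)\<^sup>2) * indicator {\<omega>. \<xi> k \<omega> \<noteq> n} \<omega> \<partial>M)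
        + ((\<integral>\<^sup>+ \<omega>. ennreal ((u k \<omega>)\<^sup>2) \<partial>M) + 4 * (\<integral>\<^sup>+ \<omega>. ennreal ((w k \<omega>)\<^sup>2) \<partial>M))"
      by (simp add: nn_integral_add nn_integral_cmult)
    also have "(\<integral>\<^sup>+ \<omega>. ennreal ((R k \<omega>)\<^sup>2) * indicator {\<omega>. \<xi> k \<omega> \<noteq> n} \<omega> \<partial>M) = ennreal (2 / 3) * Q k"
      unfolding Q_def by (rule nn_integral_unselected[OF R2m])
    also have "(\<integral>\<^sup>+ \<omega>. ennreal ((u k \<omega>)\<^sup>2) \<partial>M) = ennreal (\<integral>\<omega>. (u k \<omega>)\<^sup>2 \<partial>M)"
      by (rule nn_integral_eq_integral[OF u(3)]) simp
    also have "(\<integral>\<^sup>+ \<omega>. ennreal ((w k \<omega>)\<^sup>2) \<partial>M) = ennreal (\<integral>\<omega>. (w k \<omega>)\<^sup>2 \<partial>M)"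
      by (rule nn_integral_eq_integral[OF w(3)]) simp
    also have "ennreal (4 / 3) * (ennreal (2 / 3) * Q k) = ennreal (8 / 9) * Q k"
      by (simp add: mult.assoc[symmetric] ennreal_mult[symmetric])
    also have "ennreal (\<integral>\<omega>. (u k \<omega>)\<^sup>2 \<partial>M) + 4 * ennreal (\<integral>\<omega>. (w k \<omega>)\<^sup>2 \<partial>M) = ennreal (c k)"
      unfolding c_def by (simp add: ennreal_plus ennreal_mult')
    finally show ?thesis .
  qed
  have c0: "0 \<le> c k" for k unfolding c_def by simp
  have fin: "Q k < \<infinity>" for k
  proof (induction k)
    case 0
    have "Q 0 = ennreal (r\<^sup>2)" unfolding Q_def R_def by (simp add: emeasure_space_1)
    then show ?case by simp
  next
    case (Suc k)
    then have "ennreal (8 / 9) * Q k + ennreal (c k) < \<infinity>" by (simp add: ennreal_mult_less_top)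
    then show ?case using step[of k] by (rule order.strict_trans1[rotated])
  qed
  \<comment> \<open>All values are finite by now, so the recursion is moved to the reals, where
    \<open>summable_contraction\<close> applies.\<close>
  define q where "q k = enn2real (Q k)" for k
  have Qq: "Q k = ennreal (q k)" for k unfolding q_def using fin[of k] by simp
  have q0: "0 \<le> q k" for k unfolding q_def by simp
  have q_step: "q (Suc k) \<le> 8 / 9 * q k + c k" for k
  proof -
    have "ennreal (8 / 9) * ennreal (q k) = ennreal (8 / 9 * q k)"
      using q0[of k] by (simp flip: ennreal_mult)
    then have "ennreal (q (Suc k)) \<le> ennreal (8 / 9 * q k + c k)"
      using step[of k] c0[of k] q0[of k] unfolding Qq by simp
    then show ?thesis using c0[of k] q0[of k] by (subst (asm) ennreal_le_iff) auto
  qed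
  have "summable c" unfolding c_def by (intro summable_add summable_mult sums)
  then have "summable q" by (rule summable_contraction[where x = q and c = c, OF q0 c0 _ _ q_step, rotated 2]) simp_all
  then have "(\<Sum>k. Q k) < \<infinity>" unfolding Qq suminf_ennreal2[OF q0 \<open>summable q\<close>] by simp
  then show ?thesis unfolding Q_def R_def .
qed

end

section \<open>Inertial block prox processes\<close>

locale inertial_process = uniform_selection M F \<xi> + block_composite P f gf H lo
  for M :: "'w measure" and F :: "nat \<Rightarrow> 'w measure" and \<xi> :: "nat \<Rightarrow> 'w \<Rightarrow> 'm::finite"
    and P :: "'m \<Rightarrow> 'a::euclidean_space \<Rightarrow> 'a" and f gf H lo +
  fixes \<eta> \<alpha> \<beta> :: "nat \<Rightarrow> real" and t :: nat and A0 :: 'a and G A :: "nat \<Rightarrow> 'w \<Rightarrow> 'a"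
    and e :: "nat \<Rightarrow> 'w \<Rightarrow> real" and \<Gamma> \<Upsilon> :: "nat \<Rightarrow> 'w \<Rightarrow> real"
    and L \<gamma> V1 V2 V\<Gamma> \<tau> \<eta>lo C :: real
  assumes f_nonneg: "0 \<le> f x"
    and A_measurable: "A k \<in> borel_measurable (F k)"
    and G_measurable: "G k \<in> borel_measurable (F (Suc k))"
    and A_init: "\<omega> \<in> space M \<Longrightarrow> A 0 \<omega> = A0"
    and A_step: "\<omega> \<in> space M \<Longrightarrow> prox_step (\<xi> k \<omega>) (\<eta> k) (G k \<omega>) (A k \<omega>)
      (extrapolate \<alpha> t (\<lambda>l. A l \<omega>) k) (A (Suc k) \<omega>)"
    and A0_subdiff: "limiting_subdiff Phi A0 \<noteq> {}"
    and \<eta>lo: "0 < \<eta>lo" "\<eta>lo \<le> \<eta> k"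
    and inertia: "0 \<le> \<alpha> k" "\<alpha> k \<le> 1" "0 \<le> \<beta> k" "\<beta> k \<le> 1"
    and bounded: "AE \<omega> in M. norm (A k \<omega>) \<le> C"
    and block_lipschitz: "AE \<omega> in M. \<forall>k n Y Z. norm (P n (gf (A k \<omega> + P n (Y - A k \<omega>)))
      - P n (gf (A k \<omega> + P n (Z - A k \<omega>)))) \<le> L * norm (P n (Y - Z))"
    and L_nonneg: "0 \<le> L"
    and e_eq: "e k \<omega> = norm (P (\<xi> k \<omega>) (G k \<omega>) - P (\<xi> k \<omega>) (gf (A k \<omega>
      + P (\<xi> k \<omega>) (extrapolate \<beta> t (\<lambda>l. A l \<omega>) k - A k \<omega>))))"
    and estimator: "variance_reduced M F t A e V1 V2 V\<Gamma> \<tau> \<Gamma> \<Upsilon>"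
    and \<gamma>_eq: "\<gamma> = sqrt (V\<Gamma> / \<tau> + V1)" and \<gamma>_pos: "0 < \<gamma>"
begin

text \<open>\<open>move 0\<close> is 0 by truncated subtraction, in agreement with the convention
  that iterates of negative index equal the initial point.\<close>

definition move :: "nat \<Rightarrow> 'w \<Rightarrow> real" where
  "move k \<omega> = norm (A k \<omega> - A (k - 1) \<omega>)"

definition mean_sq_move :: "nat \<Rightarrow> real" where
  "mean_sq_move k = (\<integral>\<omega>. (move k \<omega>)\<^sup>2 \<partial>M)"

lemma move_eq: "norm (A (k + 1 - i) \<omega> - A (k - i) \<omega>) = move (k + 1 - i) \<omega>"
  unfolding move_def by (simp add: diff_right_commute)

lemma move_0: "move 0 \<omega> = 0"
  unfolding move_def by simp

lemma move_nonneg: "0 \<le> move k \<omega>"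
  unfolding move_def by simp

lemma A_measurable_le: "j \<le> k \<Longrightarrow> A j \<in> borel_measurable (F k)"
  by (rule measurable_F_mono[OF A_measurable])

lemma move_measurable: "move k \<in> borel_measurable (F k)"
proof -
  note [measurable] = A_measurable[of k] A_measurable_le[OF diff_le_self[of k 1]]
  show ?thesis unfolding move_def[abs_def] by measurable
qed

lemma eta_pos: "0 < \<eta> k"
  using \<eta>lo(1) \<eta>lo(2)[of k] by linarith

lemma variance_constants: "0 \<le> V1" "0 \<le> V2" "0 \<le> V\<Gamma>" "0 < \<tau>" "\<tau> \<le> 1"
  using estimator unfolding variance_reduced_def by auto

lemma e_nonneg: "0 \<le> e k \<omega>"
  unfolding e_eq by simp

lemma e_square_integrable: "integrable M (\<lambda>\<omega>. (e k \<omega>)\<^sup>2)"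
  using estimator unfolding variance_reduced_def by auto

lemma \<Gamma>_integrable: "1 \<le> k \<Longrightarrow> integrable M (\<Gamma> k)"
  using estimator unfolding variance_reduced_def by auto

lemma \<Gamma>_nonneg: "1 \<le> k \<Longrightarrow> AE \<omega> in M. 0 \<le> \<Gamma> k \<omega>"
  using estimator unfolding variance_reduced_def by fastforce

lemma integral_\<Gamma>_nonneg: "1 \<le> k \<Longrightarrow> 0 \<le> (\<integral>\<omega>. \<Gamma> k \<omega> \<partial>M)"
  by (rule integral_nonneg_AE) (rule \<Gamma>_nonneg)

lemma extrapolate_measurable:
  assumes "k \<le> m"
  shows "(\<lambda>\<omega>. extrapolate w t (\<lambda>l. A l \<omega>) k) \<in> borel_measurable (F m)"
  unfolding extrapolate_def using assms
  by (intro borel_measurable_add borel_measurable_sum borel_measurable_scaleR borel_measurable_diff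
      borel_measurable_const A_measurable_le) auto

lemma e_measurable: "e k \<in> borel_measurable (F (Suc k))"
proof -
  have P[measurable]: "P n \<in> borel_measurable borel" for n
    using linear_P by (intro borel_measurable_continuous_onI linear_continuous_on) (simp add: linear_conv_bounded_linear)
  have [measurable]: "gf \<in> borel_measurable borel"
    by (intro borel_measurable_continuous_onI gf_continuous)
  note [measurable] = G_measurable[of k] A_measurable_le[of k "Suc k", simplified]
    extrapolate_measurable[of k "Suc k", simplified]
  have "(\<lambda>\<omega>. norm (P n (G k \<omega>) - P n (gf (A k \<omega> + P n (extrapolate \<beta> t (\<lambda>l. A l \<omega>) k - A k \<omega>)))))
      \<in> borel_measurable (F (Suc k))" for n
    by measurable
  \<comment> \<open>The error refers to a random block; it is measurable because it is so for each
    fixed block and there are finitely many of them.\<close>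
  from measurable_select[OF this \<xi>_measurable] show ?thesis unfolding e_eq[abs_def] .
qed

text \<open>A nonempty limiting subdifferential forces a finite value at the initial point, and prox
  steps preserve finiteness. Hence \<open>phi\<close> is the true objective value along every
  path.\<close>

lemma H_finite:
  assumes "\<omega> \<in> space M"
  shows "H m (A k \<omega>) \<noteq> \<infinity>"
proof (induction k arbitrary: m)
  case 0
  have "\<bar>Phi A0\<bar> \<noteq> \<infinity>" using A0_subdiff unfolding limiting_subdiff_def by auto
  then show ?case using Phi_finite[of A0] A_init[OF assms] by simp
next
  case (Suc k)
  show ?case by (rule prox_step_finite[OF A_step[OF assms] eta_pos Suc])
qed

lemma phi_lower:
  assumes "\<And>n. H n y \<noteq> \<infinity>"
  shows "real CARD('m) * lo \<le> phi y"
proof -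
  have "lo \<le> real_of_ereal (H n y)" for n
    using H_lower[of n y] assms[of n] by (cases "H n y") auto
  then have "(\<Sum>n\<in>(UNIV::'m set). lo) \<le> (\<Sum>n\<in>UNIV. real_of_ereal (H n y))" by (intro sum_mono)
  then show ?thesis using phi_eq[OF assms] f_nonneg[of y] by simp
qed

lemma Phi_A:
  assumes "\<omega> \<in> space M"
  shows "Phi (A k \<omega>) = ereal (phi (A k \<omega>))"
  using Phi_finite[of "A k \<omega>"] H_finite[OF assms] unfolding phi_def by (simp add: ereal_real)

lemma move_bounded: "AE \<omega> in M. move k \<omega> \<le> 2 * C"
proof -
  show ?thesis using bounded[of k] bounded[of "k - 1"]
  proof eventually_elim
    case (elim \<omega>)
    then show ?case using norm_triangle_ineq4[of "A k \<omega>" "A (k - 1) \<omega>"] unfolding move_def by simp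
  qed
qed

lemma move_square_integrable: "integrable M (\<lambda>\<omega>. (move k \<omega>)\<^sup>2)"
proof (rule integrable_const_bound)
  show "AE \<omega> in M. norm ((move k \<omega>)\<^sup>2) \<le> (2 * C)\<^sup>2"
    using move_bounded[of k]
  proof eventually_elim
    case (elim \<omega>)
    then show ?case using power_mono[OF elim move_nonneg, of 2] by simp
  qed
  show "(\<lambda>\<omega>. (move k \<omega>)\<^sup>2) \<in> borel_measurable M"
    using measurable_F_M[OF move_measurable] by measurable
qed

lemma mean_sq_move_nonneg: "0 \<le> mean_sq_move k"
  unfolding mean_sq_move_def by simp

lemma mean_sq_move_0: "mean_sq_move 0 = 0"
  unfolding mean_sq_move_def move_0 by simp

section \<open>Descent in expectation\<close>

lemma descent_AE:
  "AE \<omega> in M. phi (A (Suc k) \<omega>) \<le> phi (A k \<omega>) - midas_b t L \<gamma> \<eta> \<alpha> k * (move (Suc k) \<omega>)\<^sup>2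
     + (\<Sum>i=1..t. (L * real t * (\<beta> (k + 1 - i))\<^sup>2 / 2 + \<alpha> (k + 1 - i) / (2 * \<eta> k)) * (move (k + 1 - i) \<omega>)\<^sup>2)
     + (e k \<omega>)\<^sup>2 / (2 * \<gamma>)"
  using block_lipschitz AE_space
proof eventually_elim
  case (elim \<omega>)
  have "phi (A (Suc k) \<omega>) \<le> phi (A k \<omega>) - midas_b t L \<gamma> \<eta> \<alpha> k * (norm (A (Suc k) \<omega> - A k \<omega>))\<^sup>2
     + (\<Sum>i=1..t. (L * real t * (\<beta> (k + 1 - i))\<^sup>2 / 2 + \<alpha> (k + 1 - i) / (2 * \<eta> k))
          * (norm (A (k + 1 - i) \<omega> - A (k - i) \<omega>))\<^sup>2) + (e k \<omega>)\<^sup>2 / (2 * \<gamma>)"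
    using elim by (intro inertial_step_descent[OF A_step eta_pos H_finite _ L_nonneg _ \<gamma>_pos inertia(1)])
      (auto simp: e_eq)
  then show ?case unfolding move_eq by (simp add: move_def)
qed

lemma phi_measurable_A [measurable]: "(\<lambda>\<omega>. phi (A k \<omega>)) \<in> borel_measurable M"
  using measurable_F_M[OF A_measurable[of k]] by measurable

text \<open>The regularizers are only lower semicontinuous, so bounded iterates do not bound the
  objective from above. The upper bound is the descent inequality, whose right side is integrable by
  induction; the lower bound is a constant.\<close>

lemma phi_integrable: "integrable M (\<lambda>\<omega>. phi (A k \<omega>))"
proof (induction k)
  case 0
  have "integrable M (\<lambda>\<omega>. phi A0)" by simp
  also have "integrable M (\<lambda>\<omega>. phi A0) \<longleftrightarrow> integrable M (\<lambda>\<omega>. phi (A 0 \<omega>))"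
    by (rule Bochner_Integration.integrable_cong) (simp_all add: A_init)
  finally show ?case .
next
  case (Suc k)
  define U where "U \<omega> = phi (A k \<omega>) - midas_b t L \<gamma> \<eta> \<alpha> k * (move (Suc k) \<omega>)\<^sup>2
     + (\<Sum>i=1..t. (L * real t * (\<beta> (k + 1 - i))\<^sup>2 / 2 + \<alpha> (k + 1 - i) / (2 * \<eta> k)) * (move (k + 1 - i) \<omega>)\<^sup>2)
     + (e k \<omega>)\<^sup>2 / (2 * \<gamma>)" for \<omega>
  have U: "integrable M U"
    unfolding U_def by (intro Bochner_Integration.integrable_add Bochner_Integration.integrable_diff
        Bochner_Integration.integrable_sum integrable_mult_right integrable_divide Suc move_square_integrable e_square_integrable)
  have "integrable M (\<lambda>\<omega>. \<bar>real CARD('m) * lo\<bar> + \<bar>U \<omega>\<bar>)" using U by simp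
  moreover have "AE \<omega> in M. norm (phi (A (Suc k) \<omega>)) \<le> norm (\<bar>real CARD('m) * lo\<bar> + \<bar>U \<omega>\<bar>)"
    using descent_AE[of k] AE_space
  proof eventually_elim
    case (elim \<omega>)
    then show ?case using phi_lower[OF H_finite[OF elim(2)], of "Suc k"] unfolding U_def[symmetric] by auto
  qed
  ultimately show ?case by (rule Bochner_Integration.integrable_bound[OF _ phi_measurable_A])
qed

lemma e_expectation:
  assumes "1 \<le> k"
  shows "(\<integral>\<omega>. (e k \<omega>)\<^sup>2 \<partial>M) \<le> (\<integral>\<omega>. \<Gamma> k \<omega> \<partial>M) + V1 * (\<Sum>i=1..t+1. mean_sq_move (k + 1 - i))"
proof -
  interpret finite_measure_subalgebra M "F k" by (rule finite_measure_subalgebra_F)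
  have "AE \<omega> in M. real_cond_exp M (F k) (\<lambda>\<omega>. (e k \<omega>)\<^sup>2) \<omega> \<le> \<Gamma> k \<omega> + V1 * (\<Sum>i=1..t+1. (move (k + 1 - i) \<omega>)\<^sup>2)"
    using estimator assms unfolding variance_reduced_def move_eq by blast
  then have "(\<integral>\<omega>. real_cond_exp M (F k) (\<lambda>\<omega>. (e k \<omega>)\<^sup>2) \<omega> \<partial>M) \<le> (\<integral>\<omega>. \<Gamma> k \<omega> + V1 * (\<Sum>i=1..t+1. (move (k + 1 - i) \<omega>)\<^sup>2) \<partial>M)"
    by (intro integral_mono_AE real_cond_exp_int(1) e_square_integrable Bochner_Integration.integrable_add
        integrable_mult_right Bochner_Integration.integrable_sum move_square_integrable \<Gamma>_integrable assms)
  also have "\<dots> = (\<integral>\<omega>. \<Gamma> k \<omega> \<partial>M) + V1 * (\<Sum>i=1..t+1. mean_sq_move (k + 1 - i))"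
    unfolding mean_sq_move_def using \<Gamma>_integrable[OF assms] move_square_integrable by simp
  finally show ?thesis unfolding real_cond_exp_int(2)[OF e_square_integrable] .
qed

lemma \<Gamma>_expectation:
  assumes "1 \<le> k"
  shows "(\<integral>\<omega>. \<Gamma> (Suc k) \<omega> \<partial>M) \<le> (1 - \<tau>) * (\<integral>\<omega>. \<Gamma> k \<omega> \<partial>M) + V\<Gamma> * (\<Sum>i=1..t+1. mean_sq_move (k + 1 - i))"
proof -
  interpret finite_measure_subalgebra M "F k" by (rule finite_measure_subalgebra_F)
  have int: "integrable M (\<Gamma> (k + 1))" by (rule \<Gamma>_integrable) simp
  have "AE \<omega> in M. real_cond_exp M (F k) (\<Gamma> (k + 1)) \<omega> \<le> (1 - \<tau>) * \<Gamma> k \<omega> + V\<Gamma> * (\<Sum>i=1..t+1. (move (k + 1 - i) \<omega>)\<^sup>2)"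
    using estimator assms unfolding variance_reduced_def move_eq by blast
  then have "(\<integral>\<omega>. real_cond_exp M (F k) (\<Gamma> (k + 1)) \<omega> \<partial>M)
      \<le> (\<integral>\<omega>. (1 - \<tau>) * \<Gamma> k \<omega> + V\<Gamma> * (\<Sum>i=1..t+1. (move (k + 1 - i) \<omega>)\<^sup>2) \<partial>M)"
    by (intro integral_mono_AE real_cond_exp_int(1) int Bochner_Integration.integrable_add
        integrable_mult_right Bochner_Integration.integrable_sum move_square_integrable \<Gamma>_integrable assms)
  also have "\<dots> = (1 - \<tau>) * (\<integral>\<omega>. \<Gamma> k \<omega> \<partial>M) + V\<Gamma> * (\<Sum>i=1..t+1. mean_sq_move (k + 1 - i))"
    unfolding mean_sq_move_def using \<Gamma>_integrable[OF assms] move_square_integrable by simp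
  finally show ?thesis using real_cond_exp_int(2)[OF int] by simp
qed

lemma \<gamma>_square: "\<gamma>\<^sup>2 = V\<Gamma> / \<tau> + V1"
  unfolding \<gamma>_eq using variance_constants by simp

text \<open>Explains the weight \<open>1 / (2 * \<tau> * \<gamma>)\<close> and the value of
  \<open>\<gamma>\<close>. The squared error costs the mean of \<open>\<Gamma> k\<close> over
  \<open>2 * \<gamma>\<close>, exactly what the contraction of \<open>\<Gamma>\<close> by
  \<open>1 - \<tau>\<close> gives back with that weight. The moves left over have the coefficient
  \<open>(V\<Gamma> / \<tau> + V1) / (2 * \<gamma>)\<close>, which equals
  \<open>\<gamma> / 2\<close> and so becomes the middle term of \<open>midas_a\<close>.\<close>

lemma expected_descent:
  assumes "1 \<le> k"
  shows "(\<integral>\<omega>. phi (A (Suc k) \<omega>) \<partial>M) + (\<integral>\<omega>. \<Gamma> (Suc k) \<omega> \<partial>M) / (2 * \<tau> * \<gamma>)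
    \<le> (\<integral>\<omega>. phi (A k \<omega>) \<partial>M) + (\<integral>\<omega>. \<Gamma> k \<omega> \<partial>M) / (2 * \<tau> * \<gamma>) - midas_b t L \<gamma> \<eta> \<alpha> k * mean_sq_move (Suc k)
      + (\<Sum>i=1..t+1. midas_a t L \<gamma> \<eta> \<alpha> \<beta> k i * mean_sq_move (k + 1 - i))"
proof -
  define c where "c i = L * real t * (\<beta> (k + 1 - i))\<^sup>2 / 2 + \<alpha> (k + 1 - i) / (2 * \<eta> k)" for i
  define S where "S = (\<Sum>i=1..t+1. mean_sq_move (k + 1 - i))"
  define g where "g = (\<integral>\<omega>. \<Gamma> k \<omega> \<partial>M)"
  have S0: "0 \<le> S" unfolding S_def by (intro sum_nonneg mean_sq_move_nonneg)
  have int: "integrable M (\<lambda>\<omega>. phi (A k \<omega>) - midas_b t L \<gamma> \<eta> \<alpha> k * (move (Suc k) \<omega>)\<^sup>2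
     + (\<Sum>i=1..t. c i * (move (k + 1 - i) \<omega>)\<^sup>2) + (e k \<omega>)\<^sup>2 / (2 * \<gamma>))"
    by (intro Bochner_Integration.integrable_add Bochner_Integration.integrable_diff
        Bochner_Integration.integrable_sum integrable_mult_right integrable_divide phi_integrable move_square_integrable e_square_integrable)
  have "(\<integral>\<omega>. phi (A (Suc k) \<omega>) \<partial>M) \<le> (\<integral>\<omega>. phi (A k \<omega>) - midas_b t L \<gamma> \<eta> \<alpha> k * (move (Suc k) \<omega>)\<^sup>2
     + (\<Sum>i=1..t. c i * (move (k + 1 - i) \<omega>)\<^sup>2) + (e k \<omega>)\<^sup>2 / (2 * \<gamma>) \<partial>M)"
    using descent_AE[of k] unfolding c_def[symmetric] by (intro integral_mono_AE phi_integrable int)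
  also have "\<dots> = (\<integral>\<omega>. phi (A k \<omega>) \<partial>M) - midas_b t L \<gamma> \<eta> \<alpha> k * mean_sq_move (Suc k)
     + (\<Sum>i=1..t. c i * mean_sq_move (k + 1 - i)) + (\<integral>\<omega>. (e k \<omega>)\<^sup>2 \<partial>M) / (2 * \<gamma>)"
    unfolding mean_sq_move_def using phi_integrable move_square_integrable e_square_integrable by simp
  also have "(\<integral>\<omega>. (e k \<omega>)\<^sup>2 \<partial>M) / (2 * \<gamma>) \<le> (g + V1 * S) / (2 * \<gamma>)"
    using e_expectation[OF assms] \<gamma>_pos unfolding g_def S_def by (intro divide_right_mono) auto
  finally have 1: "(\<integral>\<omega>. phi (A (Suc k) \<omega>) \<partial>M) \<le> (\<integral>\<omega>. phi (A k \<omega>) \<partial>M) - midas_b t L \<gamma> \<eta> \<alpha> k * mean_sq_move (Suc k)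
     + (\<Sum>i=1..t. c i * mean_sq_move (k + 1 - i)) + (g + V1 * S) / (2 * \<gamma>)" by simp
  have "(\<integral>\<omega>. \<Gamma> (Suc k) \<omega> \<partial>M) / (2 * \<tau> * \<gamma>) \<le> ((1 - \<tau>) * g + V\<Gamma> * S) / (2 * \<tau> * \<gamma>)"
    using \<Gamma>_expectation[OF assms] \<gamma>_pos variance_constants unfolding g_def S_def by (intro divide_right_mono) auto
  also have "\<dots> = g / (2 * \<tau> * \<gamma>) - g / (2 * \<gamma>) + V\<Gamma> / \<tau> * S / (2 * \<gamma>)"
    using \<gamma>_pos variance_constants by (simp add: field_simps)
  finally have "(\<integral>\<omega>. \<Gamma> (Suc k) \<omega> \<partial>M) / (2 * \<tau> * \<gamma>) + (g + V1 * S) / (2 * \<gamma>)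
      \<le> g / (2 * \<tau> * \<gamma>) + (V\<Gamma> / \<tau> + V1) * S / (2 * \<gamma>)"
    by (simp add: add_divide_distrib distrib_right)
  also have "(V\<Gamma> / \<tau> + V1) * S / (2 * \<gamma>) = \<gamma> / 2 * S"
    unfolding \<gamma>_square[symmetric] using \<gamma>_pos by (simp add: power2_eq_square)
  finally have 2: "(\<integral>\<omega>. \<Gamma> (Suc k) \<omega> \<partial>M) / (2 * \<tau> * \<gamma>) + (g + V1 * S) / (2 * \<gamma>) \<le> g / (2 * \<tau> * \<gamma>) + \<gamma> / 2 * S" .
  \<comment> \<open>The part of \<open>midas_a\<close> with \<open>L\<close> is three times what the
    descent produces.\<close>
  have ci: "c i + \<gamma> / 2 \<le> midas_a t L \<gamma> \<eta> \<alpha> \<beta> k i" for i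
  proof -
    have "L * real t * (\<beta> (k + 1 - i))\<^sup>2 \<le> 3 * (L * real t * (\<beta> (k + 1 - i))\<^sup>2)"
      using L_nonneg by simp
    then show ?thesis unfolding c_def midas_a_def by simp
  qed
  \<comment> \<open>The oldest move, \<open>i = t + 1\<close>, enters through the estimator only and
    not through the extrapolation.\<close>
  have "\<gamma> / 2 \<le> c (t + 1) + \<gamma> / 2" unfolding c_def
    using L_nonneg inertia eta_pos[of k] by simp
  then have cl: "\<gamma> / 2 \<le> midas_a t L \<gamma> \<eta> \<alpha> \<beta> k (t + 1)" using ci[of "t + 1"] by linarith
  have "(\<Sum>i=1..t. c i * mean_sq_move (k + 1 - i)) + \<gamma> / 2 * S
      = (\<Sum>i=1..t. (c i + \<gamma> / 2) * mean_sq_move (k + 1 - i)) + \<gamma> / 2 * mean_sq_move (k + 1 - (t + 1))"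
    unfolding S_def by (simp add: sum_distrib_left distrib_left distrib_right sum.distrib)
  also have "\<dots> \<le> (\<Sum>i=1..t. midas_a t L \<gamma> \<eta> \<alpha> \<beta> k i * mean_sq_move (k + 1 - i)) + midas_a t L \<gamma> \<eta> \<alpha> \<beta> k (t + 1) * mean_sq_move (k + 1 - (t + 1))"
    by (intro add_mono sum_mono mult_right_mono ci cl mean_sq_move_nonneg)
  also have "\<dots> = (\<Sum>i=1..t+1. midas_a t L \<gamma> \<eta> \<alpha> \<beta> k i * mean_sq_move (k + 1 - i))" by simp
  finally have 3: "(\<Sum>i=1..t. c i * mean_sq_move (k + 1 - i)) + \<gamma> / 2 * S \<le> (\<Sum>i=1..t+1. midas_a t L \<gamma> \<eta> \<alpha> \<beta> k i * mean_sq_move (k + 1 - i))" .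
  show ?thesis using 1 2 3 unfolding g_def by linarith
qed

lemma mean_sq_move_summable:
  assumes a: "\<And>i. 0 \<le> a i" "(\<Sum>i=1..t+1. a i) < b"
    and ev: "\<And>k. k0 \<le> k \<Longrightarrow> b \<le> midas_b t L \<gamma> \<eta> \<alpha> k"
      "\<And>k i. k0 \<le> k \<Longrightarrow> i \<in> {1..t+1} \<Longrightarrow> midas_a t L \<gamma> \<eta> \<alpha> \<beta> k i \<le> a i"
  shows "summable mean_sq_move"
\<comment> \<open>\<open>\<Gamma>\<close> is specified from index 1 on, so \<open>W 0\<close> is a
  placeholder equal to the lower bound, and the recursion starts at \<open>max k0 1\<close>.\<close>
proof (rule summable_descent[where x = mean_sq_move and a = a and b = b and m = "t + 1" and ?k0.0 = "max k0 1" and lo = "real CARD('m) * lo"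
      and W = "\<lambda>k. if k = 0 then real CARD('m) * lo else (\<integral>\<omega>. phi (A k \<omega>) \<partial>M) + (\<integral>\<omega>. \<Gamma> k \<omega> \<partial>M) / (2 * \<tau> * \<gamma>)",
      OF mean_sq_move_0 mean_sq_move_nonneg _ a])
  fix k
  have "real CARD('m) * lo = (\<integral>\<omega>. real CARD('m) * lo \<partial>M)" by (simp add: prob_space)
  also have "\<dots> \<le> (\<integral>\<omega>. phi (A k \<omega>) \<partial>M)"
    by (intro integral_mono phi_integrable) (auto intro!: phi_lower[OF H_finite])
  finally have "real CARD('m) * lo \<le> (\<integral>\<omega>. phi (A k \<omega>) \<partial>M)" .
  moreover have "0 \<le> (\<integral>\<omega>. \<Gamma> k \<omega> \<partial>M) / (2 * \<tau> * \<gamma>)" if "k \<noteq> 0"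
    using integral_\<Gamma>_nonneg[of k] that variance_constants \<gamma>_pos by simp
  ultimately show "real CARD('m) * lo \<le> (if k = 0 then real CARD('m) * lo
      else (\<integral>\<omega>. phi (A k \<omega>) \<partial>M) + (\<integral>\<omega>. \<Gamma> k \<omega> \<partial>M) / (2 * \<tau> * \<gamma>))" by (cases "k = 0") auto
next
  fix k assume k: "max k0 1 \<le> k"
  have "b * mean_sq_move (Suc k) \<le> midas_b t L \<gamma> \<eta> \<alpha> k * mean_sq_move (Suc k)"
    using k by (intro mult_right_mono ev(1) mean_sq_move_nonneg) simp
  moreover have "(\<Sum>i=1..t+1. midas_a t L \<gamma> \<eta> \<alpha> \<beta> k i * mean_sq_move (k + 1 - i)) \<le> (\<Sum>i=1..t+1. a i * mean_sq_move (k + 1 - i))"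
    using k by (intro sum_mono mult_right_mono ev(2) mean_sq_move_nonneg) simp_all
  ultimately show "(if Suc k = 0 then real CARD('m) * lo
      else (\<integral>\<omega>. phi (A (Suc k) \<omega>) \<partial>M) + (\<integral>\<omega>. \<Gamma> (Suc k) \<omega> \<partial>M) / (2 * \<tau> * \<gamma>))
     \<le> (if k = 0 then real CARD('m) * lo
      else (\<integral>\<omega>. phi (A k \<omega>) \<partial>M) + (\<integral>\<omega>. \<Gamma> k \<omega> \<partial>M) / (2 * \<tau> * \<gamma>)) - b * mean_sq_move (Suc k) + (\<Sum>i=1..t+1. a i * mean_sq_move (k + 1 - i))"
    using expected_descent[of k] k by simp
qed

end

lemma power2_sum3_le: "(a + b + c)\<^sup>2 \<le> 3 * a\<^sup>2 + 3 * b\<^sup>2 + 3 * (c::real)\<^sup>2"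
proof -
  have "0 \<le> (a - b)\<^sup>2 + (b - c)\<^sup>2 + (a - c)\<^sup>2" by simp
  then show ?thesis by (simp add: power2_eq_square algebra_simps)
qed

section \<open>Summability of the gradient errors and of the residuals\<close>

context inertial_process
begin

lemma delayed_sum_summable:
  assumes "summable mean_sq_move"
  shows "summable (\<lambda>k. \<Sum>i=1..m. mean_sq_move (k + 1 - i))"
  by (intro summable_sum summable_delayed assms mean_sq_move_0 mean_sq_move_nonneg) simp

lemma \<Gamma>_summable:
  assumes "summable mean_sq_move"
  shows "summable (\<lambda>k. \<integral>\<omega>. \<Gamma> (Suc k) \<omega> \<partial>M)"
proof (rule summable_contraction[where x = "\<lambda>k. \<integral>\<omega>. \<Gamma> (Suc k) \<omega> \<partial>M" and \<theta> = "1 - \<tau>"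
      and c = "\<lambda>k. V\<Gamma> * (\<Sum>i=1..t+1. mean_sq_move (Suc k + 1 - i))"])
  show "summable (\<lambda>k. V\<Gamma> * (\<Sum>i=1..t+1. mean_sq_move (Suc k + 1 - i)))"
    using delayed_sum_summable[OF assms, of "t + 1"] by (intro summable_mult) (subst summable_Suc_iff)
  show "0 \<le> V\<Gamma> * (\<Sum>i=1..t+1. mean_sq_move (Suc k + 1 - i))" for k
    using variance_constants by (intro mult_nonneg_nonneg sum_nonneg mean_sq_move_nonneg)
  show "(\<integral>\<omega>. \<Gamma> (Suc (Suc k)) \<omega> \<partial>M) \<le> (1 - \<tau>) * (\<integral>\<omega>. \<Gamma> (Suc k) \<omega> \<partial>M) + V\<Gamma> * (\<Sum>i=1..t+1. mean_sq_move (Suc k + 1 - i))" for k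
    by (rule \<Gamma>_expectation) simp
  show "0 \<le> (\<integral>\<omega>. \<Gamma> (Suc k) \<omega> \<partial>M)" for k by (rule integral_\<Gamma>_nonneg) simp
qed (use variance_constants in auto)

lemma e_summable:
  assumes "summable mean_sq_move"
  shows "summable (\<lambda>k. \<integral>\<omega>. (e k \<omega>)\<^sup>2 \<partial>M)"
proof -
  have s: "summable (\<lambda>k. (\<integral>\<omega>. \<Gamma> (Suc k) \<omega> \<partial>M) + V1 * (\<Sum>i=1..t+1. mean_sq_move (Suc k + 1 - i)))"
    using delayed_sum_summable[OF assms, of "t + 1"]
    by (intro summable_add summable_mult \<Gamma>_summable assms) (subst summable_Suc_iff)
  have "norm (\<integral>\<omega>. (e (Suc k) \<omega>)\<^sup>2 \<partial>M) \<le> (\<integral>\<omega>. \<Gamma> (Suc k) \<omega> \<partial>M) + V1 * (\<Sum>i=1..t+1. mean_sq_move (Suc k + 1 - i))" for k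
    using e_expectation[of "Suc k"] by simp
  then have "summable (\<lambda>k. \<integral>\<omega>. (e (Suc k) \<omega>)\<^sup>2 \<partial>M)"
    by (rule summable_comparison_test'[OF s, of 0])
  then show ?thesis by (subst (asm) summable_Suc_iff)
qed

lemma extrapolate_distance:
  assumes "\<And>j. 0 \<le> w j" "\<And>j. w j \<le> 1"
  shows "norm (extrapolate w t (\<lambda>l. A l \<omega>) k - A k \<omega>) \<le> (\<Sum>i=1..t. move (k + 1 - i) \<omega>)"
proof -
  have "norm (extrapolate w t (\<lambda>l. A l \<omega>) k - A k \<omega>)
      \<le> (\<Sum>i=1..t. norm (w (k + 1 - i) *\<^sub>R (A (k + 1 - i) \<omega> - A (k - i) \<omega>)))"
    unfolding extrapolate_def add_diff_cancel_left' by (rule norm_sum)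
  also have "\<dots> = (\<Sum>i=1..t. w (k + 1 - i) * move (k + 1 - i) \<omega>)"
    unfolding norm_scaleR move_eq using assms(1) by simp
  also have "\<dots> \<le> (\<Sum>i=1..t. move (k + 1 - i) \<omega>)"
    by (rule sum_mono) (rule mult_left_le_one_le[OF move_nonneg assms])
  finally show ?thesis .
qed

text \<open>\<open>B\<close> is a measurable majorant of the squared distances. Monotonicity of the
  integral suffices to bound the distances by it, while its measurability is what later allows sum
  and integral to be exchanged.\<close>

lemma residual_square_summable:
  assumes sum_x: "summable mean_sq_move"
  obtains B :: "nat \<Rightarrow> 'w \<Rightarrow> real"
  where "\<And>k. B k \<in> borel_measurable M"
    "AE \<omega> in M. \<forall>k. (dist0 (limiting_subdiff Phi (A k \<omega>)))\<^sup>2 \<le> ennreal (B k \<omega>)"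
    "(\<Sum>k. \<integral>\<^sup>+ \<omega>. ennreal (B k \<omega>) \<partial>M) < \<infinity>"
proof -
  \<comment> \<open>\<open>K\<close> bounds the change of the full gradient between successive
    iterates; this is where their boundedness is needed.\<close>
  obtain K where K: "0 \<le> K" "\<And>y z. norm y \<le> C \<Longrightarrow> norm z \<le> C \<Longrightarrow> norm (gf y - gf z) \<le> K * norm (y - z)"
    using loc_lipschitzD[OF gf_lipschitz] by metis
  obtain r0 where r0: "0 \<le> r0" "\<And>n. residual_le n A0 r0"
    using residual_le_init[OF A0_subdiff] by blast
  \<comment> \<open>In \<open>c1\<close> and \<open>c2\<close> the first summand comes from changes
    of the gradient, \<open>K\<close> along the new move and \<open>L\<close> along the
    extrapolation. The second one comes from the displacement from the prox centre divided by the
    stepsize.\<close>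
  define c1 where "c1 = K + 1 / \<eta>lo"
  define c2 where "c2 = L + 1 / \<eta>lo"
  have c: "0 \<le> c1" "0 \<le> c2" unfolding c1_def c2_def using K(1) L_nonneg \<eta>lo(1) by auto
  define u where "u k \<omega> = e k \<omega> + c1 * move (Suc k) \<omega> + c2 * (\<Sum>i=1..t. move (k + 1 - i) \<omega>)" for k \<omega>
  define w where "w k \<omega> = K * move (Suc k) \<omega>" for k \<omega>
  define R where "R n = residual_bound r0 n \<xi> u w" for n
  have Dm: "move j \<in> borel_measurable (F k)" if "j \<le> k" for j k
    using that by (rule measurable_F_mono[OF move_measurable])
  have um: "u k \<in> borel_measurable (F (Suc k))" for k
    unfolding u_def[abs_def]
    by (intro borel_measurable_add borel_measurable_times borel_measurable_sum borel_measurable_const e_measurable Dm) auto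
  have wm: "w k \<in> borel_measurable (F (Suc k))" for k
    unfolding w_def[abs_def] by (intro borel_measurable_times borel_measurable_const Dm) auto
  have u0: "0 \<le> u k \<omega>" for k \<omega>
    unfolding u_def using c by (intro add_nonneg_nonneg mult_nonneg_nonneg sum_nonneg e_nonneg move_nonneg)
  have w0: "0 \<le> w k \<omega>" for k \<omega>
    unfolding w_def using K(1) by (intro mult_nonneg_nonneg move_nonneg)
  have u_le: "(u k \<omega>)\<^sup>2 \<le> 3 * (e k \<omega>)\<^sup>2 + 3 * c1\<^sup>2 * (move (Suc k) \<omega>)\<^sup>2 + 3 * c2\<^sup>2 * real t * (\<Sum>i=1..t. (move (k + 1 - i) \<omega>)\<^sup>2)" for k \<omega>
  proof -
    have "(\<Sum>i=1..t. move (k + 1 - i) \<omega>)\<^sup>2 \<le> (\<Sum>i=1..t. (move (k + 1 - i) \<omega>)\<^sup>2) * real (card {1..t})"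
      by (rule sum_squared_le_sum_of_squares)
    then have "3 * c2\<^sup>2 * (\<Sum>i=1..t. move (k + 1 - i) \<omega>)\<^sup>2 \<le> 3 * c2\<^sup>2 * ((\<Sum>i=1..t. (move (k + 1 - i) \<omega>)\<^sup>2) * real (card {1..t}))"
      by (intro mult_left_mono) auto
    then show ?thesis unfolding u_def
      using power2_sum3_le[of "e k \<omega>" "c1 * move (Suc k) \<omega>" "c2 * (\<Sum>i=1..t. move (k + 1 - i) \<omega>)"]
      by (simp add: power_mult_distrib algebra_simps)
  qed
  have v_int: "integrable M (\<lambda>\<omega>. 3 * (e k \<omega>)\<^sup>2 + 3 * c1\<^sup>2 * (move (Suc k) \<omega>)\<^sup>2 + 3 * c2\<^sup>2 * real t * (\<Sum>i=1..t. (move (k + 1 - i) \<omega>)\<^sup>2))" for k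
    by (intro Bochner_Integration.integrable_add integrable_mult_right Bochner_Integration.integrable_sum move_square_integrable e_square_integrable)
  have u_int: "integrable M (\<lambda>\<omega>. (u k \<omega>)\<^sup>2)" for k
  proof (rule Bochner_Integration.integrable_bound[OF v_int[of k]])
    show "(\<lambda>\<omega>. (u k \<omega>)\<^sup>2) \<in> borel_measurable M"
      using measurable_F_M[OF um[of k]] by measurable
    show "AE \<omega> in M. norm ((u k \<omega>)\<^sup>2) \<le> norm (3 * (e k \<omega>)\<^sup>2 + 3 * c1\<^sup>2 * (move (Suc k) \<omega>)\<^sup>2 + 3 * c2\<^sup>2 * real t * (\<Sum>i=1..t. (move (k + 1 - i) \<omega>)\<^sup>2))"
    proof (rule AE_I2)
      fix \<omega>
      have "norm ((u k \<omega>)\<^sup>2) = (u k \<omega>)\<^sup>2" by simp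
      also note u_le[of k \<omega>]
      also note abs_ge_self
      finally show "norm ((u k \<omega>)\<^sup>2) \<le> norm (3 * (e k \<omega>)\<^sup>2 + 3 * c1\<^sup>2 * (move (Suc k) \<omega>)\<^sup>2 + 3 * c2\<^sup>2 * real t * (\<Sum>i=1..t. (move (k + 1 - i) \<omega>)\<^sup>2))"
        unfolding real_norm_def .
    qed
  qed
  have w_int: "integrable M (\<lambda>\<omega>. (w k \<omega>)\<^sup>2)" for k
    unfolding w_def power_mult_distrib by (intro integrable_mult_right move_square_integrable)
  have v_sum: "summable (\<lambda>k. 3 * (\<integral>\<omega>. (e k \<omega>)\<^sup>2 \<partial>M) + 3 * c1\<^sup>2 * mean_sq_move (Suc k) + 3 * c2\<^sup>2 * real t * (\<Sum>i=1..t. mean_sq_move (k + 1 - i)))"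
    using sum_x by (intro summable_add summable_mult e_summable delayed_sum_summable) (auto simp: summable_Suc_iff)
  have u_sum: "summable (\<lambda>k. \<integral>\<omega>. (u k \<omega>)\<^sup>2 \<partial>M)"
  proof (rule summable_comparison_test'[OF v_sum, of 0])
    fix k
    have "(\<integral>\<omega>. (u k \<omega>)\<^sup>2 \<partial>M) \<le> (\<integral>\<omega>. 3 * (e k \<omega>)\<^sup>2 + 3 * c1\<^sup>2 * (move (Suc k) \<omega>)\<^sup>2 + 3 * c2\<^sup>2 * real t * (\<Sum>i=1..t. (move (k + 1 - i) \<omega>)\<^sup>2) \<partial>M)"
      by (intro integral_mono u_int v_int u_le)
    also have "\<dots> = 3 * (\<integral>\<omega>. (e k \<omega>)\<^sup>2 \<partial>M) + 3 * c1\<^sup>2 * mean_sq_move (Suc k) + 3 * c2\<^sup>2 * real t * (\<Sum>i=1..t. mean_sq_move (k + 1 - i))"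
      unfolding mean_sq_move_def using e_square_integrable move_square_integrable by simp
    finally show "norm (\<integral>\<omega>. (u k \<omega>)\<^sup>2 \<partial>M) \<le> 3 * (\<integral>\<omega>. (e k \<omega>)\<^sup>2 \<partial>M) + 3 * c1\<^sup>2 * mean_sq_move (Suc k) + 3 * c2\<^sup>2 * real t * (\<Sum>i=1..t. mean_sq_move (k + 1 - i))"
      by simp
  qed
  have "(\<integral>\<omega>. (w k \<omega>)\<^sup>2 \<partial>M) = K\<^sup>2 * mean_sq_move (Suc k)" for k
    unfolding w_def mean_sq_move_def power_mult_distrib by simp
  then have w_sum: "summable (\<lambda>k. \<integral>\<omega>. (w k \<omega>)\<^sup>2 \<partial>M)"
    using sum_x by (simp add: summable_mult summable_Suc_iff)
  have R_sum: "(\<Sum>k. \<integral>\<^sup>+ \<omega>. ennreal ((R n k \<omega>)\<^sup>2) \<partial>M) < \<infinity>" for n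
    unfolding R_def by (rule residual_bound_square_summable[OF r0(1) um u0 u_int wm w0 w_int u_sum w_sum])
  have Rm: "R n k \<in> borel_measurable M" for n k
    unfolding R_def by (rule measurable_F_M[OF residual_bound_measurable[OF um wm]])
  have R0: "0 \<le> R n k \<omega>" for n k \<omega>
    unfolding R_def by (rule residual_bound_nonneg[where \<omega> = \<omega>, OF r0(1) u0 w0])
  \<comment> \<open>One null set for all \<open>k\<close>, because the induction below follows a
    single path.\<close>
  have "AE \<omega> in M. \<forall>k. norm (A k \<omega>) \<le> C" using bounded by (simp add: AE_all_countable)
  then have res: "AE \<omega> in M. \<forall>k n. residual_le n (A k \<omega>) (R n k \<omega>)"
    using block_lipschitz AE_space
  proof eventually_elim
    case (elim \<omega>)
    have "residual_le n (A k \<omega>) (R n k \<omega>)" for k n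
    proof (induction k)
      case 0
      then show ?case using r0(2) A_init[OF elim(3)] unfolding R_def by simp
    next
      case (Suc k)
      have gf_le: "norm (gf (A (Suc k) \<omega>) - gf (A k \<omega>)) \<le> K * move (Suc k) \<omega>"
        using K(2)[of "A (Suc k) \<omega>" "A k \<omega>"] elim(1) unfolding move_def by simp
      note step = A_step[OF elim(3), of k]
      show ?case
      proof (cases "\<xi> k \<omega> = n")
        case False
        then have "P n (A (Suc k) \<omega>) = P n (A k \<omega>)" using step unfolding prox_step_def by auto
        from residual_le_keep[OF Suc this gf_le] show ?thesis using False unfolding R_def w_def by simp
      next
        case True
        define y where "y = extrapolate \<beta> t (\<lambda>l. A l \<omega>) k"
        define z where "z = extrapolate \<alpha> t (\<lambda>l. A l \<omega>) k"
        define S where "S = (\<Sum>i=1..t. move (k + 1 - i) \<omega>)"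
        have yS: "norm (y - A k \<omega>) \<le> S" and zS: "norm (z - A k \<omega>) \<le> S"
          unfolding y_def z_def S_def by (intro extrapolate_distance inertia)+
        have S0: "0 \<le> S" unfolding S_def by (intro sum_nonneg move_nonneg)
        have a: "norm (P n (gf (A (Suc k) \<omega>)) - P n (gf (A k \<omega>))) \<le> K * move (Suc k) \<omega>"
          using norm_P_le[of n "gf (A (Suc k) \<omega>) - gf (A k \<omega>)"] gf_le by (simp add: P_diff)
        have "norm (P n (gf (A k \<omega> + P n (A k \<omega> - A k \<omega>))) - P n (gf (A k \<omega> + P n (y - A k \<omega>)))) \<le> L * norm (P n (A k \<omega> - y))"
          using elim(2) by blast
        also have "norm (P n (A k \<omega> - y)) \<le> S"
          using norm_P_le[of n "A k \<omega> - y"] yS by (simp add: norm_minus_commute)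
        finally have b: "norm (P n (gf (A k \<omega>)) - P n (gf (A k \<omega> + P n (y - A k \<omega>)))) \<le> L * S"
          using L_nonneg by (simp add: P_zero mult_left_mono)
        have e: "norm (P n (gf (A k \<omega> + P n (y - A k \<omega>))) - P n (G k \<omega>)) = e k \<omega>"
          unfolding e_eq True y_def by (rule norm_minus_commute)
        \<comment> \<open>From the gradient at the new iterate via the one at the old iterate and
          the one at the extrapolated point to the stochastic gradient; the three differences cost
          \<open>K\<close>, \<open>L\<close> and \<open>e k\<close>.\<close>
        have "P n (gf (A (Suc k) \<omega>)) - P n (G k \<omega>) = (P n (gf (A (Suc k) \<omega>)) - P n (gf (A k \<omega>)))
            + (P n (gf (A k \<omega>)) - P n (gf (A k \<omega> + P n (y - A k \<omega>))))
            + (P n (gf (A k \<omega> + P n (y - A k \<omega>))) - P n (G k \<omega>))" by simp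
        then have "norm (P n (gf (A (Suc k) \<omega>)) - P n (G k \<omega>)) \<le> K * move (Suc k) \<omega> + L * S + e k \<omega>"
          using a b e by (smt (verit) norm_triangle_ineq)
        moreover have "(1 / \<eta> k) * norm (A (Suc k) \<omega> - z) \<le> (1 / \<eta>lo) * (move (Suc k) \<omega> + S)"
        proof (rule mult_mono)
          show "1 / \<eta> k \<le> 1 / \<eta>lo" using \<eta>lo eta_pos by (intro divide_left_mono) auto
          have "A (Suc k) \<omega> - z = (A (Suc k) \<omega> - A k \<omega>) - (z - A k \<omega>)" by simp
          then show "norm (A (Suc k) \<omega> - z) \<le> move (Suc k) \<omega> + S"
            using zS norm_triangle_ineq4[of "A (Suc k) \<omega> - A k \<omega>" "z - A k \<omega>"] unfolding move_def by simp
        qed (use \<eta>lo in auto)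
        moreover have "u k \<omega> = (K * move (Suc k) \<omega> + L * S + e k \<omega>) + (1 / \<eta>lo) * (move (Suc k) \<omega> + S)"
          unfolding u_def c1_def c2_def S_def[symmetric] by (simp add: algebra_simps)
        ultimately have "norm (P n (gf (A (Suc k) \<omega>)) - P n (G k \<omega>)) + (1 / \<eta> k) * norm (A (Suc k) \<omega> - z) \<le> u k \<omega>"
          by linarith
        then have "residual_le n (A (Suc k) \<omega>) (u k \<omega>)"
          using residual_le_prox_step[OF step[unfolded True] eta_pos H_finite[OF elim(3)]] unfolding z_def by blast
        then show ?thesis using True unfolding R_def by simp
      qed
    qed
    then show ?case by blast
  qed
  define B where "B k \<omega> = (\<Sum>n\<in>UNIV. (R n k \<omega>)\<^sup>2) * real CARD('m)" for k \<omega>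
  show thesis
  proof (rule that[of B])
    show "B k \<in> borel_measurable M" for k unfolding B_def[abs_def] using Rm by measurable
    show "AE \<omega> in M. \<forall>k. (dist0 (limiting_subdiff Phi (A k \<omega>)))\<^sup>2 \<le> ennreal (B k \<omega>)"
      using res
    proof eventually_elim
      case (elim \<omega>)
      show ?case
      proof
        fix k
        have "(dist0 (limiting_subdiff Phi (A k \<omega>)))\<^sup>2 \<le> (ennreal (\<Sum>n\<in>UNIV. R n k \<omega>))\<^sup>2"
          using elim by (intro power_mono dist0_residual) auto
        also have "\<dots> = ennreal ((\<Sum>n\<in>UNIV. R n k \<omega>)\<^sup>2)" by (intro ennreal_power sum_nonneg R0)
        also have "\<dots> \<le> ennreal (B k \<omega>)"
          unfolding B_def by (intro ennreal_leI sum_squared_le_sum_of_squares)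
        finally show "(dist0 (limiting_subdiff Phi (A k \<omega>)))\<^sup>2 \<le> ennreal (B k \<omega>)" .
      qed
    qed
    have "(\<integral>\<^sup>+ \<omega>. ennreal (B k \<omega>) \<partial>M) = (\<Sum>n\<in>UNIV. \<integral>\<^sup>+ \<omega>. ennreal ((R n k \<omega>)\<^sup>2) \<partial>M) * ennreal (real CARD('m))" for k
    proof -
      note [measurable] = Rm
      have "(\<integral>\<^sup>+ \<omega>. ennreal (B k \<omega>) \<partial>M) = (\<integral>\<^sup>+ \<omega>. (\<Sum>n\<in>UNIV. ennreal ((R n k \<omega>)\<^sup>2)) * ennreal (real CARD('m)) \<partial>M)"
        unfolding B_def by (intro nn_integral_cong) (simp add: ennreal_mult sum_nonneg flip: sum_ennreal)
      also have "\<dots> = (\<Sum>n\<in>UNIV. \<integral>\<^sup>+ \<omega>. ennreal ((R n k \<omega>)\<^sup>2) \<partial>M) * ennreal (real CARD('m))"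
        by (subst nn_integral_multc) (auto simp: nn_integral_sum simp del: sum_ennreal)
      finally show ?thesis .
    qed
    then have "(\<Sum>k. \<integral>\<^sup>+ \<omega>. ennreal (B k \<omega>) \<partial>M)
        = (\<Sum>n\<in>UNIV. \<Sum>k. \<integral>\<^sup>+ \<omega>. ennreal ((R n k \<omega>)\<^sup>2) \<partial>M) * ennreal (real CARD('m))"
      by (simp add: suminf_sum)
    also have "\<dots> < \<infinity>"
      using R_sum by (simp add: ennreal_mult_less_top)
    finally show "(\<Sum>k. \<integral>\<^sup>+ \<omega>. ennreal (B k \<omega>) \<partial>M) < \<infinity>" .
  qed
qed

text \<open>The induction carries two facts, no move so far and a vanishing mean of
  \<open>\<Gamma>\<close>. Together they make the next mean squared error zero, so the gradient used
  is exact and the prox step has nowhere to go; without a move the mean of \<open>\<Gamma>\<close>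
  stays zero. The first step precedes \<open>\<Gamma> 1\<close> and is covered by the assumption on
  \<open>A 1\<close>.\<close>

lemma stationary_start:
  assumes A1: "AE \<omega> in M. A 1 \<omega> = A0" and \<Gamma>1: "(\<integral>\<omega>. \<Gamma> 1 \<omega> \<partial>M) = 0" and min: "\<And>y. Phi A0 \<le> Phi y"
  shows "AE \<omega> in M. A k \<omega> = A0"
proof -
  obtain \<omega>0 where "\<omega>0 \<in> space M" using not_empty by blast
  then have finA0: "H n A0 \<noteq> \<infinity>" for n using H_finite[of \<omega>0 n 0] A_init by simp
  have "(AE \<omega> in M. \<forall>j\<le>Suc k. A j \<omega> = A0) \<and> (\<integral>\<omega>. \<Gamma> (Suc k) \<omega> \<partial>M) = 0" for k
  proof (induction k)
    case 0
    have "AE \<omega> in M. \<forall>j\<le>Suc 0. A j \<omega> = A0"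
      using A1 AE_space
    proof eventually_elim
      case (elim \<omega>)
      show ?case
      proof (intro allI impI)
        fix j :: nat assume "j \<le> Suc 0"
        then show "A j \<omega> = A0" using elim A_init[OF elim(2)] by (cases j) auto
      qed
    qed
    then show ?case using \<Gamma>1 by simp
  next
    case (Suc k)
    then have IH: "AE \<omega> in M. \<forall>j\<le>Suc k. A j \<omega> = A0" and \<Gamma>k: "(\<integral>\<omega>. \<Gamma> (Suc k) \<omega> \<partial>M) = 0" by auto
    have "mean_sq_move j = 0" if "j \<le> Suc k" for j
    proof -
      have "AE \<omega> in M. (move j \<omega>)\<^sup>2 = 0"
        using IH by eventually_elim (use that in \<open>simp add: move_def\<close>)
      then show ?thesis unfolding mean_sq_move_def by (intro integral_eq_zero_AE)
    qed
    then have S: "(\<Sum>i=1..t+1. mean_sq_move (Suc k + 1 - i)) = 0" by (intro sum.neutral) auto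
    have "(\<integral>\<omega>. (e (Suc k) \<omega>)\<^sup>2 \<partial>M) \<le> 0"
      using e_expectation[of "Suc k"] unfolding \<Gamma>k S by simp
    then have "(\<integral>\<omega>. (e (Suc k) \<omega>)\<^sup>2 \<partial>M) = 0" by (intro antisym) auto
    then have "AE \<omega> in M. (e (Suc k) \<omega>)\<^sup>2 = 0"
      by (subst (asm) integral_nonneg_eq_0_iff_AE[OF e_square_integrable]) auto
    then have step: "AE \<omega> in M. \<forall>j\<le>Suc (Suc k). A j \<omega> = A0"
      using IH AE_space
    proof eventually_elim
      case (elim \<omega>)
      have ext: "extrapolate w t (\<lambda>l. A l \<omega>) (Suc k) = A0" for w
      proof -
        have "(\<Sum>i=1..t. w (Suc k + 1 - i) *\<^sub>R (A (Suc k + 1 - i) \<omega> - A (Suc k - i) \<omega>)) = 0"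
          using elim(2) by (intro sum.neutral) auto
        then show ?thesis unfolding extrapolate_def using elim(2) by simp
      qed
      have step: "prox_step (\<xi> (Suc k) \<omega>) (\<eta> (Suc k)) (G (Suc k) \<omega>) A0 A0 (A (Suc (Suc k)) \<omega>)"
        using A_step[OF elim(3), of "Suc k"] elim(2) unfolding ext by simp
      have "P (\<xi> (Suc k) \<omega>) (G (Suc k) \<omega>) = P (\<xi> (Suc k) \<omega>) (gf A0)"
        using elim(1,2) unfolding e_eq ext by (simp add: P_zero)
      then have "A (Suc (Suc k)) \<omega> = A0"
        by (rule prox_step_minimizer[OF finA0 min step eta_pos])
      then show ?case using elim(2) by (auto simp: le_Suc_eq)
    qed
    have "(\<integral>\<omega>. \<Gamma> (Suc (Suc k)) \<omega> \<partial>M) \<le> 0"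
      using \<Gamma>_expectation[of "Suc k"] unfolding \<Gamma>k S by simp
    then have "(\<integral>\<omega>. \<Gamma> (Suc (Suc k)) \<omega> \<partial>M) = 0" by (intro antisym integral_\<Gamma>_nonneg) auto
    with step show ?case by blast
  qed
  then have "AE \<omega> in M. \<forall>j\<le>Suc k. A j \<omega> = A0" by blast
  then show ?thesis by eventually_elim simp
qed

end

text \<open>A counting argument on each path: every index before the first stationary one
  contributes at least \<open>\<epsilon>\<^sup>2\<close> to the series, so there are at most as many
  as the sum divided by \<open>\<epsilon>\<^sup>2\<close>.\<close>

lemma stationarity_time_le:
  assumes bound: "\<And>k. (dist0 (limiting_subdiff \<Phi> (A k \<omega>)))\<^sup>2 \<le> ennreal (B k)" and \<epsilon>: "0 < \<epsilon>"
  shows "stationarity_time \<Phi> A \<epsilon> \<omega> \<le> ennreal (1 / \<epsilon>\<^sup>2) * (\<Sum>k. ennreal (B k))"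
proof -
  define T where "T = {k. eps_stationary \<Phi> \<epsilon> (A k \<omega>)}"
  define S where "S = ennreal (1 / \<epsilon>\<^sup>2) * (\<Sum>k. ennreal (B k))"
  have le: "of_nat m \<le> S" if m: "\<And>k. k < m \<Longrightarrow> k \<notin> T" for m
  proof -
    have "1 \<le> ennreal (1 / \<epsilon>\<^sup>2) * ennreal (B k)" if "k < m" for k
    proof -
      have "ennreal \<epsilon> \<le> dist0 (limiting_subdiff \<Phi> (A k \<omega>))"
        using m[OF that] unfolding T_def eps_stationary_def by simp
      then have "(ennreal \<epsilon>)\<^sup>2 \<le> ennreal (B k)" using bound[of k] by (meson order.trans power_mono zero_le)
      then have "ennreal (\<epsilon>\<^sup>2) \<le> ennreal (B k)" using \<epsilon> by (simp add: ennreal_power)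
      then have "ennreal (1 / \<epsilon>\<^sup>2) * ennreal (\<epsilon>\<^sup>2) \<le> ennreal (1 / \<epsilon>\<^sup>2) * ennreal (B k)" by (rule mult_left_mono) simp
      moreover have "ennreal (1 / \<epsilon>\<^sup>2) * ennreal (\<epsilon>\<^sup>2) = 1" using \<epsilon> by (simp flip: ennreal_mult)
      ultimately show ?thesis by simp
    qed
    then have "(\<Sum>k<m. 1) \<le> (\<Sum>k<m. ennreal (1 / \<epsilon>\<^sup>2) * ennreal (B k))" by (intro sum_mono) auto
    also have "\<dots> \<le> (\<Sum>k. ennreal (1 / \<epsilon>\<^sup>2) * ennreal (B k))" by (rule sum_le_suminf) auto
    finally show ?thesis unfolding S_def by simp
  qed
  show ?thesis
  proof (cases "T = {}")
    case True
    \<comment> \<open>Without any stationary index the count is unbounded, so the series diverges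
      and the claim holds with infinity on the right.\<close>
    then have "of_nat m \<le> S" for m by (intro le) auto
    then have "\<not> S < \<infinity>" using ennreal_Ex_less_of_nat[of S] by (auto simp: not_less[symmetric])
    then have "S = \<infinity>" by (simp add: less_top[symmetric])
    then show ?thesis unfolding S_def by simp
  next
    case False
    then obtain k where "k \<in> T" by blast
    define m where "m = (LEAST k. k \<in> T)"
    have m: "m \<in> T" "\<And>k. k < m \<Longrightarrow> k \<notin> T"
      unfolding m_def using LeastI[of "\<lambda>k. k \<in> T", OF \<open>k \<in> T\<close>] not_less_Least by blast+
    have "stationarity_time \<Phi> A \<epsilon> \<omega> \<le> of_nat m" unfolding stationarity_time_def T_def[symmetric] using m(1) by (rule INF_lower)
    also have "\<dots> \<le> S" by (rule le[OF m(2)])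
    finally show ?thesis unfolding S_def .
  qed
qed

section \<open>Application to Midas-LL1\<close>

lemma history_generators:
  assumes "midas_sampling M N \<xi> \<zeta> X B"
  shows "{(\<lambda>\<omega>. (\<xi> j \<omega>, \<zeta> j \<omega>)) -` S \<inter> space M | j S. j < k \<and> S \<in> sets (sample_space N)} \<subseteq> sets M"
proof -
  have "(\<lambda>\<omega>. (\<xi> j \<omega>, \<zeta> j \<omega>)) \<in> measurable M (sample_space N)" for j
    using assms unfolding midas_sampling_def sample_space_def by (intro measurable_Pair) auto
  then show ?thesis by (auto dest: measurable_sets)
qed

lemma sets_history:
  assumes "midas_sampling M N \<xi> \<zeta> X B"
  shows "sets (history M N \<xi> \<zeta> k) = sigma_sets (space M)
    {(\<lambda>\<omega>. (\<xi> j \<omega>, \<zeta> j \<omega>)) -` S \<inter> space M | j S. j < k \<and> S \<in> sets (sample_space N)}"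
  unfolding history_def by (rule sets_measure_of) auto

lemma subalgebra_history:
  assumes "midas_sampling M N \<xi> \<zeta> X B"
  shows "subalgebra M (history M N \<xi> \<zeta> k)"
  unfolding subalgebra_def sets_history[OF assms]
  using sets.sigma_sets_subset[OF history_generators[OF assms]] by (simp add: history_def space_measure_of_conv)

lemma history_Suc:
  assumes "midas_sampling M N \<xi> \<zeta> X B"
  shows "sets (history M N \<xi> \<zeta> k) \<subseteq> sets (history M N \<xi> \<zeta> (Suc k))"
  unfolding sets_history[OF assms] by (rule sigma_sets_mono') (auto intro: less_SucI)

lemma mode_measurable_history:
  assumes "midas_sampling M N \<xi> \<zeta> X B"
  shows "\<xi> k \<in> measurable (history M N \<xi> \<zeta> (Suc k)) (count_space UNIV)"
proof (rule measurableI)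
  fix U :: "mode set"
  have \<zeta>: "\<zeta> k \<in> measurable M (count_space UNIV \<Otimes>\<^sub>M N)"
    using assms unfolding midas_sampling_def by blast
  have "\<xi> k -` U \<inter> space M
      = (\<lambda>\<omega>. (\<xi> k \<omega>, \<zeta> k \<omega>)) -` (U \<times> space (count_space UNIV \<Otimes>\<^sub>M N)) \<inter> space M"
    using measurable_space[OF \<zeta>] by auto
  moreover have "U \<times> space (count_space UNIV \<Otimes>\<^sub>M N) \<in> sets (sample_space N)"
    unfolding sample_space_def by (intro pair_measureI) auto
  ultimately show "\<xi> k -` U \<inter> space (history M N \<xi> \<zeta> (Suc k)) \<in> sets (history M N \<xi> \<zeta> (Suc k))"
    unfolding sets_history[OF assms] by (intro sigma_sets.Basic) (auto simp: history_def space_measure_of_conv)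
qed simp

text \<open>The sampling assumption concerns the mode jointly with an admissible minibatch, so
  summing over minibatches gives only a lower bound for the event of a mode. The three lower bounds
  already exhaust the probability of \<open>E\<close>, hence all of them are equalities.\<close>

lemma mode_uniform_given_history:
  fixes X :: "real^'k::finite^'j::finite^'i::finite"
  assumes "prob_space M" and samp: "midas_sampling M N \<xi> \<zeta> X B" and E: "E \<in> sets (history M N \<xi> \<zeta> k)"
  shows "measure M (E \<inter> {\<omega> \<in> space M. \<xi> k \<omega> = n}) = measure M E / 3"
proof -
  interpret prob_space M by fact
  have [measurable]: "\<xi> k \<in> measurable M (count_space UNIV)" "\<zeta> k \<in> measurable M (count_space UNIV \<Otimes>\<^sub>M N)"
    using samp unfolding midas_sampling_def by blast+
  have EM[measurable]: "E \<in> sets M" using E subalgebra_history[OF samp] unfolding subalgebra_def by blast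
  have lower: "measure M E / 3 \<le> measure M (E \<inter> {\<omega> \<in> space M. \<xi> k \<omega> = n})" for n
  proof -
    define \<S> where "\<S> = {S. S \<subseteq> {1..num_fibers X n} \<and> card S = B}"
    define Q where "Q S = E \<inter> {\<omega> \<in> space M. \<xi> k \<omega> = n \<and> fst (\<zeta> k \<omega>) = S}" for S
    have fin: "finite \<S>" unfolding \<S>_def by (rule finite_subset[of _ "Pow {1..num_fibers X n}"]) auto
    have card: "card \<S> = num_fibers X n choose B" unfolding \<S>_def by (simp add: n_subsets)
    have pos: "0 < num_fibers X n choose B" using samp unfolding midas_sampling_def by simp
    have Qm: "Q S \<in> sets M" for S unfolding Q_def by measurable
    have "measure M E / 3 = (\<Sum>S\<in>\<S>. measure M E * (1 / 3) * (1 / real (num_fibers X n choose B)))"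
      using pos by (simp add: card)
    also have "\<dots> = (\<Sum>S\<in>\<S>. measure M (Q S))"
      using samp E unfolding midas_sampling_def Q_def \<S>_def by (intro sum.cong) auto
    also have "\<dots> = measure M (\<Union>S\<in>\<S>. Q S)"
      by (rule finite_measure_finite_Union[symmetric]) (use fin Qm in \<open>auto simp: disjoint_family_on_def Q_def\<close>)
    also have "\<dots> \<le> measure M (E \<inter> {\<omega> \<in> space M. \<xi> k \<omega> = n})"
      by (rule finite_measure_mono) (auto simp: Q_def)
    finally show ?thesis .
  qed
  have "measure M E = measure M (\<Union>m\<in>UNIV. E \<inter> {\<omega> \<in> space M. \<xi> k \<omega> = m})"
    using sets.sets_into_space[OF EM] by (intro arg_cong[where f = "measure M"]) auto
  also have "\<dots> = (\<Sum>m\<in>UNIV. measure M (E \<inter> {\<omega> \<in> space M. \<xi> k \<omega> = m}))"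
    by (rule finite_measure_finite_Union) (auto simp: disjoint_family_on_def)
  finally have "measure M E = measure M (E \<inter> {\<omega> \<in> space M. \<xi> k \<omega> = M1})
      + measure M (E \<inter> {\<omega> \<in> space M. \<xi> k \<omega> = M2}) + measure M (E \<inter> {\<omega> \<in> space M. \<xi> k \<omega> = M3})"
    by (simp add: UNIV_mode)
  then have "measure M (E \<inter> {\<omega> \<in> space M. \<xi> k \<omega> = M1}) = measure M E / 3"
    "measure M (E \<inter> {\<omega> \<in> space M. \<xi> k \<omega> = M2}) = measure M E / 3"
    "measure M (E \<inter> {\<omega> \<in> space M. \<xi> k \<omega> = M3}) = measure M E / 3"
    using lower[of M1] lower[of M2] lower[of M3] by linarith+
  then show ?thesis by (cases n) simp_all
qed

text \<open>A uniform index averages \<open>K\<close> terms of a nonnegative series, so its finite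
  total yields the rate \<open>1 / K\<close>.\<close>

lemma mean_sq_residual_le:
  assumes AE: "\<And>k. AE \<omega> in M. (dist0 (limiting_subdiff \<Phi> (A k \<omega>)))\<^sup>2 \<le> ennreal (b k \<omega>)"
    and sum: "(\<Sum>k. \<integral>\<^sup>+ \<omega>. ennreal (b k \<omega>) \<partial>M) \<le> ennreal s" and "0 \<le> s" "1 \<le> K"
  shows "mean_sq_residual M \<Phi> A K \<le> ennreal (s / real K)"
proof -
  have "mean_sq_residual M \<Phi> A K
      = (\<Sum>k\<in>{2..K+1}. \<integral>\<^sup>+ \<omega>. (dist0 (limiting_subdiff \<Phi> (A k \<omega>)))\<^sup>2 \<partial>M) / of_nat (card {2..K+1})"
    unfolding mean_sq_residual_def using assms(4) by (subst nn_integral_pmf_of_set) (auto simp: ennreal_of_nat_eq_real_of_nat)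
  also have "\<dots> \<le> ennreal s / of_nat (card {2..K+1})"
  proof (rule divide_right_mono_ennreal)
    have "(\<Sum>k\<in>{2..K+1}. \<integral>\<^sup>+ \<omega>. (dist0 (limiting_subdiff \<Phi> (A k \<omega>)))\<^sup>2 \<partial>M)
        \<le> (\<Sum>k\<in>{2..K+1}. \<integral>\<^sup>+ \<omega>. ennreal (b k \<omega>) \<partial>M)"
      by (intro sum_mono nn_integral_mono_AE AE)
    also have "\<dots> \<le> (\<Sum>k. \<integral>\<^sup>+ \<omega>. ennreal (b k \<omega>) \<partial>M)" by (rule sum_le_suminf) auto
    also note sum
    finally show "(\<Sum>k\<in>{2..K+1}. \<integral>\<^sup>+ \<omega>. (dist0 (limiting_subdiff \<Phi> (A k \<omega>)))\<^sup>2 \<partial>M) \<le> ennreal s" .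
  qed
  also have "\<dots> = ennreal (s / real K)"
    using assms(3,4) by (simp add: ennreal_of_nat_eq_real_of_nat divide_ennreal)
  finally show ?thesis .
qed

text \<open>The prox problem of a block is the sum of the problems of its pieces. For any competitor
  \<open>w\<close>, each piece of the new iterate beats the corresponding piece of \<open>w\<close>,
  and the inequalities are added.\<close>

lemma midas_step_prox_step:
  fixes h :: "mode \<Rightarrow> 'r \<Rightarrow> ('i::finite, 'j::finite, 'k::finite, 'c::finite, 'r::finite) factors \<Rightarrow> ereal"
  assumes "block_composite block f gf (\<lambda>n A. \<Sum>r\<in>UNIV. h n r (piece blk n r A)) lo"
    and "midas_step blk h \<eta> \<alpha> t n g a k"
  shows "block_composite.prox_step block (\<lambda>n A. \<Sum>r\<in>UNIV. h n r (piece blk n r A)) n (\<eta> k) g (a k)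
    (extrapolate \<alpha> t a k) (a (Suc k))"
proof -
  interpret block_composite block f gf "\<lambda>n A. \<Sum>r\<in>UNIV. h n r (piece blk n r A)" lo by fact
  define z where "z = extrapolate \<alpha> t a k"
  define q where "q r w = piece blk n r g \<bullet> (w - piece blk n r z) + 1 / (2 * \<eta> k) * (norm (w - piece blk n r z))\<^sup>2" for r w
  have q_sum: "(\<Sum>r\<in>UNIV. q r (piece blk n r w)) = g \<bullet> block n (w - z) + 1 / (2 * \<eta> k) * (norm (block n (w - z)))\<^sup>2" for w
  proof -
    have d: "piece blk n r w - piece blk n r z = piece blk n r (w - z)" for r
      by (rule linear_diff[OF linear_piece, symmetric])
    have "(\<Sum>r\<in>UNIV. q r (piece blk n r w)) = block n g \<bullet> block n (w - z) + 1 / (2 * \<eta> k) * (block n (w - z) \<bullet> block n (w - z))"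
      unfolding q_def d power2_norm_eq_inner sum.distrib sum_distrib_left[symmetric] sum_inner_piece ..
    then show ?thesis unfolding power2_norm_eq_inner inner_P_right[of g] inner_P[of n g] .
  qed
  have "(\<Sum>r\<in>UNIV. h n r (piece blk n r (a (Suc k)))) + ereal (g \<bullet> block n (a (Suc k) - z) + 1 / (2 * \<eta> k) * (norm (block n (a (Suc k) - z)))\<^sup>2)
    \<le> (\<Sum>r\<in>UNIV. h n r (piece blk n r w)) + ereal (g \<bullet> block n (w - z) + 1 / (2 * \<eta> k) * (norm (block n (w - z)))\<^sup>2)" for w
  proof -
    have "h n r (piece blk n r (a (Suc k))) + ereal (q r (piece blk n r (a (Suc k))))
        \<le> h n r (piece blk n r w) + ereal (q r (piece blk n r w))" for r
    proof -
      have "is_arg_min (\<lambda>Z. h n r Z + ereal (q r Z)) (\<lambda>Z. Z \<in> range (piece blk n r)) (piece blk n r (a (Suc k)))"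
        using assms(2) unfolding midas_step_def q_def z_def by blast
      then show ?thesis unfolding is_arg_min_linorder by (auto simp del: split_paired_All)
    qed
    then have "(\<Sum>r\<in>UNIV. h n r (piece blk n r (a (Suc k))) + ereal (q r (piece blk n r (a (Suc k)))))
        \<le> (\<Sum>r\<in>UNIV. h n r (piece blk n r w) + ereal (q r (piece blk n r w)))"
      by (intro sum_mono)
    then show ?thesis by (simp add: sum.distrib q_sum)
  qed
  then show ?thesis using assms(2) unfolding prox_step_def z_def midas_step_def by blast
qed

lemma block_composite_ll1:
  fixes X :: "real^'k::finite^'j::finite^'i::finite" and blk :: "'c::finite \<Rightarrow> 'r::finite"
    and h :: "mode \<Rightarrow> 'r \<Rightarrow> ('i, 'j, 'k, 'c, 'r) factors \<Rightarrow> ereal"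
  assumes lsc: "\<And>n r. lsc_on (range (piece blk n r)) (h n r)"
    and lower: "\<And>n r. bounded_below_on (range (piece blk n r)) (h n r)"
    and conv: "\<And>n r. ereal_convex_on (range (piece blk n r)) (h n r)"
  obtains lo where "block_composite block (ll1_loss X blk) (grad (ll1_loss X blk))
      (\<lambda>n A. \<Sum>r\<in>UNIV. h n r (piece blk n r A)) lo"
proof -
  obtain c :: "mode \<Rightarrow> 'r \<Rightarrow> real" where c: "\<And>n r A. ereal (c n r) \<le> h n r (piece blk n r A)"
    using lower unfolding bounded_below_on_def by (metis rangeI)
  \<comment> \<open>With absolute values over all modes, one constant lies below the sum of the
    bounds of every single mode.\<close>
  define lo where "lo = - (\<Sum>n\<in>UNIV. \<Sum>r\<in>UNIV. \<bar>c n r\<bar>)"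
  show thesis
  proof (rule that[of lo], rule block_composite.intro[OF block_decomposition_block], rule block_composite_axioms.intro)
    fix n :: mode and A :: "('i, 'j, 'k, 'c, 'r) factors"
    show "GDERIV (ll1_loss X blk) A :> grad (ll1_loss X blk) A" by (rule c11_grad(1)[OF c11_ll1_loss])
    show "loc_lipschitz (grad (ll1_loss X blk))" by (rule c11_grad(2)[OF c11_ll1_loss])
    have "(\<Sum>r\<in>UNIV. \<bar>c n r\<bar>) \<le> (\<Sum>n\<in>UNIV. \<Sum>r\<in>UNIV. \<bar>c n r\<bar>)"
      by (rule member_le_sum[where f = "\<lambda>n. \<Sum>r\<in>UNIV. \<bar>c n r\<bar>"]) (auto intro: sum_nonneg)
    moreover have "- (\<Sum>r\<in>UNIV. \<bar>c n r\<bar>) \<le> (\<Sum>r\<in>UNIV. c n r)"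
      unfolding sum_negf[symmetric] by (intro sum_mono) simp
    ultimately have "ereal lo \<le> (\<Sum>r\<in>UNIV. ereal (c n r))" unfolding lo_def by simp
    also have "\<dots> \<le> (\<Sum>r\<in>UNIV. h n r (piece blk n r A))" by (intro sum_mono c)
    finally show "ereal lo \<le> (\<Sum>r\<in>UNIV. h n r (piece blk n r A))" .
    have ninf: "h n r (piece blk n r A) \<noteq> -\<infinity>" for r A using c[of n r A] by auto
    show "ereal_convex_on UNIV (\<lambda>A. \<Sum>r\<in>UNIV. h n r (piece blk n r A))"
      by (intro ereal_convex_on_sum ereal_convex_on_linear_image linear_piece conv ninf) auto
    show "(\<Sum>r\<in>UNIV. h n r (piece blk n r (block n A))) = (\<Sum>r\<in>UNIV. h n r (piece blk n r A))"
      by (simp add: piece_block)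
    have "continuous_on UNIV (piece blk n r :: ('i, 'j, 'k, 'c, 'r) factors \<Rightarrow> _)" for r
      using linear_piece by (intro linear_continuous_on) (simp add: linear_conv_bounded_linear)
    then show "(\<lambda>A. \<Sum>r\<in>UNIV. h n r (piece blk n r A)) \<in> borel_measurable borel"
      by (intro borel_measurable_ereal_sum ereal_lsc_borel_measurable[OF _ lsc]) auto
  qed
qed

lemma midas_coefficients_eventually:
  assumes \<eta>: "0 < \<eta>lo" "\<And>k. \<eta>lo \<le> \<eta> k \<and> \<eta> k \<le> \<eta>hi"
    and inertia: "\<And>k. 0 \<le> \<alpha> k \<and> \<alpha> k \<le> 1" "\<And>k. 0 \<le> \<beta> k \<and> \<beta> k \<le> 1"
    and L: "0 \<le> L" and \<gamma>: "0 < \<gamma>"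
    and abar_def: "\<And>i. abar i = real_limsup (\<lambda>k. midas_a t L \<gamma> \<eta> \<alpha> \<beta> k i)"
    and \<delta>: "0 < real_liminf (midas_b t L \<gamma> \<eta> \<alpha>) - (\<Sum>j=1..t+1. (real j + 1) * abar j)"
  shows "\<gamma> / 2 \<le> abar i"
    and "\<exists>a b k0. (\<forall>i. 0 \<le> a i) \<and> (\<Sum>i=1..t+1. a i) < b \<and> (\<forall>k\<ge>k0. b \<le> midas_b t L \<gamma> \<eta> \<alpha> k)
      \<and> (\<forall>k\<ge>k0. \<forall>i\<in>{1..t+1}. midas_a t L \<gamma> \<eta> \<alpha> \<beta> k i \<le> a i)"
proof -
  have \<eta>0: "0 < \<eta> k" for k using \<eta>(1) \<eta>(2)[of k] by linarith
  have \<eta>hi: "0 < \<eta>hi" using \<eta>0[of 0] \<eta>(2)[of 0] by linarith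
  have a_low: "\<gamma> / 2 \<le> midas_a t L \<gamma> \<eta> \<alpha> \<beta> k i" for k i
    unfolding midas_a_def using L \<eta>0[of k] inertia by simp
  have a_bd: "\<bar>midas_a t L \<gamma> \<eta> \<alpha> \<beta> k i\<bar> \<le> 3 * L * real t / 2 + \<gamma> / 2 + 1 / (2 * \<eta>lo)" for k i
  proof -
    have "3 * L * real t * (\<beta> (k + 1 - i))\<^sup>2 \<le> 3 * L * real t"
      using L inertia(2)[of "k + 1 - i"] by (intro mult_left_le) (auto intro: power_le_one)
    moreover have "\<alpha> (k + 1 - i) / (2 * \<eta> k) \<le> 1 / (2 * \<eta>lo)"
      using inertia(1)[of "k + 1 - i"] \<eta>(1) \<eta>(2)[of k] by (intro frac_le) auto
    ultimately show ?thesis using a_low[of k i] \<gamma> unfolding midas_a_def by simp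
  qed
  have b_bd: "\<bar>midas_b t L \<gamma> \<eta> \<alpha> k\<bar> \<le> (1 + real t + 2 * L * \<eta>hi + \<gamma> * \<eta>hi) / (2 * \<eta>lo)" for k
  proof -
    have "(\<Sum>i=1..t. \<alpha> (k + 1 - i)) \<le> (\<Sum>i=1..t. 1)" using inertia(1) by (intro sum_mono) auto
    moreover have "0 \<le> (\<Sum>i=1..t. \<alpha> (k + 1 - i))" using inertia(1) by (intro sum_nonneg) auto
    moreover have "0 \<le> L * \<eta> k" "L * \<eta> k \<le> L * \<eta>hi" "0 \<le> \<gamma> * \<eta> k" "\<gamma> * \<eta> k \<le> \<gamma> * \<eta>hi"
      using L \<gamma> \<eta>0[of k] \<eta>(2)[of k] by (auto intro!: mult_left_mono)
    ultimately have "\<bar>1 - (\<Sum>i=1..t. \<alpha> (k + 1 - i)) - 2 * L * \<eta> k - \<gamma> * \<eta> k\<bar> \<le> 1 + real t + 2 * L * \<eta>hi + \<gamma> * \<eta>hi"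
      by simp
    then show ?thesis unfolding midas_b_def abs_divide
      using \<eta>(1) \<eta>(2)[of k] by (intro frac_le) auto
  qed
  show low: "\<gamma> / 2 \<le> abar i" for i unfolding abar_def by (rule real_limsup_ge[OF a_bd a_low])
  define \<delta> where "\<delta> = real_liminf (midas_b t L \<gamma> \<eta> \<alpha>) - (\<Sum>j=1..t+1. (real j + 1) * abar j)"
  \<comment> \<open>Raising \<open>t + 1\<close> coefficients and lowering \<open>b\<close> by
    \<open>\<epsilon>\<close> costs \<open>(t + 2) * \<epsilon>\<close>; one further
    \<open>\<epsilon>\<close> keeps the inequality strict.\<close>
  define \<epsilon> where "\<epsilon> = \<delta> / (real t + 3)"
  have \<epsilon>: "0 < \<epsilon>" unfolding \<epsilon>_def \<delta>_def using \<delta> by simp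
  have "eventually (\<lambda>k. \<forall>i\<in>{1..t+1}. midas_a t L \<gamma> \<eta> \<alpha> \<beta> k i \<le> abar i + \<epsilon>) sequentially"
    unfolding abar_def by (intro eventually_ball_finite ballI eventually_le_real_limsup[OF a_bd \<epsilon>]) auto
  moreover have "eventually (\<lambda>k. real_liminf (midas_b t L \<gamma> \<eta> \<alpha>) - \<epsilon> \<le> midas_b t L \<gamma> \<eta> \<alpha> k) sequentially"
    by (rule eventually_ge_real_liminf[OF b_bd \<epsilon>])
  ultimately obtain k0 where k0: "\<And>k. k \<ge> k0 \<Longrightarrow> \<forall>i\<in>{1..t+1}. midas_a t L \<gamma> \<eta> \<alpha> \<beta> k i \<le> abar i + \<epsilon>"
    "\<And>k. k \<ge> k0 \<Longrightarrow> real_liminf (midas_b t L \<gamma> \<eta> \<alpha>) - \<epsilon> \<le> midas_b t L \<gamma> \<eta> \<alpha> k"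
    using eventually_conj unfolding eventually_sequentially by (metis nle_le order.trans)
  have "(\<Sum>i=1..t+1. abar i + \<epsilon>) = (\<Sum>i=1..t+1. abar i) + (real t + 1) * \<epsilon>" by (simp add: sum.distrib algebra_simps)
  \<comment> \<open>The weights \<open>j + 1\<close> of the condition on \<open>\<delta>\<close>
    only enlarge the sum, as the \<open>abar j\<close> are nonnegative.\<close>
  also have "(\<Sum>i=1..t+1. abar i) \<le> (\<Sum>j=1..t+1. (real j + 1) * abar j)"
  proof (rule sum_mono)
    fix j
    have "0 \<le> abar j" using low[of j] \<gamma> by linarith
    then show "abar j \<le> (real j + 1) * abar j" by (simp add: distrib_right)
  qed
  finally have "(\<Sum>i=1..t+1. abar i + \<epsilon>) \<le> real_liminf (midas_b t L \<gamma> \<eta> \<alpha>) - \<delta> + (real t + 1) * \<epsilon>"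
    unfolding \<delta>_def by simp
  also have "\<delta> = (real t + 3) * \<epsilon>" unfolding \<epsilon>_def by simp
  finally have "(\<Sum>i=1..t+1. abar i + \<epsilon>) < real_liminf (midas_b t L \<gamma> \<eta> \<alpha>) - \<epsilon>"
    using \<epsilon> by (simp add: algebra_simps)
  moreover have "0 \<le> abar i + \<epsilon>" for i using low[of i] \<gamma> \<epsilon> by linarith
  ultimately show "\<exists>a b k0. (\<forall>i. 0 \<le> a i) \<and> (\<Sum>i=1..t+1. a i) < b \<and> (\<forall>k\<ge>k0. b \<le> midas_b t L \<gamma> \<eta> \<alpha> k)
      \<and> (\<forall>k\<ge>k0. \<forall>i\<in>{1..t+1}. midas_a t L \<gamma> \<eta> \<alpha> \<beta> k i \<le> a i)"
    using k0 by (intro exI[of _ "\<lambda>i. abar i + \<epsilon>"] exI[of _ "real_liminf (midas_b t L \<gamma> \<eta> \<alpha>) - \<epsilon>"] exI[of _ k0]) auto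
qed

text \<open>\<open>\<Phi>\<close>, and with it the mean of \<open>\<Psi> 1\<close>, may be negative,
  while the left side is not. Subtracting the minimum of 0 and the infimum of \<open>\<Phi>\<close>
  makes the bracket nonnegative and changes nothing if \<open>\<Phi>\<close> is nonnegative. The
  comparison is made in \<open>ereal\<close> because \<open>ennreal\<close> would turn a negative
  bound into 0.\<close>

theorem theorem2:
  fixes M :: "'w measure" and N :: "'s measure"
    and \<xi> :: "nat \<Rightarrow> 'w \<Rightarrow> mode" and \<zeta> :: "nat \<Rightarrow> 'w \<Rightarrow> nat set \<times> 's"
    and X :: "real^'k::finite^'j::finite^'i::finite" and blk :: "'c::finite \<Rightarrow> 'r::finite"
    and h :: "mode \<Rightarrow> 'r \<Rightarrow> ('i, 'j, 'k, 'c, 'r) factors \<Rightarrow> ereal"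
    and A0 :: "('i, 'j, 'k, 'c, 'r) factors"
    and G A :: "nat \<Rightarrow> 'w \<Rightarrow> ('i, 'j, 'k, 'c, 'r) factors"
    and \<eta> \<alpha> \<beta> :: "nat \<Rightarrow> real" and t B :: nat
    and \<Gamma> \<Upsilon> :: "nat \<Rightarrow> 'w \<Rightarrow> real"
    and V1 V2 V\<Gamma> \<tau> L \<gamma> \<eta>_lo \<eta>_hi c1 c2 b_low a_min \<delta> \<rho> mubar :: real
    and abar :: "nat \<Rightarrow> real"
    and \<Phi> :: "('i, 'j, 'k, 'c, 'r) factors \<Rightarrow> ereal"
    and \<Psi> :: "nat \<Rightarrow> 'w \<Rightarrow> real"
  assumes "prob_space M" and "surj blk" and "1 \<le> t"
    and \<Phi>_def: "\<Phi> = ll1_objective X blk h"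
    and h: "\<And>n r. proper_on (range (piece blk n r)) (h n r)"
      "\<And>n r. lsc_on (range (piece blk n r)) (h n r)"
      "\<And>n r. bounded_below_on (range (piece blk n r)) (h n r)"
      "\<And>n r. ereal_convex_on (range (piece blk n r)) (h n r)"
    and A0: "limiting_subdiff \<Phi> A0 \<noteq> {}"
    and stepsize: "0 < \<eta>_lo" "\<And>k. \<eta>_lo \<le> \<eta> k \<and> \<eta> k \<le> \<eta>_hi"
    and inertia: "\<And>k. 0 \<le> \<alpha> k \<and> \<alpha> k \<le> 1" "\<And>k. 0 \<le> \<beta> k \<and> \<beta> k \<le> 1"
      "\<alpha> \<longlonglongrightarrow> c1" "\<beta> \<longlonglongrightarrow> c2"
    and algorithm: "midas_process M N \<xi> \<zeta> X blk h \<eta> \<alpha> t B A0 G A"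
    and bounded: "\<exists>C. \<forall>k. AE \<omega> in M. norm (A k \<omega>) \<le> C"
    and Lipschitz: "AE \<omega> in M. \<forall>k n Y Z.
      norm (partial_grad X blk n (with_block n Y (A k \<omega>))
          - partial_grad X blk n (with_block n Z (A k \<omega>))) \<le> L * norm (block n (Y - Z))"
    and estimator: "variance_reduced M (history M N \<xi> \<zeta>) t A (grad_error X blk \<beta> t \<xi> G A)
      V1 V2 V\<Gamma> \<tau> \<Gamma> \<Upsilon>"
    and \<gamma>_def: "\<gamma> = sqrt (V\<Gamma> / \<tau> + V1)" and \<gamma>_pos: "0 < \<gamma>"
    and b_low_def: "b_low = real_liminf (midas_b t L \<gamma> \<eta> \<alpha>)"
    and abar_def: "\<And>i. abar i = real_limsup (\<lambda>k. midas_a t L \<gamma> \<eta> \<alpha> \<beta> k i)"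
    and a_min_def: "a_min = Min (abar ` {1..t})"
    and \<delta>_def: "\<delta> = b_low - (\<Sum>j=1..t+1. (real j + 1) * abar j)" and \<delta>_pos: "0 < \<delta>"
    and a_last_pos: "0 < (real t + 2) * abar (t + 1) - \<gamma> / 2"
    and \<rho>_def: "\<rho> = min \<delta> (min ((real t + 2) * abar (t + 1) - \<gamma> / 2) a_min)"
    and \<Psi>_def: "\<Psi> = lyapunov \<Phi> t abar \<tau> \<gamma> A \<Gamma>"
    and mubar_def: "mubar = 3 * Max {6 * L\<^sup>2 + 6 / \<eta>_lo,
      6 * L\<^sup>2 * real t * c2\<^sup>2 + 3 * V1 + 6 * real t / \<eta>_lo * c1\<^sup>2, 3 * V1}"
  shows "(\<exists>\<sigma>. 0 < \<sigma> \<and> \<sigma> < \<rho> \<and> integrable M (\<Psi> 1) \<and>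
      (let bound = (\<lambda>K. mubar / ((\<rho> - \<sigma>) * real K) *
             ((\<integral>\<omega>. \<Psi> 1 \<omega> \<partial>M) - min 0 (real_of_ereal (INF Z. \<Phi> Z))
               + 3 * (\<rho> - \<sigma>) / (\<tau> * mubar) * (\<integral>\<omega>. \<Gamma> 1 \<omega> \<partial>M)))
       in (\<forall>K\<ge>1. enn2ereal (mean_sq_residual M \<Phi> A K) \<le> ereal (bound K)) \<and>
          bound \<in> O(\<lambda>K. 1 / real K))) \<and>
    (\<exists>C>0. \<forall>\<epsilon>. 0 < \<epsilon> \<and> \<epsilon> \<le> 1 \<longrightarrow>
      (\<integral>\<^sup>+ \<omega>. stationarity_time \<Phi> A \<epsilon> \<omega> \<partial>M) \<le> ennreal (C / \<epsilon>\<^sup>2) \<and>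
      (\<forall>K\<ge>1. C / \<epsilon>\<^sup>2 \<le> real K \<longrightarrow> mean_sq_residual M \<Phi> A K \<le> ennreal (\<epsilon>\<^sup>2)))"
proof -
  interpret prob_space M by fact
  have sampling: "midas_sampling M N \<xi> \<zeta> X B" using algorithm unfolding midas_process_def by blast
  obtain lo where bc: "block_composite block (ll1_loss X blk) (grad (ll1_loss X blk))
      (\<lambda>n A. \<Sum>r\<in>UNIV. h n r (piece blk n r A)) lo"
    using block_composite_ll1[OF h(2,3,4)] .
  interpret bc: block_composite block "ll1_loss X blk" "grad (ll1_loss X blk)"
      "\<lambda>n A. \<Sum>r\<in>UNIV. h n r (piece blk n r A)" lo by (rule bc)
  have Phi: "bc.Phi = \<Phi>"
    unfolding \<Phi>_def bc.Phi_def[abs_def] ll1_objective_def[abs_def] ..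
  obtain C where C: "\<And>k. AE \<omega> in M. norm (A k \<omega>) \<le> C" using bounded by blast
  have L: "0 \<le> L"
  proof -
    obtain \<omega> where \<omega>: "\<And>k n Y Z. norm (partial_grad X blk n (with_block n Y (A k \<omega>))
        - partial_grad X blk n (with_block n Z (A k \<omega>))) \<le> L * norm (block n (Y - Z))"
      using eventually_happens'[OF _ Lipschitz] ae_filter_bot by blast
    \<comment> \<open>A direction with a nonzero first block forces the sign of
      \<open>L\<close>.\<close>
    define Y :: "('i, 'j, 'k, 'c, 'r) factors" where "Y = (\<chi> i c. 1, 0, 0)"
    have "block M1 (Y - 0) \<noteq> 0" unfolding Y_def by (simp add: zero_prod_def vec_eq_iff)
    moreover have "0 \<le> L * norm (block M1 (Y - 0))"
      using \<omega>[of M1 Y 0 0] norm_ge_zero order.trans by blast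
    ultimately show ?thesis by (simp add: zero_le_mult_iff)
  qed
  interpret ip: inertial_process M "history M N \<xi> \<zeta>" \<xi> block "ll1_loss X blk" "grad (ll1_loss X blk)"
    "\<lambda>n A. \<Sum>r\<in>UNIV. h n r (piece blk n r A)" lo \<eta> \<alpha> \<beta> t A0 G A "grad_error X blk \<beta> t \<xi> G A" \<Gamma> \<Upsilon>
    L \<gamma> V1 V2 V\<Gamma> \<tau> \<eta>_lo C
  proof (unfold_locales)
    show "subalgebra M (history M N \<xi> \<zeta> k)" for k by (rule subalgebra_history[OF sampling])
    show "sets (history M N \<xi> \<zeta> k) \<subseteq> sets (history M N \<xi> \<zeta> (Suc k))" for k by (rule history_Suc[OF sampling])
    show "\<xi> k \<in> measurable (history M N \<xi> \<zeta> (Suc k)) (count_space UNIV)" for k by (rule mode_measurable_history[OF sampling])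
    show "E \<in> sets (history M N \<xi> \<zeta> k) \<Longrightarrow> prob (E \<inter> {\<omega> \<in> space M. \<xi> k \<omega> = n}) = prob E / 3" for E k n
      by (rule mode_uniform_given_history[OF assms(1) sampling])
    show "0 \<le> ll1_loss X blk A" for A unfolding ll1_loss_def by simp
    show "A k \<in> borel_measurable (history M N \<xi> \<zeta> k)" "G k \<in> borel_measurable (history M N \<xi> \<zeta> (Suc k))" for k
      using algorithm unfolding midas_process_def by blast+
    show "\<omega> \<in> space M \<Longrightarrow> A 0 \<omega> = A0" for \<omega>
      using algorithm unfolding midas_process_def by blast
    show "bc.prox_step (\<xi> k \<omega>) (\<eta> k) (G k \<omega>) (A k \<omega>) (extrapolate \<alpha> t (\<lambda>l. A l \<omega>) k) (A (Suc k) \<omega>)"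
      if "\<omega> \<in> space M" for \<omega> k
      using midas_step_prox_step[OF bc, of \<eta> \<alpha> t "\<xi> k \<omega>" "G k \<omega>" "\<lambda>l. A l \<omega>" k] algorithm that
      unfolding midas_process_def by blast
    show "limiting_subdiff bc.Phi A0 \<noteq> {}" unfolding Phi by (rule A0)
    show "0 < \<eta>_lo" "\<eta>_lo \<le> \<eta> k" for k using stepsize by auto
    show "0 \<le> \<alpha> k" "\<alpha> k \<le> 1" "0 \<le> \<beta> k" "\<beta> k \<le> 1" for k using inertia by auto
    show "AE \<omega> in M. norm (A k \<omega>) \<le> C" for k by (rule C)
    show "AE \<omega> in M. \<forall>k n Y Z.
       norm (block n (grad (ll1_loss X blk) (A k \<omega> + block n (Y - A k \<omega>)))
         - block n (grad (ll1_loss X blk) (A k \<omega> + block n (Z - A k \<omega>)))) \<le> L * norm (block n (Y - Z))"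
      using Lipschitz unfolding partial_grad_def with_block_eq .
    show "0 \<le> L" by (rule L)
    show "grad_error X blk \<beta> t \<xi> G A k \<omega> = norm (block (\<xi> k \<omega>) (G k \<omega>)
       - block (\<xi> k \<omega>) (grad (ll1_loss X blk) (A k \<omega> + block (\<xi> k \<omega>) (extrapolate \<beta> t (\<lambda>l. A l \<omega>) k - A k \<omega>))))" for k \<omega>
      unfolding grad_error_def partial_grad_def grad_point_def with_block_eq ..
  qed (rule estimator \<gamma>_def \<gamma>_pos)+
  have abar_low: "\<gamma> / 2 \<le> abar i" for i
    using midas_coefficients_eventually(1)[OF stepsize inertia(1,2) L \<gamma>_pos abar_def \<delta>_pos[unfolded \<delta>_def b_low_def]] .
  have abar_pos: "0 < abar i" for i using abar_low[of i] \<gamma>_pos by linarith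
  obtain a b k0 where "\<And>i. 0 \<le> a i" "(\<Sum>i=1..t+1. a i) < b"
    "\<And>k. k0 \<le> k \<Longrightarrow> b \<le> midas_b t L \<gamma> \<eta> \<alpha> k"
    "\<And>k i. k0 \<le> k \<Longrightarrow> i \<in> {1..t+1} \<Longrightarrow> midas_a t L \<gamma> \<eta> \<alpha> \<beta> k i \<le> a i"
    using midas_coefficients_eventually(2)[OF stepsize inertia(1,2) L \<gamma>_pos abar_def \<delta>_pos[unfolded \<delta>_def b_low_def]]
    by blast
  then have "summable ip.mean_sq_move" by (rule ip.mean_sq_move_summable)
  then obtain R :: "nat \<Rightarrow> 'w \<Rightarrow> real" where R: "\<And>k. R k \<in> borel_measurable M"
    "AE \<omega> in M. \<forall>k. (dist0 (limiting_subdiff \<Phi> (A k \<omega>)))\<^sup>2 \<le> ennreal (R k \<omega>)"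
    "(\<Sum>k. \<integral>\<^sup>+ \<omega>. ennreal (R k \<omega>) \<partial>M) < \<infinity>"
    using ip.residual_square_summable unfolding Phi by blast
  define s where "s = enn2real (\<Sum>k. \<integral>\<^sup>+ \<omega>. ennreal (R k \<omega>) \<partial>M)"
  have s0: "0 \<le> s" unfolding s_def by simp
  have s: "(\<Sum>k. \<integral>\<^sup>+ \<omega>. ennreal (R k \<omega>) \<partial>M) = ennreal s" unfolding s_def using R(3) by simp
  have mean: "mean_sq_residual M \<Phi> A K \<le> ennreal (s / real K)" if "1 \<le> K" for K
    using R(2) s s0 that by (intro mean_sq_residual_le[where b = R]) (auto elim: eventually_mono)
  have complexity: "\<exists>C>0. \<forall>\<epsilon>. 0 < \<epsilon> \<and> \<epsilon> \<le> 1 \<longrightarrow>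
      (\<integral>\<^sup>+ \<omega>. stationarity_time \<Phi> A \<epsilon> \<omega> \<partial>M) \<le> ennreal (C / \<epsilon>\<^sup>2) \<and>
      (\<forall>K\<ge>1. C / \<epsilon>\<^sup>2 \<le> real K \<longrightarrow> mean_sq_residual M \<Phi> A K \<le> ennreal (\<epsilon>\<^sup>2))"
  \<comment> \<open>\<open>s\<close> itself may be 0, and the constant has to be positive.\<close>
  proof (intro exI[of _ "s + 1"] conjI allI impI)
    show "0 < s + 1" using s0 by simp
    fix \<epsilon> :: real assume "0 < \<epsilon> \<and> \<epsilon> \<le> 1"
    then have \<epsilon>: "0 < \<epsilon>" by simp
    have "(\<integral>\<^sup>+ \<omega>. stationarity_time \<Phi> A \<epsilon> \<omega> \<partial>M) \<le> (\<integral>\<^sup>+ \<omega>. ennreal (1 / \<epsilon>\<^sup>2) * (\<Sum>k. ennreal (R k \<omega>)) \<partial>M)"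
      using R(2) by (intro nn_integral_mono_AE) (auto elim!: eventually_mono intro!: stationarity_time_le \<epsilon>)
    also have "\<dots> = ennreal (1 / \<epsilon>\<^sup>2) * (\<Sum>k. \<integral>\<^sup>+ \<omega>. ennreal (R k \<omega>) \<partial>M)"
      using R(1) by (simp add: nn_integral_cmult nn_integral_suminf)
    also have "\<dots> = ennreal (s / \<epsilon>\<^sup>2)" unfolding s using s0 by (simp flip: ennreal_mult)
    also have "\<dots> \<le> ennreal ((s + 1) / \<epsilon>\<^sup>2)" using \<epsilon> by (intro ennreal_leI divide_right_mono) auto
    finally show "(\<integral>\<^sup>+ \<omega>. stationarity_time \<Phi> A \<epsilon> \<omega> \<partial>M) \<le> ennreal ((s + 1) / \<epsilon>\<^sup>2)" .
    fix K :: nat assume K: "1 \<le> K" "(s + 1) / \<epsilon>\<^sup>2 \<le> real K"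
    have "s / real K \<le> \<epsilon>\<^sup>2"
    proof -
      have "s + 1 \<le> \<epsilon>\<^sup>2 * real K" using K \<epsilon> by (simp add: pos_divide_le_eq mult.commute)
      then have "s \<le> \<epsilon>\<^sup>2 * real K" by simp
      then show ?thesis using K(1) by (simp add: pos_divide_le_eq)
    qed
    then show "mean_sq_residual M \<Phi> A K \<le> ennreal (\<epsilon>\<^sup>2)"
      using mean[OF K(1)] ennreal_leI order.trans by blast
  qed
  define m where "m = real_of_ereal (INF Z. \<Phi> Z)"
  have fin: "\<omega> \<in> space M \<Longrightarrow> \<Phi> (A k \<omega>) = ereal (bc.phi (A k \<omega>))" for k \<omega>
    using ip.Phi_A unfolding Phi by blast
  \<comment> \<open>The infimum is finite: a constant lies below \<open>\<Phi>\<close>, and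
    \<open>\<Phi>\<close> is finite at the initial point. Hence \<open>real_of_ereal\<close> returns
    the infimum itself.\<close>
  have m: "ereal m \<le> \<Phi> Z" for Z
  proof -
    have "ereal (real CARD(mode) * lo) \<le> \<Phi> Z" for Z
    proof (cases "\<bar>\<Phi> Z\<bar> = \<infinity>")
      case True
      moreover have "\<Phi> Z \<noteq> -\<infinity>" unfolding Phi[symmetric] bc.Phi_def
        using sum_ereal_not_MInfty[of UNIV "\<lambda>n. \<Sum>r\<in>UNIV. h n r (piece blk n r Z)"] bc.H_ninf by simp
      ultimately show ?thesis by (cases "\<Phi> Z") auto
    next
      case False
      then have "real CARD(mode) * lo \<le> bc.phi Z"
        using bc.Phi_finite[of Z] unfolding Phi by (intro ip.phi_lower) auto
      then show ?thesis using False unfolding bc.phi_def Phi by (cases "\<Phi> Z") auto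
    qed
    then have "ereal (real CARD(mode) * lo) \<le> (INF Z. \<Phi> Z)" by (intro INF_greatest)
    moreover have "(INF Z. \<Phi> Z) \<le> ereal (bc.phi (A 0 \<omega>))" if "\<omega> \<in> space M" for \<omega>
      using INF_lower[of "A 0 \<omega>" UNIV \<Phi>] fin[OF that] by simp
    ultimately have "ereal m = (INF Z. \<Phi> Z)"
      using not_empty unfolding m_def by (cases "INF Z. \<Phi> Z") auto
    then show ?thesis by (simp add: INF_lower)
  qed
  have m_phi: "m \<le> bc.phi (A k \<omega>)" if "\<omega> \<in> space M" for k \<omega>
    using m[of "A k \<omega>"] unfolding fin[OF that] by simp
  define c where "c i = (\<Sum>j=i..t+1. (real j + 1) * abar j)" for i
  have c0: "0 \<le> c i" for i unfolding c_def using abar_pos by (intro sum_nonneg) (simp add: less_imp_le)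
  have c1: "0 < c 1" unfolding c_def using abar_pos by (intro sum_pos) auto
  have \<Psi>1: "\<Psi> 1 \<omega> = bc.phi (A 1 \<omega>) + (\<Sum>i=1..t+1. c i * (ip.move (1 + 1 - i) \<omega>)\<^sup>2) + 1 / (2 * \<tau> * \<gamma>) * \<Gamma> 1 \<omega>" for \<omega>
    unfolding \<Psi>_def lyapunov_def ip.move_eq c_def bc.phi_def Phi by (simp only: sum_distrib_right)
  have int\<Psi>: "integrable M (\<Psi> 1)"
    unfolding \<Psi>1[abs_def]
    by (intro Bochner_Integration.integrable_add integrable_mult_right Bochner_Integration.integrable_sum
        ip.phi_integrable ip.move_square_integrable ip.\<Gamma>_integrable) simp
  have E\<Psi>: "(\<integral>\<omega>. \<Psi> 1 \<omega> \<partial>M) = (\<integral>\<omega>. bc.phi (A 1 \<omega>) \<partial>M) + (\<Sum>i=1..t+1. c i * ip.mean_sq_move (1 + 1 - i))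
      + 1 / (2 * \<tau> * \<gamma>) * (\<integral>\<omega>. \<Gamma> 1 \<omega> \<partial>M)"
    unfolding \<Psi>1 ip.mean_sq_move_def using ip.phi_integrable ip.move_square_integrable ip.\<Gamma>_integrable by simp
  define g where "g = (\<integral>\<omega>. \<Gamma> 1 \<omega> \<partial>M)"
  have g0: "0 \<le> g" unfolding g_def by (rule ip.integral_\<Gamma>_nonneg) simp
  have \<tau>\<gamma>: "0 < 1 / (2 * \<tau> * \<gamma>)" using ip.variance_constants \<gamma>_pos by simp
  \<comment> \<open>At index 1 the terms with \<open>i \<ge> 2\<close> belong to
    \<open>move 0\<close>; the first one alone detects a move, and its weight \<open>c 1\<close> is
    positive.\<close>
  have split: "(\<Sum>i=1..t+1. c i * ip.mean_sq_move (1 + 1 - i)) = c 1 * ip.mean_sq_move 1 + (\<Sum>i=2..t+1. c i * ip.mean_sq_move (1 + 1 - i))"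
    by (simp add: sum.atLeast_Suc_atMost numeral_2_eq_2)
  have rest: "0 \<le> (\<Sum>i=2..t+1. c i * ip.mean_sq_move (1 + 1 - i))"
    using c0 ip.mean_sq_move_nonneg by (intro sum_nonneg mult_nonneg_nonneg)
  have phi1: "m \<le> (\<integral>\<omega>. bc.phi (A 1 \<omega>) \<partial>M)"
  proof -
    have "m = (\<integral>\<omega>. m \<partial>M)" by (simp add: prob_space)
    also have "\<dots> \<le> (\<integral>\<omega>. bc.phi (A 1 \<omega>) \<partial>M)" by (intro integral_mono ip.phi_integrable m_phi) auto
    finally show ?thesis .
  qed
  have cx: "0 \<le> c 1 * ip.mean_sq_move 1" using c1 ip.mean_sq_move_nonneg by simp
  have \<tau>g: "0 \<le> 1 / (2 * \<tau> * \<gamma>) * g" using \<tau>\<gamma> g0 by (intro mult_nonneg_nonneg) auto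
  define d where "d = (\<integral>\<omega>. \<Psi> 1 \<omega> \<partial>M) - min 0 m"
  have min_m: "min 0 m \<le> m" by simp
  note d_eq = d_def[unfolded E\<Psi> split, folded g_def]
  have d0: "0 \<le> d" using rest phi1 cx \<tau>g min_m d_eq by linarith
  \<comment> \<open>\<open>d\<close> is a sum of nonnegative parts, one of them the excess of the
    mean objective over \<open>m\<close>; if \<open>d\<close> is 0, each part vanishes.\<close>
  have d_zero: "(\<integral>\<omega>. bc.phi (A 1 \<omega>) \<partial>M) = m" "c 1 * ip.mean_sq_move 1 = 0" "1 / (2 * \<tau> * \<gamma>) * g = 0" if "d = 0"
    using rest phi1 cx \<tau>g min_m d_eq that by linarith+
  have \<rho>: "0 < \<rho>"
  proof -
    have "0 < a_min" unfolding a_min_def using abar_pos \<open>1 \<le> t\<close> by (subst Min_gr_iff) auto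
    then show ?thesis unfolding \<rho>_def using \<delta>_pos a_last_pos by simp
  qed
  have mubar: "0 < mubar"
  proof -
    have "0 < 6 * L\<^sup>2 + 6 / \<eta>_lo" using stepsize(1) by (intro add_nonneg_pos) auto
    then show ?thesis unfolding mubar_def by (subst zero_less_mult_iff) (auto simp: Max_gr_iff)
  qed
  have \<tau>: "0 < \<tau>" by (rule ip.variance_constants)
  obtain \<sigma> where \<sigma>: "0 < \<sigma>" "\<sigma> < \<rho>"
    and main: "\<And>K. 1 \<le> K \<Longrightarrow> mean_sq_residual M \<Phi> A K \<le> ennreal (mubar / (\<rho> - \<sigma>) * d / real K)"
  proof (cases "d = 0")
    case True
    then have E: "(\<integral>\<omega>. bc.phi (A 1 \<omega>) \<partial>M) = m" "ip.mean_sq_move 1 = 0" "g = 0"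
      using d_zero c1 \<tau>\<gamma> by auto
    have "AE \<omega> in M. (ip.move 1 \<omega>)\<^sup>2 = 0"
      using E(2) integral_nonneg_eq_0_iff_AE[OF ip.move_square_integrable] unfolding ip.mean_sq_move_def by auto
    then have A1: "AE \<omega> in M. A 1 \<omega> = A0"
      using AE_space by eventually_elim (simp add: ip.move_def ip.A_init)
    then have "(\<integral>\<omega>. bc.phi (A 1 \<omega>) \<partial>M) = (\<integral>\<omega>. bc.phi A0 \<partial>M)"
      by (intro integral_cong_AE) (auto elim: eventually_mono)
    then have "bc.phi A0 = m" using E(1) by (simp add: prob_space)
    moreover obtain \<omega>0 where \<omega>0: "\<omega>0 \<in> space M" using not_empty by blast
    ultimately have "\<Phi> A0 = ereal m" using fin[OF \<omega>0, of 0] ip.A_init[OF \<omega>0] by simp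
    then have min: "\<Phi> A0 \<le> \<Phi> y" for y using m by simp
    have dist: "dist0 (limiting_subdiff \<Phi> A0) = 0"
      using bc.dist0_minimizer[of A0] ip.H_finite[OF \<omega>0, of _ 0] ip.A_init[OF \<omega>0] min unfolding Phi by simp
    \<comment> \<open>All residuals are 0 here, so any \<open>\<sigma>\<close> between 0 and
      \<open>\<rho>\<close> will do, for instance \<open>\<rho> / 2\<close>.\<close>
    have "AE \<omega> in M. (dist0 (limiting_subdiff \<Phi> (A k \<omega>)))\<^sup>2 \<le> ennreal 0" for k
      using ip.stationary_start[OF A1 E(3)[unfolded g_def], unfolded Phi, OF min, of k]
      by eventually_elim (simp add: dist)
    from mean_sq_residual_le[OF this, of 0] have "mean_sq_residual M \<Phi> A K \<le> ennreal 0" if "1 \<le> K" for K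
      using that by simp
    then show thesis using that[of "\<rho> / 2"] \<rho> True by simp
  next
    case False
    then have d: "0 < d" using d0 by simp
    \<comment> \<open>The second argument makes \<open>mubar / (\<rho> - \<sigma>) * d\<close> at
      least \<open>s + 1\<close>; the first one keeps \<open>\<sigma>\<close> positive.\<close>
    define \<sigma> where "\<sigma> = max (\<rho> / 2) (\<rho> - mubar * d / (s + 1))"
    have q: "0 < mubar * d / (s + 1)" using mubar d s0 by simp
    have \<sigma>: "0 < \<sigma>" "\<sigma> < \<rho>" unfolding \<sigma>_def using \<rho> q by auto
    have "\<rho> - \<sigma> \<le> mubar * d / (s + 1)" unfolding \<sigma>_def by simp
    then have "(\<rho> - \<sigma>) * (s + 1) \<le> mubar * d" using s0 by (simp add: pos_le_divide_eq)
    then have "s + 1 \<le> mubar / (\<rho> - \<sigma>) * d" using \<sigma>(2) by (simp add: pos_le_divide_eq mult.commute)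
    then have "s / real K \<le> mubar / (\<rho> - \<sigma>) * d / real K" for K by (intro divide_right_mono) auto
    then show thesis using that[OF \<sigma>] mean ennreal_leI order.trans by meson
  qed
  define bound where "bound K = mubar / ((\<rho> - \<sigma>) * real K) * (d + 3 * (\<rho> - \<sigma>) / (\<tau> * mubar) * g)" for K :: nat
  have bound_ge: "mubar / (\<rho> - \<sigma>) * d / real K \<le> bound K" for K
  proof -
    have "mubar / (\<rho> - \<sigma>) * d / real K = mubar / ((\<rho> - \<sigma>) * real K) * d" by simp
    also have "\<dots> \<le> bound K" unfolding bound_def using \<sigma> mubar \<tau> g0 by (intro mult_left_mono) auto
    finally show ?thesis .
  qed
  have "enn2ereal (mean_sq_residual M \<Phi> A K) \<le> ereal (bound K)" if "1 \<le> K" for K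
  proof -
    have "mean_sq_residual M \<Phi> A K \<le> ennreal (bound K)"
      using main[OF that] bound_ge ennreal_leI order.trans by blast
    moreover have "0 \<le> bound K" using \<sigma> mubar \<tau> g0 d0 unfolding bound_def by simp
    ultimately show ?thesis by (metis enn2ereal_ennreal less_eq_ennreal.rep_eq)
  qed
  moreover have "bound \<in> O(\<lambda>K. 1 / real K)"
  proof (rule bigoI[where c = "\<bar>mubar / (\<rho> - \<sigma>) * (d + 3 * (\<rho> - \<sigma>) / (\<tau> * mubar) * g)\<bar>"], intro always_eventually allI)
    fix K :: nat
    have "bound K = mubar / (\<rho> - \<sigma>) * (d + 3 * (\<rho> - \<sigma>) / (\<tau> * mubar) * g) * (1 / real K)"
      unfolding bound_def by simp
    then show "norm (bound K) \<le> \<bar>mubar / (\<rho> - \<sigma>) * (d + 3 * (\<rho> - \<sigma>) / (\<tau> * mubar) * g)\<bar> * norm (1 / real K)"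
      by (simp only: real_norm_def abs_mult)
  qed
  ultimately show ?thesis
    using \<sigma> int\<Psi> complexity unfolding Let_def bound_def[abs_def] d_def m_def g_def by blast
qed

end
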